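(* Let $W$ be a vector space over $\mathbb C$. Every maximal quasi-compatible subspace of $\mathcal E^o(W)=\operatorname{Hom}(W,W((x^{-1})))$ is closed and contains $1_W$. Furthermore, for any quasi-compatible subset $S$ of $\mathcal E^o(W)$, there exists a (unique) smallest closed quasi-compatible subspace $\langle S\rangle$ containing $S$ and $1_W$, and $(\langle S\rangle,Y_{\mathcal E^o},1_W)$ carries the structure of a nonlocal vertex algebra with $W$ as a faithful (left) quasi module-at-infinity, where the vertex operator map $Y_W$ is given by $Y_W(\psi(x),x_0)=\psi(x_0)$. If $S$ is compatible, then $W$ is a module-at-infinity for $\langle S\rangle$.
   Context: All vector spaces are over $\mathbb C$; $\mathbb N=\{0,1,2,\dots\}$; powers $(y+z)^n$ of binomials are expanded in nonnegative powers of the second variable $z$. $W((x_1^{-1},\dots,x_r^{-1}))$ denotes $W[[x_1^{-1},\dots,x_r^{-1}]][x_1,\dots,x_r]$. $1_W$ is the identity operator on $W$. $\iota_{x,\infty;x_0,0}:\mathbb C(x,x_0)\to\mathbb C((x^{-1}))((x_0))$ is the unique field embedding extending the inclusion of $\mathbb C[x,x_0]$. For $A\in\operatorname{Hom}(W,W((x_1^{-1},x^{-1})))$, $A(x_1,x)|_{x_1=x+x_0}=\big(e^{x_0\partial/\partial x_1}A(x_1,x)\big)|_{x_1=x}$. **(Quasi-)compatible.** A finite ordered sequence $a_1(x),\dots,a_r(x)$ in $\mathcal E^o(W)$ is quasi-compatible if there is a nonzero polynomial $p(x_1,x_2)$ with $\big(\prod_{1\le i<j\le r}p(x_i,x_j)\big)a_1(x_1)\cdots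 a_r(x_r)\in\operatorname{Hom}(W,W((x_1^{-1},\dots,x_r^{-1})))$, and compatible if this holds with $p(x_1,x_2)=(x_1-x_2)^k$ for some $k\in\mathbb N$. A subset is quasi-compatible (compatible) if every finite sequence in it is. A maximal quasi-compatible subspace is one maximal under inclusion among quasi-compatible subspaces. **Operation $Y_{\mathcal E^o}$ and closedness.** For a quasi-compatible pair $(a(x),b(x))$ choose a nonzero polynomial $p$ with $p(x_1,x_2)a(x_1)b(x_2)\in\operatorname{Hom}(W,W((x_1^{-1},x_2^{-1})))$ and set $$Y_{\mathcal E^o}(a(x),x_0)b(x)=\sum_{n\in\mathbb Z}a(x)_nb(x)\,x_0^{-n-1}=\iota_{x,\infty;x_0,0}\big(1/p(x_0+x,x)\big)\big(p(x_1,x)a(x_1)b(x)\big)|_{x_1=x+x_0}\in\mathcal E^o(W)((x_0)),$$ independent of the choice of $p$. A quasi-compatible subspace $K$ is closed if $a(x)_nb(x)\in K$ for all $a(x),b(x)\in K$, $n\in\mathbb Z$. **Nonlocal vertex algebra.** A vector space $V$ with a linear map $Y:V\to\operatorname{Hom}(V,V((x)))$ and $\mathbf 1\in V$ such that $Y(\mathbf 1,x)v=v$, $Y(v,x)\mathbf 1\in V[[x]]$, $\lim_{x\to0}Y(v,x)\mathbf 1=v$, and for all $u,v,w$ there is $l\in\mathbb N$ with $(x_0+x_2)^lY(u,x_0+x_2)Y(v,x_2)w=(x_0+x_2)^lY(Y(u,x_0)v,x_2)w$. **Quasi module-at-infinity.** For a nonlocal vertex algebra $V$: a vector space $W$ with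 a linear map $Y_W:V\to\operatorname{Hom}(W,W((x^{-1})))$ such that $Y_W(\mathbf 1,x)=1_W$ and for any $u,v\in V$ there is a nonzero polynomial $p(x_1,x_2)$ with $p(x_1,x_2)Y_W(u,x_1)Y_W(v,x_2)\in\operatorname{Hom}(W,W((x_1^{-1},x_2^{-1})))$ and $p(x_0+x_2,x_2)Y_W(Y(u,x_0)v,x_2)=\big(p(x_1,x_2)Y_W(u,x_1)Y_W(v,x_2)\big)|_{x_1=x_2+x_0}$. It is a module-at-infinity if for any $u,v$ one can take $p=(x_1-x_2)^k$ with $k\in\mathbb N$. It is faithful if $Y_W$ is injective. *)

theory Defs
  imports
    "HOL-Computational_Algebra.Computational_Algebra"
    "HOL-Library.Function_Algebras"
    "HOL-Library.Poly_Mapping"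
begin

text \<open>
  A vector space over the complex numbers is a type together with a scalar multiplication \<open>s\<close>
  satisfying \<^const>\<open>vector_space\<close>; subspaces of it are sets satisfying \<open>module.subspace s\<close>.
  Formal series are coefficient functions, and a series-valued map \<open>a\<close> is represented by
  \<open>a w n\<close> = coefficient of \<open>x\<^sup>n\<close> in \<open>a(x)w\<close>.  Throughout, the integer argument is the actual
  exponent of the variable, so that a mode \<open>a\<^sub>n b\<close> is the coefficient at exponent \<open>-n-1\<close>.
  Function types carry the pointwise addition of \<^theory>\<open>HOL-Library.Function_Algebras\<close>.
\<close>

definition pscale :: "(complex \<Rightarrow> 'v \<Rightarrow> 'v) \<Rightarrow> complex \<Rightarrow> ('i \<Rightarrow> 'v) \<Rightarrow> ('i \<Rightarrow> 'v)" where
  "pscale s c f = (\<lambda>i. s c (f i))"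

definition linear_on_set ::
  "'a::ab_group_add set \<Rightarrow> (complex \<Rightarrow> 'a \<Rightarrow> 'a) \<Rightarrow> (complex \<Rightarrow> 'b::ab_group_add \<Rightarrow> 'b)
    \<Rightarrow> ('a \<Rightarrow> 'b) \<Rightarrow> bool" where
  "linear_on_set V s1 s2 f \<longleftrightarrow>
     (\<forall>u\<in>V. \<forall>v\<in>V. f (u + v) = f u + f v) \<and> (\<forall>c. \<forall>v\<in>V. f (s1 c v) = s2 c (f v))"


section \<open>Series spaces\<close>

text \<open>\<open>W((x\<^sup>-\<^sup>1))\<close>, \<open>W((x\<^sub>1\<^sup>-\<^sup>1,x\<^sub>2\<^sup>-\<^sup>1))\<close> and \<open>W((x\<^sub>1\<^sup>-\<^sup>1,\<dots>,x\<^sub>r\<^sup>-\<^sup>1))\<close>: the exponents occurring are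
  bounded above, jointly in all variables.  In the last case a monomial is the list of its
  \<open>r\<close> exponents.\<close>

definition laurent_inf :: "(int \<Rightarrow> 'w::zero) set" where
  "laurent_inf = {f. \<exists>N. \<forall>n. f n \<noteq> 0 \<longrightarrow> n \<le> N}"

definition laurent_inf2 :: "(int \<Rightarrow> int \<Rightarrow> 'w::zero) set" where
  "laurent_inf2 = {f. \<exists>N. \<forall>m n. f m n \<noteq> 0 \<longrightarrow> m \<le> N \<and> n \<le> N}"

definition laurent_inf_list :: "nat \<Rightarrow> (int list \<Rightarrow> 'w::zero) set" where
  "laurent_inf_list r =
     {f. \<exists>N. \<forall>es. f es \<noteq> 0 \<longrightarrow> length es = r \<and> (\<forall>e\<in>set es. e \<le> N)}"

definition Eo :: "(complex \<Rightarrow> 'w::ab_group_add \<Rightarrow> 'w) \<Rightarrow> ('w \<Rightarrow> int \<Rightarrow> 'w) set" where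
  "Eo s = {a. Vector_Spaces.linear s (pscale s) a \<and> (\<forall>w. a w \<in> laurent_inf)}"

definition Hom_inf2 :: "(complex \<Rightarrow> 'w::ab_group_add \<Rightarrow> 'w) \<Rightarrow> ('w \<Rightarrow> int \<Rightarrow> int \<Rightarrow> 'w) set" where
  "Hom_inf2 s =
     {A. Vector_Spaces.linear s (pscale (pscale s)) A \<and> (\<forall>w. A w \<in> laurent_inf2)}"

definition Hom_inf_list ::
  "nat \<Rightarrow> (complex \<Rightarrow> 'w::ab_group_add \<Rightarrow> 'w) \<Rightarrow> ('w \<Rightarrow> int list \<Rightarrow> 'w) set" where
  "Hom_inf_list r s =
     {A. Vector_Spaces.linear s (pscale s) A \<and> (\<forall>w. A w \<in> laurent_inf_list r)}"

definition id_op :: "'w \<Rightarrow> int \<Rightarrow> 'w::zero" where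
  "id_op w n = (if n = 0 then w else 0)"


section \<open>Polynomials acting on series\<close>

text \<open>A polynomial in two variables is a \<^typ>\<open>complex poly poly\<close>, the outer variable
  (\<open>var1\<close>) being the first and the inner variable (\<open>var2\<close>) the second one.  Hence
  \<open>pcompose p (var1 + var2)\<close> is \<open>p(x\<^sub>0 + x, x)\<close> in the variables \<open>(x\<^sub>0, x)\<close>.\<close>

definition var1 :: "complex poly poly" where "var1 = [:0, 1:]"

definition var2 :: "complex poly poly" where "var2 = [:[:0, 1:]:]"

definition pmul ::
  "(complex \<Rightarrow> 'w::comm_monoid_add \<Rightarrow> 'w) \<Rightarrow> complex poly poly \<Rightarrow> (int \<Rightarrow> int \<Rightarrow> 'w)
    \<Rightarrow> (int \<Rightarrow> int \<Rightarrow> 'w)" where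
  "pmul s p A = (\<lambda>m n. \<Sum>i\<le>degree p. \<Sum>j\<le>degree (coeff p i).
     s (coeff (coeff p i) j) (A (m - int i) (n - int j)))"

text \<open>Polynomials in \<open>x\<^sub>0, x\<^sub>1, \<dots>\<close>, as finitely supported functions on monomials;
  \<open>at_vars p i j\<close> is \<open>p(x\<^sub>i, x\<^sub>j)\<close>.  Variables are numbered from \<open>0\<close>.\<close>

definition at_vars :: "complex poly poly \<Rightarrow> nat \<Rightarrow> nat \<Rightarrow> (nat \<Rightarrow>\<^sub>0 nat) \<Rightarrow>\<^sub>0 complex" where
  "at_vars p i j = (\<Sum>k\<le>degree p. \<Sum>l\<le>degree (coeff p k).
     Poly_Mapping.single (Poly_Mapping.single i k + Poly_Mapping.single j l)
       (coeff (coeff p k) l))"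

definition pmul_list ::
  "(complex \<Rightarrow> 'w::comm_monoid_add \<Rightarrow> 'w) \<Rightarrow> ((nat \<Rightarrow>\<^sub>0 nat) \<Rightarrow>\<^sub>0 complex)
    \<Rightarrow> (int list \<Rightarrow> 'w) \<Rightarrow> (int list \<Rightarrow> 'w)" where
  "pmul_list s q A = (\<lambda>es. \<Sum>\<mu>\<in>Poly_Mapping.keys q.
     s (Poly_Mapping.lookup q \<mu>)
       (A (map (\<lambda>i. es ! i - int (Poly_Mapping.lookup \<mu> i)) [0..<length es])))"

text \<open>The products \<open>a(x\<^sub>1)b(x\<^sub>2)w\<close> and \<open>a\<^sub>1(x\<^sub>1)\<cdots>a\<^sub>r(x\<^sub>r)w\<close>.\<close>

definition op_prod ::
  "('w \<Rightarrow> int \<Rightarrow> 'w) \<Rightarrow> ('w \<Rightarrow> int \<Rightarrow> 'w) \<Rightarrow> 'w \<Rightarrow> int \<Rightarrow> int \<Rightarrow> 'w" where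
  "op_prod a b w = (\<lambda>m n. a (b w n) m)"

definition op_prod_list :: "('w \<Rightarrow> int \<Rightarrow> 'w::zero) list \<Rightarrow> 'w \<Rightarrow> int list \<Rightarrow> 'w" where
  "op_prod_list as w es =
     (if length es = length as then foldr (\<lambda>(a, e) v. a v e) (zip as es) w else 0)"


section \<open>Compatibility\<close>

definition compat_via ::
  "(complex \<Rightarrow> 'w::ab_group_add \<Rightarrow> 'w) \<Rightarrow> complex poly poly \<Rightarrow> ('w \<Rightarrow> int \<Rightarrow> 'w) list \<Rightarrow> bool" where
  "compat_via s p as \<longleftrightarrow>
     (\<lambda>w. pmul_list s (\<Prod>(i, j)\<in>{(i, j). i < j \<and> j < length as}. at_vars p i j)
            (op_prod_list as w)) \<in> Hom_inf_list (length as) s"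

definition quasi_compatible_seq ::
  "(complex \<Rightarrow> 'w::ab_group_add \<Rightarrow> 'w) \<Rightarrow> ('w \<Rightarrow> int \<Rightarrow> 'w) list \<Rightarrow> bool" where
  "quasi_compatible_seq s as \<longleftrightarrow> (\<exists>p. p \<noteq> 0 \<and> compat_via s p as)"

definition compatible_seq ::
  "(complex \<Rightarrow> 'w::ab_group_add \<Rightarrow> 'w) \<Rightarrow> ('w \<Rightarrow> int \<Rightarrow> 'w) list \<Rightarrow> bool" where
  "compatible_seq s as \<longleftrightarrow> (\<exists>k. compat_via s ((var1 - var2) ^ k) as)"

definition quasi_compatible ::
  "(complex \<Rightarrow> 'w::ab_group_add \<Rightarrow> 'w) \<Rightarrow> ('w \<Rightarrow> int \<Rightarrow> 'w) set \<Rightarrow> bool" where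
  "quasi_compatible s S \<longleftrightarrow> S \<subseteq> Eo s \<and> (\<forall>as. set as \<subseteq> S \<longrightarrow> quasi_compatible_seq s as)"

definition compatible ::
  "(complex \<Rightarrow> 'w::ab_group_add \<Rightarrow> 'w) \<Rightarrow> ('w \<Rightarrow> int \<Rightarrow> 'w) set \<Rightarrow> bool" where
  "compatible s S \<longleftrightarrow> S \<subseteq> Eo s \<and> (\<forall>as. set as \<subseteq> S \<longrightarrow> compatible_seq s as)"

definition quasi_compatible_subspace ::
  "(complex \<Rightarrow> 'w::ab_group_add \<Rightarrow> 'w) \<Rightarrow> ('w \<Rightarrow> int \<Rightarrow> 'w) set \<Rightarrow> bool" where
  "quasi_compatible_subspace s K \<longleftrightarrow>
     module.subspace (pscale (pscale s)) K \<and> quasi_compatible s K"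

definition maximal_quasi_compatible_subspace ::
  "(complex \<Rightarrow> 'w::ab_group_add \<Rightarrow> 'w) \<Rightarrow> ('w \<Rightarrow> int \<Rightarrow> 'w) set \<Rightarrow> bool" where
  "maximal_quasi_compatible_subspace s K \<longleftrightarrow>
     quasi_compatible_subspace s K \<and>
     (\<forall>K'. quasi_compatible_subspace s K' \<and> K \<subseteq> K' \<longrightarrow> K' = K)"


section \<open>The expansion \<open>\<iota>\<close>\<close>

text \<open>\<open>\<complex>((x\<^sup>-\<^sup>1))((x\<^sub>0))\<close> is \<^typ>\<open>complex fls fls\<close>: the outer indeterminate is \<open>x\<^sub>0\<close>, the inner
  one is \<open>x\<^sup>-\<^sup>1\<close>, so \<open>x\<close> is \<^const>\<open>fls_X_inv\<close>.  Elements of \<open>\<complex>[x,x\<^sub>0]\<close> are bivariate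
  polynomials with outer variable \<open>x\<^sub>0\<close>.\<close>

definition emb_x :: "complex poly \<Rightarrow> complex fls" where
  "emb_x q = poly (map_poly fls_const q) fls_X_inv"

definition emb :: "complex poly poly \<Rightarrow> complex fls fls" where
  "emb p = poly (map_poly (\<lambda>q. fls_const (emb_x q)) p) fls_X"

lemma poly_map_poly_hom:
  fixes h :: "'a::comm_ring_1 \<Rightarrow> 'b::comm_ring_1"
  assumes h0: "h 0 = 0" and h1: "h 1 = 1" and ha: "\<And>a b. h (a + b) = h a + h b"
    and hm: "\<And>a b. h (a * b) = h a * h b"
  shows "poly (map_poly h (p + q)) z = poly (map_poly h p) z + poly (map_poly h q) z"
    and "poly (map_poly h (p * q)) z = poly (map_poly h p) z * poly (map_poly h q) z"
    and "poly (map_poly h 1) z = 1"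
proof -
  have add: "poly (map_poly h (p + q)) z = poly (map_poly h p) z + poly (map_poly h q) z" for p q
  proof -
    have "map_poly h (p + q) = map_poly h p + map_poly h q"
      by (rule poly_eqI) (simp add: coeff_map_poly h0 ha)
    thus ?thesis by simp
  qed
  have smult: "poly (map_poly h (smult c q)) z = h c * poly (map_poly h q) z" for c q
  proof -
    have "map_poly h (smult c q) = smult (h c) (map_poly h q)"
      by (rule poly_eqI) (simp add: coeff_map_poly h0 hm)
    thus ?thesis by simp
  qed
  have pc: "poly (map_poly h (pCons c q)) z = h c + z * poly (map_poly h q) z" for c q
    by (simp add: map_poly_pCons h0)
  show "poly (map_poly h (p + q)) z = poly (map_poly h p) z + poly (map_poly h q) z"
    by (rule add)
  show "poly (map_poly h (p * q)) z = poly (map_poly h p) z * poly (map_poly h q) z"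
    by (induction p) (simp_all add: add smult pc h0 algebra_simps)
  show "poly (map_poly h 1) z = 1"
    by (simp add: map_poly_1' h1)
qed

lemma emb_x_hom:
  "emb_x 0 = 0" "emb_x (p + q) = emb_x p + emb_x q" "emb_x (p * q) = emb_x p * emb_x q" "emb_x 1 = 1"
  unfolding emb_x_def by (simp_all add: poly_map_poly_hom[of fls_const] fls_plus_const)

lemma emb_hom:
  "emb 0 = 0" "emb (p + q) = emb p + emb q" "emb (p * q) = emb p * emb q" "emb 1 = 1"
  unfolding emb_def
  by (simp_all add: poly_map_poly_hom[of "\<lambda>q. fls_const (emb_x q)"] emb_x_hom fls_plus_const)

lemma fls_nth_emb_x: "fls_nth (emb_x q) (- int n) = coeff q n"
proof -
  have "fls_nth (emb_x q) (- int n) =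
      (\<Sum>i\<le>degree (map_poly fls_const q).
         if n = i then coeff q i else 0)"
    unfolding emb_x_def poly_altdef
    by (intro sum.cong trans[OF fls_nth_sum]) (auto simp: coeff_map_poly)
  also have "\<dots> = coeff q n"
    by (auto simp: sum.delta' degree_map_poly coeff_eq_0 not_le)
  finally show ?thesis .
qed

lemma emb_x_eq_0_iff: "emb_x q = 0 \<longleftrightarrow> q = 0"
  by (metis emb_x_hom(1) fls_nth_emb_x fls_zero_nth poly_eqI coeff_0)

lemma fls_nth_emb: "fls_nth (emb p) (int n) = emb_x (coeff p n)"
proof -
  have "degree (map_poly (\<lambda>q. fls_const (emb_x q)) p) = degree p"
    by (rule degree_map_poly) (simp add: emb_x_eq_0_iff)
  hence "fls_nth (emb p) (int n) = (\<Sum>i\<le>degree p. if n = i then emb_x (coeff p i) else 0)"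
    unfolding emb_def poly_altdef
    by (intro sum.cong trans[OF fls_nth_sum]) (auto simp: coeff_map_poly emb_x_hom)
  also have "\<dots> = emb_x (coeff p n)"
    by (auto simp: sum.delta' coeff_eq_0 not_le emb_x_hom)
  finally show ?thesis .
qed

lemma emb_eq_0_iff: "emb p = 0 \<longleftrightarrow> p = 0"
  by (metis emb_hom(1) fls_nth_emb fls_zero_nth poly_eqI coeff_0 emb_x_eq_0_iff)

definition iota :: "complex poly poly fract \<Rightarrow> complex fls fls" where
  "iota q = (THE z. \<exists>f g. g \<noteq> 0 \<and> q = Fract f g \<and> z = emb f / emb g)"

lemma iota_Fract:
  assumes "g \<noteq> 0"
  shows "iota (Fract f g) = emb f / emb g"
  unfolding iota_def
proof (rule the_equality)
  show "\<exists>f' g'. g' \<noteq> 0 \<and> Fract f g = Fract f' g' \<and> emb f / emb g = emb f' / emb g'"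
    using assms by blast
next
  fix z assume "\<exists>f' g'. g' \<noteq> 0 \<and> Fract f g = Fract f' g' \<and> z = emb f' / emb g'"
  then obtain f' g' where g': "g' \<noteq> 0" and eq: "Fract f g = Fract f' g'" and z: "z = emb f' / emb g'"
    by blast
  from eq have "f * g' = f' * g" using assms g' by (simp add: eq_fract)
  hence "emb f * emb g' = emb f' * emb g" by (metis emb_hom(3))
  thus "z = emb f / emb g" using assms g' by (simp add: z frac_eq_eq emb_eq_0_iff)
qed

text \<open>\<open>iota\<close> is a field embedding extending the inclusion of \<open>\<complex>[x,x\<^sub>0]\<close>, and it is the only one.\<close>

lemma iota_extends: "iota (Fract f 1) = emb f"
  by (simp add: iota_Fract emb_hom)

lemma iota_add: "iota (a + b) = iota a + iota b"
  by (cases a; cases b) (simp add: iota_Fract emb_hom add_frac_eq emb_eq_0_iff)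

lemma iota_mult: "iota (a * b) = iota a * iota b"
  by (cases a; cases b) (simp add: iota_Fract emb_hom)

lemma iota_unique:
  fixes h :: "complex poly poly fract \<Rightarrow> complex fls fls"
  assumes "\<And>a b. h (a * b) = h a * h b" and "\<And>f. h (Fract f 1) = emb f"
  shows "h = iota"
proof
  fix a :: "complex poly poly fract"
  obtain f g where a: "a = Fract f g" and g: "g \<noteq> 0" by (cases a)
  have "a * Fract g 1 = Fract f 1"
    using g by (simp add: a eq_fract)
  hence "h a * emb g = emb f"
    by (metis assms)
  thus "h a = iota a"
    using g by (simp add: a iota_Fract emb_eq_0_iff field_simps)
qed

text \<open>The action of \<open>\<complex>((x\<^sup>-\<^sup>1))((x\<^sub>0))\<close> on \<open>W((x\<^sup>-\<^sup>1))((x\<^sub>0))\<close>; the first exponent of the series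
  is that of \<open>x\<^sub>0\<close>.\<close>

definition fls_mul ::
  "(complex \<Rightarrow> 'w::comm_monoid_add \<Rightarrow> 'w) \<Rightarrow> complex fls fls \<Rightarrow> (int \<Rightarrow> int \<Rightarrow> 'w)
    \<Rightarrow> (int \<Rightarrow> int \<Rightarrow> 'w)" where
  "fls_mul s g F = (\<lambda>k n. Sum_any (\<lambda>(i, j). s (fls_nth (fls_nth g i) (- j)) (F (k - i) (n - j))))"


section \<open>Substitutions\<close>

definition deriv1 ::
  "(complex \<Rightarrow> 'w \<Rightarrow> 'w) \<Rightarrow> (int \<Rightarrow> int \<Rightarrow> 'w) \<Rightarrow> (int \<Rightarrow> int \<Rightarrow> 'w)" where
  "deriv1 s A = (\<lambda>m n. s (of_int (m + 1)) (A (m + 1) n))"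

text \<open>\<open>A(x\<^sub>1,x)|\<close> at \<open>x\<^sub>1 = x + x\<^sub>0\<close>, i.e. \<open>exp(x\<^sub>0 \<partial>/\<partial>x\<^sub>1) A(x\<^sub>1,x)\<close> with \<open>x\<^sub>1\<close> then set to \<open>x\<close>, for
  \<open>A\<close> in \<open>W((x\<^sub>1\<^sup>-\<^sup>1,x\<^sup>-\<^sup>1))\<close>; the first exponent of the result is that of \<open>x\<^sub>0\<close>, the second that
  of \<open>x\<close>.\<close>

definition taylor_subst ::
  "(complex \<Rightarrow> 'w::comm_monoid_add \<Rightarrow> 'w) \<Rightarrow> (int \<Rightarrow> int \<Rightarrow> 'w) \<Rightarrow> (int \<Rightarrow> int \<Rightarrow> 'w)" where
  "taylor_subst s A = (\<lambda>k n. if k < 0 then 0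
     else Sum_any (\<lambda>m. s (1 / fact (nat k)) ((deriv1 s ^^ nat k) A m (n - m))))"

text \<open>\<open>A(x\<^sub>0 + x\<^sub>2, x\<^sub>2)\<close>, where \<open>(x\<^sub>0 + x\<^sub>2)\<^sup>m\<close> is expanded in nonnegative powers of \<open>x\<^sub>2\<close>.\<close>

definition binom_subst ::
  "(complex \<Rightarrow> 'w::comm_monoid_add \<Rightarrow> 'w) \<Rightarrow> (int \<Rightarrow> int \<Rightarrow> 'w) \<Rightarrow> (int \<Rightarrow> int \<Rightarrow> 'w)" where
  "binom_subst s A = (\<lambda>k n. Sum_any (\<lambda>j::nat.
     s (of_int (k + int j) gchoose j) (A (k + int j) (n - int j))))"


section \<open>The operation \<open>Y\<close> on \<open>Eo\<close> and closedness\<close>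

text \<open>\<open>Y_Eo s a b k\<close> is the coefficient of \<open>x\<^sub>0\<^sup>k\<close> in \<open>Y(a(x),x\<^sub>0)b(x)\<close>; it is meaningful for
  quasi-compatible pairs \<open>(a,b)\<close> only.\<close>

definition Y_Eo ::
  "(complex \<Rightarrow> 'w::ab_group_add \<Rightarrow> 'w) \<Rightarrow> ('w \<Rightarrow> int \<Rightarrow> 'w) \<Rightarrow> ('w \<Rightarrow> int \<Rightarrow> 'w)
    \<Rightarrow> int \<Rightarrow> ('w \<Rightarrow> int \<Rightarrow> 'w)" where
  "Y_Eo s a b =
     (let p = (SOME p. p \<noteq> 0 \<and> (\<lambda>w. pmul s p (op_prod a b w)) \<in> Hom_inf2 s)
      in (\<lambda>k w. fls_mul s (iota (Fract 1 (pcompose p (var1 + var2))))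
                  (taylor_subst s (pmul s p (op_prod a b w))) k))"

definition mode ::
  "(complex \<Rightarrow> 'w::ab_group_add \<Rightarrow> 'w) \<Rightarrow> ('w \<Rightarrow> int \<Rightarrow> 'w) \<Rightarrow> int \<Rightarrow> ('w \<Rightarrow> int \<Rightarrow> 'w)
    \<Rightarrow> ('w \<Rightarrow> int \<Rightarrow> 'w)" where
  "mode s a n b = Y_Eo s a b (- n - 1)"

definition Y_closed ::
  "(complex \<Rightarrow> 'w::ab_group_add \<Rightarrow> 'w) \<Rightarrow> ('w \<Rightarrow> int \<Rightarrow> 'w) set \<Rightarrow> bool" where
  "Y_closed s K \<longleftrightarrow> (\<forall>a\<in>K. \<forall>b\<in>K. \<forall>n. mode s a n b \<in> K)"

definition is_smallest_closed ::
  "(complex \<Rightarrow> 'w::ab_group_add \<Rightarrow> 'w) \<Rightarrow> ('w \<Rightarrow> int \<Rightarrow> 'w) set \<Rightarrow> ('w \<Rightarrow> int \<Rightarrow> 'w) set \<Rightarrow> bool" where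
  "is_smallest_closed s S K \<longleftrightarrow>
     quasi_compatible_subspace s K \<and> Y_closed s K \<and> S \<subseteq> K \<and> id_op \<in> K \<and>
     (\<forall>K'. quasi_compatible_subspace s K' \<and> Y_closed s K' \<and> S \<subseteq> K' \<and> id_op \<in> K' \<longrightarrow> K \<subseteq> K')"

definition gen_closed ::
  "(complex \<Rightarrow> 'w::ab_group_add \<Rightarrow> 'w) \<Rightarrow> ('w \<Rightarrow> int \<Rightarrow> 'w) set \<Rightarrow> ('w \<Rightarrow> int \<Rightarrow> 'w) set" where
  "gen_closed s S = (THE K. is_smallest_closed s S K)"


section \<open>Nonlocal vertex algebras and modules-at-infinity\<close>

text \<open>The underlying vector space \<open>V\<close> is a subspace of an ambient one, and \<open>Y u v k\<close> is the
  coefficient of \<open>x\<^sup>k\<close> in \<open>Y(u,x)v\<close>; values of \<open>Y\<close> outside \<open>V\<close> are irrelevant.\<close>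

definition nonlocal_vertex_algebra ::
  "(complex \<Rightarrow> 'v::ab_group_add \<Rightarrow> 'v) \<Rightarrow> 'v set \<Rightarrow> ('v \<Rightarrow> 'v \<Rightarrow> int \<Rightarrow> 'v) \<Rightarrow> 'v \<Rightarrow> bool" where
  "nonlocal_vertex_algebra s V Y one \<longleftrightarrow>
     vector_space s \<and> module.subspace s V \<and> one \<in> V \<and>
     (\<forall>u\<in>V. \<forall>v\<in>V. (\<forall>k. Y u v k \<in> V) \<and> (\<exists>N. \<forall>k<N. Y u v k = 0)) \<and>
     (\<forall>u\<in>V. linear_on_set V s (pscale s) (Y u)) \<and>
     (\<forall>v\<in>V. linear_on_set V s (pscale s) (\<lambda>u. Y u v)) \<and>
     (\<forall>v\<in>V. \<forall>k. Y one v k = (if k = 0 then v else 0)) \<and>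
     (\<forall>v\<in>V. (\<forall>k<0. Y v one k = 0) \<and> Y v one 0 = v) \<and>
     (\<forall>u\<in>V. \<forall>v\<in>V. \<forall>w\<in>V. \<exists>l::nat.
        pmul s ((var1 + var2) ^ l) (binom_subst s (op_prod (Y u) (Y v) w)) =
        pmul s ((var1 + var2) ^ l) (\<lambda>k n. Y (Y u v k) w n))"

definition module_relation ::
  "('v \<Rightarrow> 'v \<Rightarrow> int \<Rightarrow> 'v) \<Rightarrow> (complex \<Rightarrow> 'w::ab_group_add \<Rightarrow> 'w) \<Rightarrow> ('v \<Rightarrow> 'w \<Rightarrow> int \<Rightarrow> 'w)
    \<Rightarrow> 'v \<Rightarrow> 'v \<Rightarrow> complex poly poly \<Rightarrow> bool" where
  "module_relation Y s YW u v p \<longleftrightarrow>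
     (\<lambda>w. pmul s p (op_prod (YW u) (YW v) w)) \<in> Hom_inf2 s \<and>
     (\<forall>w. pmul s (pcompose p (var1 + var2)) (\<lambda>k n. YW (Y u v k) w n) =
          taylor_subst s (pmul s p (op_prod (YW u) (YW v) w)))"

definition quasi_module_at_infinity ::
  "(complex \<Rightarrow> 'v::ab_group_add \<Rightarrow> 'v) \<Rightarrow> 'v set \<Rightarrow> ('v \<Rightarrow> 'v \<Rightarrow> int \<Rightarrow> 'v) \<Rightarrow> 'v
    \<Rightarrow> (complex \<Rightarrow> 'w::ab_group_add \<Rightarrow> 'w) \<Rightarrow> ('v \<Rightarrow> 'w \<Rightarrow> int \<Rightarrow> 'w) \<Rightarrow> bool" where
  "quasi_module_at_infinity sV V Y one s YW \<longleftrightarrow>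
     nonlocal_vertex_algebra sV V Y one \<and> vector_space s \<and>
     (\<forall>u\<in>V. YW u \<in> Eo s) \<and> linear_on_set V sV (pscale (pscale s)) YW \<and>
     YW one = id_op \<and>
     (\<forall>u\<in>V. \<forall>v\<in>V. \<exists>p. p \<noteq> 0 \<and> module_relation Y s YW u v p)"

definition module_at_infinity ::
  "(complex \<Rightarrow> 'v::ab_group_add \<Rightarrow> 'v) \<Rightarrow> 'v set \<Rightarrow> ('v \<Rightarrow> 'v \<Rightarrow> int \<Rightarrow> 'v) \<Rightarrow> 'v
    \<Rightarrow> (complex \<Rightarrow> 'w::ab_group_add \<Rightarrow> 'w) \<Rightarrow> ('v \<Rightarrow> 'w \<Rightarrow> int \<Rightarrow> 'w) \<Rightarrow> bool" where
  "module_at_infinity sV V Y one s YW \<longleftrightarrow>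
     quasi_module_at_infinity sV V Y one s YW \<and>
     (\<forall>u\<in>V. \<forall>v\<in>V. \<exists>k::nat. module_relation Y s YW u v ((var1 - var2) ^ k))"

definition faithful_on :: "'v set \<Rightarrow> ('v \<Rightarrow> 'w \<Rightarrow> int \<Rightarrow> 'w) \<Rightarrow> bool" where
  "faithful_on V YW \<longleftrightarrow> inj_on YW V"

end

theory Submission
  imports Defs
begin

text \<open>
  Everything is reduced to polynomial multiples.  The product \<open>a(x\<^sub>1)b(x\<^sub>2)\<close> becomes regular after
  multiplication by some \<open>p\<close>, and \<open>Y(a,x\<^sub>0)b\<close> is the only series truncated in \<open>x\<^sub>0\<close> whose multiple
  by \<open>p(x\<^sub>0+x,x)\<close> is \<open>p(x\<^sub>1,x)a(x\<^sub>1)b(x)\<close> at \<open>x\<^sub>1 = x+x\<^sub>0\<close>; on truncated series such factors cancel.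

  Replacing two neighbours \<open>a\<close>, \<open>b\<close> of a compatible sequence by a mode \<open>a\<^sub>n b\<close> keeps it compatible:
  the multiple determines the coefficients of \<open>Y(a,x\<^sub>0)b\<close> recursively, upwards from the lowest
  power of \<open>x\<^sub>0\<close>, at the cost of one more power of the polynomial for each coefficient.  So the set
  generated by \<open>S\<close> and \<open>1\<^sub>W\<close> under linear combinations and modes is quasi-compatible, and a maximal
  quasi-compatible subspace equals the set it generates.

  For weak associativity both sides have the same multiple by
  \<open>f(x\<^sub>0+x\<^sub>2+x,x) f(x\<^sub>2+x,x) f(x\<^sub>0+x\<^sub>2+x,x\<^sub>2+x)\<close>.  As \<open>f(z+x,x)\<close> is \<open>z\<^sup>k\<close> times a series invertible at
  \<open>z = 0\<close>, everything cancels except the factor \<open>(x\<^sub>0+x\<^sub>2)\<^sup>k\<close>.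
\<close>

section \<open>Polynomials in many variables acting on formal distributions\<close>

text \<open>No single polynomial is at hand for all modes of \<open>Y(u,x_0)v\<close> paired with w:
  for the mode at exponent k the argument yields a power that grows with k. So weak associativity is
  not proved with one denominator. Up to a given exponent finitely many denominators suffice, and
  they are removed again before passing to the next.

  Every removal rests on one decomposition, \<open>f(z+x,x) = z^k (h(x) + z g(z,x))\<close> with
  \<open>h\<close> nonzero. Among series bounded above in x the factor \<open>h\<close> can be
  divided out, and the rest follows upwards in z. In a product of operators the bound in x depends
  on the other exponents, so the division is carried out with those held fixed.

  The two sides of weak associativity are bounded below in opposite orders of their two variables.
  Factors \<open>x_0^k\<close> and \<open>x_2^k\<close> are shifts of exponents on both sides and
  disappear, but \<open>x_0+x_2\<close> has no inverse acting on both sides alike. This is the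
  origin of the factor in the definition of a nonlocal vertex algebra.\<close>

type_synonym mpoly = "(nat \<Rightarrow>\<^sub>0 nat) \<Rightarrow>\<^sub>0 complex"

text \<open>A formal distribution in \<open>x\<^sub>0, x\<^sub>1, \<dots>\<close> is a function of the exponents.  If \<open>x\<^sub>l\<close> does not occur,
  the function does not depend on the exponent of \<open>x\<^sub>l\<close> (instead of vanishing unless it is \<open>0\<close>), so
  that no support conditions arise for the variables not involved.\<close>

type_synonym 'a dist = "(nat \<Rightarrow> int) \<Rightarrow> 'a"

section \<open>Evaluation of polynomials in one and two variables at elements of
  \<open>mpoly\<close>\<close>

definition mvar :: "nat \<Rightarrow> mpoly" where
  "mvar i = Poly_Mapping.single (Poly_Mapping.single i 1) 1"

definition mconst :: "complex \<Rightarrow> mpoly" where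
  "mconst c = Poly_Mapping.single 0 c"

definition ev1 :: "complex poly \<Rightarrow> mpoly \<Rightarrow> mpoly" where
  "ev1 h Q = poly (map_poly mconst h) Q"

definition ev2 :: "complex poly poly \<Rightarrow> mpoly \<Rightarrow> mpoly \<Rightarrow> mpoly" where
  "ev2 f P Q = poly (map_poly (\<lambda>h. ev1 h Q) f) P"

abbreviation at2 :: "nat \<Rightarrow> nat \<Rightarrow> complex poly poly \<Rightarrow> mpoly" where
  "at2 i j p \<equiv> ev2 p (mvar i) (mvar j)"

abbreviation at2_shift :: "nat \<Rightarrow> nat \<Rightarrow> complex poly poly \<Rightarrow> mpoly" where
  "at2_shift i j p \<equiv> ev2 p (mvar i + mvar j) (mvar j)"

lemma mconst_hom:
  "mconst 0 = 0" "mconst 1 = 1" "mconst (a + b) = mconst a + mconst b"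
  "mconst (a * b) = mconst a * mconst b"
  by (simp_all add: mconst_def single_add mult_single)

lemma ev1_simps:
  "ev1 0 Q = 0" "ev1 1 Q = 1" "ev1 (f + g) Q = ev1 f Q + ev1 g Q"
  "ev1 (f * g) Q = ev1 f Q * ev1 g Q" "ev1 (pCons c f) Q = mconst c + Q * ev1 f Q"
  unfolding ev1_def
  by (simp_all add: poly_map_poly_hom[of mconst] mconst_hom map_poly_pCons)

lemma ev2_simps:
  "ev2 0 P Q = 0" "ev2 1 P Q = 1" "ev2 (f + g) P Q = ev2 f P Q + ev2 g P Q"
  "ev2 (f * g) P Q = ev2 f P Q * ev2 g P Q" "ev2 (pCons h f) P Q = ev1 h Q + P * ev2 f P Q"
  unfolding ev2_def
  by (simp_all add: poly_map_poly_hom[of "\<lambda>h. ev1 h Q"] ev1_simps map_poly_pCons)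

lemma ev2_power: "ev2 (f ^ n) P Q = ev2 f P Q ^ n"
  by (induction n) (simp_all add: ev2_simps)

lemma ev1_power: "ev1 (f ^ n) Q = ev1 f Q ^ n"
  by (induction n) (simp_all add: ev1_simps)

lemma ev2_vars: "ev2 var1 P Q = P" "ev2 var2 P Q = Q"
  by (simp_all add: var1_def var2_def ev2_simps ev1_simps one_pCons[symmetric] mconst_hom)

lemma ev2_pcompose: "ev2 (pcompose f g) P Q = ev2 f (ev2 g P Q) Q"
  by (induction f) (simp_all add: pcompose_pCons ev2_simps ev1_simps)

lemma ev2_shift: "ev2 (pcompose f (var1 + var2)) P Q = ev2 f (P + Q) Q"
  by (simp add: ev2_pcompose ev2_simps ev2_vars)

text \<open>Parametricity: evaluation only uses constants, sums and products. Together with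
  \<open>ev2_rel\<close> this yields locality, behaviour under substitution, renaming of variables
  and congruences, each for its own relation \<open>R\<close>.\<close>

lemma ev1_rel:
  assumes "\<And>c. R (mconst c) (mconst c)"
    and "\<And>p q p' q'. R p p' \<Longrightarrow> R q q' \<Longrightarrow> R (p + q) (p' + q')"
    and "\<And>p q p' q'. R p p' \<Longrightarrow> R q q' \<Longrightarrow> R (p * q) (p' * q')"
    and "R Q Q'"
  shows "R (ev1 h Q) (ev1 h Q')"
proof (induction h)
  case 0
  show ?case using assms(1)[of 0] by (simp add: ev1_simps mconst_hom)
next
  case (pCons c h)
  show ?case unfolding ev1_simps by (intro assms pCons.IH)
qed

lemma ev2_rel:
  assumes "\<And>c. R (mconst c) (mconst c)"
    and "\<And>p q p' q'. R p p' \<Longrightarrow> R q q' \<Longrightarrow> R (p + q) (p' + q')"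
    and "\<And>p q p' q'. R p p' \<Longrightarrow> R q q' \<Longrightarrow> R (p * q) (p' * q')"
    and "R P P'" "R Q Q'"
  shows "R (ev2 f P Q) (ev2 f P' Q')"
proof (induction f)
  case 0
  show ?case using assms(1)[of 0] by (simp add: ev2_simps mconst_hom)
next
  case (pCons h f)
  show ?case unfolding ev2_simps
    by (intro assms(2) ev1_rel[of R] assms(3) pCons.IH assms(1,4,5))
qed

lemma poly_sum_le:
  fixes x :: "'a::comm_semiring_1"
  assumes "degree p \<le> n" shows "poly p x = (\<Sum>i\<le>n. coeff p i * x ^ i)"
  unfolding poly_altdef
  by (intro sum.mono_neutral_left) (use assms in \<open>auto simp: coeff_eq_0\<close>)

lemma ev1_altdef: "ev1 h Q = (\<Sum>i\<le>degree h. mconst (coeff h i) * Q ^ i)"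
  unfolding ev1_def
  by (subst poly_sum_le[where n = "degree h"])
    (simp_all add: map_poly_degree_leq coeff_map_poly mconst_hom)

lemma ev2_altdef: "ev2 f P Q = (\<Sum>i\<le>degree f. ev1 (coeff f i) Q * P ^ i)"
  unfolding ev2_def
  by (subst poly_sum_le[where n = "degree f"])
    (simp_all add: map_poly_degree_leq coeff_map_poly ev1_simps)

lemma mvar_power: "mvar i ^ n = Poly_Mapping.single (Poly_Mapping.single i n) 1"
proof (induction n)
  case (Suc n)
  thus ?case by (simp add: mvar_def mult_single single_add[symmetric])
qed simp

lemma at_vars_eq: "at_vars p i j = at2 i j p"
  unfolding at_vars_def ev2_altdef ev1_altdef mvar_power mconst_def
  by (simp add: sum_distrib_right mult_single add.commute)

abbreviation lower :: "(nat \<Rightarrow> int) \<Rightarrow> (nat \<Rightarrow>\<^sub>0 nat) \<Rightarrow> nat \<Rightarrow> int" where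
  "lower e \<mu> \<equiv> (\<lambda>i. e i - int (poly_mapping.lookup \<mu> i))"

section \<open>The action on coefficients\<close>

locale complex_space = vector_space s
  for s :: "complex \<Rightarrow> 'w::ab_group_add \<Rightarrow> 'w"
begin

definition act :: "mpoly \<Rightarrow> 'w dist \<Rightarrow> 'w dist" where
  "act q A = (\<lambda>e. \<Sum>\<mu>\<in>Poly_Mapping.keys q.
     s (Poly_Mapping.lookup q \<mu>) (A (lower e \<mu>)))"

lemma act_superset:
  assumes "finite K" "Poly_Mapping.keys q \<subseteq> K"
  shows "act q A e = (\<Sum>\<mu>\<in>K. s (Poly_Mapping.lookup q \<mu>) (A (lower e \<mu>)))"
  unfolding act_def
  by (rule sum.mono_neutral_left) (use assms in \<open>auto simp: in_keys_iff\<close>)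

lemma act_add: "act (p + q) A = (\<lambda>e. act p A e + act q A e)"
proof
  fix e
  let ?K = "Poly_Mapping.keys p \<union> Poly_Mapping.keys q"
  have "Poly_Mapping.keys (p + q) \<subseteq> ?K" by (rule keys_add)
  thus "act (p + q) A e = act p A e + act q A e"
    by (simp add: act_superset[of ?K] lookup_add scale_left_distrib sum.distrib)
qed

lemma act_zero: "act 0 A = (\<lambda>e. 0)"
  by (simp add: act_def)

lemma act_single:
  "act (Poly_Mapping.single \<mu> c) A = (\<lambda>e. s c (A (lower e \<mu>)))"
  by (simp add: act_def fun_eq_iff)

lemma act_mconst: "act (mconst c) A = (\<lambda>e. s c (A e))"
  by (simp add: mconst_def act_single)

lemma act_one: "act 1 A = A"
  using act_mconst[of 1] by (simp add: mconst_hom)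

lemma act_mvar: "act (mvar i) A = (\<lambda>e. A (e(i := e i - 1)))"
proof -
  have "(\<lambda>j. e j - int (Poly_Mapping.lookup (Poly_Mapping.single i 1) j)) = e(i := e i - 1)"
    for e :: "nat \<Rightarrow> int"
    by (auto simp: lookup_single when_def)
  thus ?thesis by (simp add: mvar_def act_single)
qed

lemma act_mvar_power: "act (mvar i ^ n) A = (\<lambda>e. A (e(i := e i - int n)))"
proof -
  have "(\<lambda>j. e j - int (Poly_Mapping.lookup (Poly_Mapping.single i n) j)) = e(i := e i - int n)"
    for e :: "nat \<Rightarrow> int"
    by (auto simp: lookup_single when_def)
  thus ?thesis by (simp add: mvar_power act_single)
qed

lemma act_zero_right: "act q (\<lambda>e. 0) = (\<lambda>e. 0)"
  by (simp add: act_def)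

lemma act_add_right: "act q (\<lambda>e. A e + B e) = (\<lambda>e. act q A e + act q B e)"
  by (simp add: act_def scale_right_distrib sum.distrib)

lemma act_diff_right: "act q (\<lambda>e. A e - B e) = (\<lambda>e. act q A e - act q B e)"
  by (simp add: act_def scale_right_diff_distrib sum_subtractf)

lemma act_scale_right: "act q (\<lambda>e. s c (A e)) = (\<lambda>e. s c (act q A e))"
  by (simp add: act_def scale_sum_right mult.commute)

lemma mpoly_induct [case_names zero add single]:
  fixes q :: mpoly
  assumes "P 0" "\<And>p q. P p \<Longrightarrow> P q \<Longrightarrow> P (p + q)" "\<And>\<mu> c. P (Poly_Mapping.single \<mu> c)"
  shows "P q"
proof (induction q rule: update_induct)
  case const
  show ?case using assms(1) by simp
next
  case (update f a b)
  have "Poly_Mapping.update a b f = f + Poly_Mapping.single a b"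
  proof (rule poly_mapping_eqI)
    fix k
    show "Poly_Mapping.lookup (Poly_Mapping.update a b f) k =
        Poly_Mapping.lookup (f + Poly_Mapping.single a b) k"
      using update(1) by (cases "k = a") (auto simp: lookup_update lookup_add lookup_single in_keys_iff)
  qed
  thus ?case using assms(2)[OF update(3) assms(3)[of a b]] by metis
qed

lemma act_mult: "act (p * q) A = act p (act q A)"
proof (induction p rule: mpoly_induct)
  case (single \<mu> c)
  show ?case
  proof (induction q rule: mpoly_induct)
    case (single \<nu> d)
    have "(\<lambda>i. e i - int (Poly_Mapping.lookup (\<mu> + \<nu>) i)) =
      (\<lambda>i. e i - int (Poly_Mapping.lookup \<mu> i) - int (Poly_Mapping.lookup \<nu> i))" for e :: "nat \<Rightarrow> int"
      by (simp add: lookup_add algebra_simps)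
    thus ?case by (simp add: mult_single act_single)
  qed (simp_all add: distrib_left act_add act_add_right act_zero act_zero_right)
qed (simp_all add: distrib_right act_add act_zero)

lemma act_commute: "act p (act q A) = act q (act p A)"
  by (simp only: act_mult[symmetric] mult.commute)

lemma act_closed:
  assumes "P (\<lambda>e. 0)" "\<And>A B. P A \<Longrightarrow> P B \<Longrightarrow> P (\<lambda>e. A e + B e)"
    and "\<And>c A \<mu>. P A \<Longrightarrow> P (\<lambda>e. s c (A (lower e \<mu>)))"
    and "P A"
  shows "P (act q A)"
proof (induction q rule: mpoly_induct)
  case zero
  show ?case unfolding act_zero by (rule assms(1))
next
  case (add p q)
  thus ?case unfolding act_add by (rule assms(2))
next
  case (single \<mu> c)
  show ?case unfolding act_single by (rule assms(3)[OF assms(4)])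
qed

text \<open>Polynomials have no negative exponents, so a product reads its argument only at
  exponents that are smaller or equal in every variable. Lower bounds therefore survive
  multiplication, and cutting off high levels does not disturb low ones.\<close>

lemma act_cong:
  assumes "\<And>e'. (\<forall>i. e' i \<le> e i) \<Longrightarrow> A e' = B e'"
  shows "act q A e = act q B e"
  unfolding act_def by (intro sum.cong arg_cong2[of _ _ _ _ s] assms) auto

lemma act_eq_0:
  assumes "\<And>e'. (\<forall>i. e' i \<le> e i) \<Longrightarrow> A e' = 0"
  shows "act q A e = 0"
  using act_cong[of e A "\<lambda>_. 0" q] assms by (simp add: act_zero_right)

text \<open>Satisfied by the polynomials that do not contain \<open>x\<^sub>l\<close>.\<close>

definition loc :: "nat \<Rightarrow> mpoly \<Rightarrow> bool" where
  "loc l p \<longleftrightarrow> (\<forall>A B e. (\<forall>e'. e' l = e l \<longrightarrow> A e' = B e') \<longrightarrow> act p A e = act p B e)"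

lemma locD: "loc l p \<Longrightarrow> (\<And>e'. e' l = e l \<Longrightarrow> A e' = B e') \<Longrightarrow> act p A e = act p B e"
  unfolding loc_def by blast

lemma loc_mconst: "loc l (mconst c)"
  by (simp add: loc_def act_mconst)

lemma loc_mvar: "i \<noteq> l \<Longrightarrow> loc l (mvar i)"
  by (simp add: loc_def act_mvar)

lemma loc_add: "loc l p \<Longrightarrow> loc l q \<Longrightarrow> loc l (p + q)"
  unfolding loc_def[of l "p + q"] act_add by (blast intro: arg_cong2[of _ _ _ _ "(+)"] locD)

lemma loc_mult: "loc l p \<Longrightarrow> loc l q \<Longrightarrow> loc l (p * q)"
  unfolding loc_def[of l "p * q"] act_mult by (intro allI impI, erule locD, erule locD) simp

lemma loc_ev2: "loc l P \<Longrightarrow> loc l Q \<Longrightarrow> loc l (ev2 f P Q)"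
  by (rule ev2_rel[of "\<lambda>p _. loc l p"]) (auto intro: loc_mconst loc_add loc_mult)

lemma loc_ev1: "loc l Q \<Longrightarrow> loc l (ev1 f Q)"
  by (rule ev1_rel[of "\<lambda>p _. loc l p"]) (auto intro: loc_mconst loc_add loc_mult)

lemma loc_power: "loc l P \<Longrightarrow> loc l (P ^ n)"
  by (induction n) (use loc_mconst[of l 1] in \<open>auto intro: loc_mult simp: mconst_hom\<close>)

lemma act_ev1:
  "act (ev1 h (mvar b)) A e = (\<Sum>i\<le>degree h. s (coeff h i) (A (e(b := e b - int i))))"
proof -
  have sum: "act (\<Sum>x\<in>I. f x) A e = (\<Sum>x\<in>I. act (f x) A e)" for f :: "nat \<Rightarrow> mpoly" and I
    by (induction I rule: infinite_finite_induct) (simp_all add: act_add act_zero)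
  show ?thesis
    by (simp add: ev1_altdef sum act_mult act_mconst act_mvar_power)
qed

text \<open>With all exponents but those at \<open>i\<close> and \<open>j\<close> frozen, the action
  becomes the two-variable \<open>pmul\<close> of the definitions.\<close>

lemma act_ev2:
  assumes "i \<noteq> j"
  shows "act (at2 i j p) A e = pmul s p (\<lambda>m n. A (e(i := m, j := n))) (e i) (e j)"
proof -
  have sum: "act (\<Sum>x\<in>I. f x) A e = (\<Sum>x\<in>I. act (f x) A e)" for f :: "nat \<Rightarrow> mpoly" and I A e
    by (induction I rule: infinite_finite_induct) (simp_all add: act_add act_zero)
  show ?thesis
    using assms by (simp add: ev2_altdef sum act_mult act_ev1 act_mvar_power pmul_def fun_upd_twist)
qed

lemma act_ev2_shift:
  assumes "i \<noteq> j"
  shows "act (at2_shift i j p) A e =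
    pmul s (pcompose p (var1 + var2)) (\<lambda>m n. A (e(i := m, j := n))) (e i) (e j)"
  using act_ev2[OF assms, of "pcompose p (var1 + var2)"] by (simp add: ev2_shift)

end

section \<open>Substitution of a sum for a variable\<close>

text \<open>\<open>taylor_coeff k d\<close> is the coefficient of \<open>x\<^sub>0\<^sup>k x\<^sup>d\<close> in \<open>(x + x\<^sub>0)\<^sup>k\<^sup>+\<^sup>d\<close> expanded in \<open>x\<^sub>0\<close>, and
  \<open>binom_coeff\<close> the one for the expansion in \<open>x\<close>.  The operator \<open>subst c i j\<close> below replaces
  \<open>x\<^sub>i\<close> by \<open>x\<^sub>i + x\<^sub>j\<close>; the recurrences \<open>pascal\<close> are all that its rules need of the expansion.\<close>

definition taylor_coeff :: "int \<Rightarrow> int \<Rightarrow> complex" where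
  "taylor_coeff k d = (if k < 0 then 0 else of_int (k + d) gchoose nat k)"

definition binom_coeff :: "int \<Rightarrow> int \<Rightarrow> complex" where
  "binom_coeff k d = taylor_coeff d k"

text \<open>Here \<open>c k d\<close> stands for the coefficient of \<open>x_i^k x_j^d\<close> in
  \<open>(x_i+x_j)^(k+d)\<close>. The first recurrence expresses multiplication by
  \<open>x_i+x_j\<close>, the other two the derivatives with respect to \<open>x_i\<close> and
  \<open>x_j\<close>.\<close>

definition pascal :: "(int \<Rightarrow> int \<Rightarrow> complex) \<Rightarrow> bool" where
  "pascal c \<longleftrightarrow> (\<forall>k d. c k d = c (k - 1) d + c k (d - 1) \<and>
     of_int (k + 1) * c (k + 1) d = of_int (k + d + 1) * c k d \<and>
     of_int (d + 1) * c k (d + 1) = of_int (k + d + 1) * c k d)"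

lemma pascal_taylor: "pascal taylor_coeff"
proof -
  have 1: "taylor_coeff k d = taylor_coeff (k - 1) d + taylor_coeff k (d - 1)" for k d
  proof -
    consider "k < 0" | "k = 0" | "k > 0" by linarith
    thus ?thesis
    proof cases
      case 3
      hence k: "nat (k - 1) = nat k - 1" "0 < nat k" by simp_all
      have "(of_int (k - 1 + d) :: complex) = of_int (k + d) - 1" "(of_int (k + (d - 1)) :: complex) = of_int (k + d) - 1"
        by simp_all
      thus ?thesis
        using 3 gbinomial_reduce_nat[OF k(2), of "of_int (k + d) :: complex"]
        unfolding taylor_coeff_def k(1) by (simp del: of_int_add of_int_diff)
    qed (simp_all add: taylor_coeff_def)
  qed
  have 2: "of_int (k + 1) * taylor_coeff (k + 1) d = of_int (k + d + 1) * taylor_coeff k d" for k d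
  proof -
    consider "k < -1" | "k = -1" | "k \<ge> 0" by linarith
    thus ?thesis
    proof cases
      case 3
      hence k: "nat (k + 1) = Suc (nat k)" "of_int (k + 1) = (of_nat (Suc (nat k)) :: complex)" by simp_all
      have "of_int (k + 1 + d) = (of_int (k + d) + 1 :: complex)" "of_int (k + d + 1) = (of_int (k + d) + 1 :: complex)"
        by simp_all
      thus ?thesis
        using 3 Suc_times_gbinomial[of "nat k" "of_int (k + d) :: complex"]
        unfolding taylor_coeff_def k by (simp add: ac_simps)
    qed (simp_all add: taylor_coeff_def)
  qed
  have 3: "of_int (d + 1) * taylor_coeff k (d + 1) = of_int (k + d + 1) * taylor_coeff k d" for k d
  proof (cases "k < 0")
    case False
    have "of_int (k + d + 1) - of_nat (nat k) = (of_int (d + 1) :: complex)"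
      "of_int (k + d + 1) - 1 = (of_int (k + d) :: complex)" "k + (d + 1) = k + d + 1"
      using False by simp_all
    thus ?thesis
      using False gbinomial_absorb_comp[of "of_int (k + d + 1) :: complex" "nat k"]
      unfolding taylor_coeff_def by (simp add: ac_simps)
  qed (simp add: taylor_coeff_def)
  show ?thesis unfolding pascal_def using 1 2 3 by blast
qed

text \<open>The recurrences are symmetric: exchanging \<open>k\<close> and \<open>d\<close> swaps
  the two derivative rules and preserves Pascal's rule.\<close>

lemma pascal_binom: "pascal binom_coeff"
proof -
  have t: "taylor_coeff k d = taylor_coeff (k - 1) d + taylor_coeff k (d - 1)"
    "of_int (k + 1) * taylor_coeff (k + 1) d = of_int (k + d + 1) * taylor_coeff k d"
    "of_int (d + 1) * taylor_coeff k (d + 1) = of_int (k + d + 1) * taylor_coeff k d" for k d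
    using pascal_taylor unfolding pascal_def by blast+
  show ?thesis
    unfolding pascal_def binom_coeff_def
  proof (intro allI conjI)
    fix k d
    show "taylor_coeff d k = taylor_coeff d (k - 1) + taylor_coeff (d - 1) k"
      using t(1)[of d k] by (simp add: add.commute)
    show "of_int (k + 1) * taylor_coeff d (k + 1) = of_int (k + d + 1) * taylor_coeff d k"
      using t(3)[of k d] by (simp only: add.commute[of d k])
    show "of_int (d + 1) * taylor_coeff (d + 1) k = of_int (k + d + 1) * taylor_coeff d k"
      using t(2)[of d k] by (simp only: add.commute[of d k])
  qed
qed

lemma upd_upd: "i \<noteq> j \<Longrightarrow> e(i := a, j := b, i := c) = e(i := c, j := b)"
  by auto

section \<open>Substitution and its effect on polynomial multiples\<close>

context complex_space
begin

text \<open>Slot \<open>i\<close> is reused: in the result it holds the summand \<open>x_i\<close>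
  of \<open>x_i+x_j\<close>, and a term that takes \<open>x_j^d\<close> from the power comes from
  exponent \<open>e i + d\<close>. As \<open>Sum_any\<close> is 0 on an infinite support, finiteness
  is tracked separately by \<open>summ\<close>.\<close>

definition subst ::
  "(int \<Rightarrow> int \<Rightarrow> complex) \<Rightarrow> nat \<Rightarrow> nat \<Rightarrow> 'w dist \<Rightarrow> 'w dist" where
  "subst c i j A = (\<lambda>e. Sum_any (\<lambda>d. s (c (e i) d) (A (e(i := e i + d, j := e j - d)))))"

definition subst_supp ::
  "(int \<Rightarrow> int \<Rightarrow> complex) \<Rightarrow> nat \<Rightarrow> nat \<Rightarrow> 'w dist \<Rightarrow> (nat \<Rightarrow> int) \<Rightarrow> int set" where
  "subst_supp c i j A e = {d. c (e i) d \<noteq> 0 \<and> A (e(i := e i + d, j := e j - d)) \<noteq> 0}"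

definition summ ::
  "(int \<Rightarrow> int \<Rightarrow> complex) \<Rightarrow> nat \<Rightarrow> nat \<Rightarrow> 'w dist \<Rightarrow> bool" where
  "summ c i j A \<longleftrightarrow> (\<forall>e. finite (subst_supp c i j A e))"

abbreviation "taylor \<equiv> subst taylor_coeff"
abbreviation "taylor_supp \<equiv> subst_supp taylor_coeff"
abbreviation "taylor_summ \<equiv> summ taylor_coeff"

lemma subst_eq_sum:
  assumes "finite D" "subst_supp c i j A e \<subseteq> D"
  shows "subst c i j A e = (\<Sum>d\<in>D. s (c (e i) d) (A (e(i := e i + d, j := e j - d))))"
  unfolding subst_def
  by (rule Sum_any.expand_superset) (use assms in \<open>auto simp: subst_supp_def\<close>)

lemma subst_cong:
  assumes "\<And>d. A (e(i := e i + d, j := e j - d)) = B (e(i := e i + d, j := e j - d))"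
  shows "subst c i j A e = subst c i j B e"
  using assms by (simp add: subst_def)

lemma subst_eq_0:
  assumes "\<And>d. c (e i) d \<noteq> 0 \<Longrightarrow> A (e(i := e i + d, j := e j - d)) = 0"
  shows "subst c i j A e = 0"
  using subst_eq_sum[of "{}" c i j A e] assms by (auto simp: subst_supp_def)

lemma subst_nonzero:
  assumes "subst c i j A e \<noteq> 0"
  obtains d where "c (e i) d \<noteq> 0" "A (e(i := e i + d, j := e j - d)) \<noteq> 0"
  using subst_eq_0[of c e i A j] assms by blast

lemma subst_supp_add:
  "subst_supp c i j (\<lambda>e. A e + B e) e \<subseteq> subst_supp c i j A e \<union> subst_supp c i j B e"
  by (auto simp: subst_supp_def)

lemma summ_add: "summ c i j A \<Longrightarrow> summ c i j B \<Longrightarrow> summ c i j (\<lambda>e. A e + B e)"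
  unfolding summ_def using subst_supp_add by (meson finite_UnI finite_subset)

lemma summ_scale: "summ c i j A \<Longrightarrow> summ c i j (\<lambda>e. s a (A e))"
  unfolding summ_def by (auto simp: subst_supp_def elim!: finite_subset[rotated])

lemma subst_add:
  assumes "summ c i j A" "summ c i j B"
  shows "subst c i j (\<lambda>e. A e + B e) = (\<lambda>e. subst c i j A e + subst c i j B e)"
proof
  fix e
  let ?D = "subst_supp c i j A e \<union> subst_supp c i j B e"
  have "finite ?D" using assms by (simp add: summ_def)
  thus "subst c i j (\<lambda>e. A e + B e) e = subst c i j A e + subst c i j B e"
    using subst_supp_add[of c i j A B e]
    by (simp add: subst_eq_sum[of ?D] scale_right_distrib sum.distrib)
qed

lemma subst_scale:
  assumes "summ c i j A"
  shows "subst c i j (\<lambda>e. s a (A e)) = (\<lambda>e. s a (subst c i j A e))"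
proof
  fix e
  let ?D = "subst_supp c i j A e"
  have "finite ?D" "subst_supp c i j (\<lambda>e. s a (A e)) e \<subseteq> ?D"
    using assms by (auto simp: summ_def subst_supp_def)
  thus "subst c i j (\<lambda>e. s a (A e)) e = s a (subst c i j A e)"
    by (simp add: subst_eq_sum[of ?D] scale_sum_right mult.commute)
qed

text \<open>\<open>p'\<close> is \<open>p\<close> after the substitution. As a relation it passes
  from the variables to all evaluated polynomials by \<open>ev2_rel\<close>; summability is included
  so that products can be treated one factor at a time.\<close>

definition subst_rel ::
  "(int \<Rightarrow> int \<Rightarrow> complex) \<Rightarrow> nat \<Rightarrow> nat \<Rightarrow> mpoly \<Rightarrow> mpoly \<Rightarrow> bool" where
  "subst_rel c i j p p' \<longleftrightarrow>
     (\<forall>A. summ c i j A \<longrightarrow> summ c i j (act p A) \<and> subst c i j (act p A) = act p' (subst c i j A))"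

abbreviation "taylor_rel \<equiv> subst_rel taylor_coeff"

lemma subst_relD:
  assumes "subst_rel c i j p p'" "summ c i j A"
  shows "summ c i j (act p A)" "subst c i j (act p A) = act p' (subst c i j A)"
  using assms by (auto simp: subst_rel_def)

lemma subst_rel_mconst: "subst_rel c i j (mconst a) (mconst a)"
  by (simp add: subst_rel_def act_mconst summ_scale subst_scale)

lemma subst_rel_add:
  assumes "subst_rel c i j p p'" "subst_rel c i j q q'"
  shows "subst_rel c i j (p + q) (p' + q')"
  unfolding subst_rel_def act_add
  using subst_relD[OF assms(1)] subst_relD[OF assms(2)] by (simp add: summ_add subst_add)

lemma subst_rel_mult:
  assumes "subst_rel c i j p p'" "subst_rel c i j q q'"
  shows "subst_rel c i j (p * q) (p' * q')"
  unfolding subst_rel_def act_mult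
  using subst_relD[OF assms(1)] subst_relD[OF assms(2)] by simp

lemma subst_rel_one: "subst_rel c i j 1 1"
  using subst_rel_mconst[of c i j 1] by (simp add: mconst_hom)

lemma subst_rel_ev2:
  assumes "subst_rel c i j P P'" "subst_rel c i j Q Q'"
  shows "subst_rel c i j (ev2 f P Q) (ev2 f P' Q')"
  by (rule ev2_rel[of "subst_rel c i j"])
    (use assms in \<open>auto intro: subst_rel_mconst subst_rel_add subst_rel_mult\<close>)

lemma subst_rel_other:
  assumes "l \<noteq> i" "l \<noteq> j"
  shows "subst_rel c i j (mvar l) (mvar l)"
proof -
  have eq: "e(i := a, j := b, l := (e(i := a, j := b)) l - 1) = (e(l := e l - 1))(i := a, j := b)"
    for e :: "nat \<Rightarrow> int" and a b
    using assms by (auto simp: fun_eq_iff algebra_simps)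
  have "subst_supp c i j (act (mvar l) A) e = subst_supp c i j A (e(l := e l - 1))" for A e
    using assms unfolding subst_supp_def act_mvar eq by simp
  moreover have "subst c i j (act (mvar l) A) e = act (mvar l) (subst c i j A) e" for A e
    using assms unfolding subst_def act_mvar eq by simp
  ultimately show ?thesis by (auto simp: subst_rel_def summ_def)
qed

lemma subst_rel_base:
  assumes "i \<noteq> j"
  shows "subst_rel c i j (mvar j) (mvar j)"
proof -
  have eq: "e(i := a, j := b, j := (e(i := a, j := b)) j - 1) = e(i := a, j := b - 1)"
    for e :: "nat \<Rightarrow> int" and a b
    by (auto simp: fun_eq_iff algebra_simps)
  have "subst_supp c i j (act (mvar j) A) e = subst_supp c i j A (e(j := e j - 1))" for A e
    using assms unfolding subst_supp_def act_mvar eq by (simp add: fun_upd_twist algebra_simps)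
  moreover have "subst c i j (act (mvar j) A) e = act (mvar j) (subst c i j A) e" for A e
    using assms unfolding subst_def act_mvar eq by (simp add: fun_upd_twist algebra_simps)
  ultimately show ?thesis by (auto simp: subst_rel_def summ_def)
qed

text \<open>Pascal's rule splits each coefficient into the part in which \<open>x_i\<close> is taken
  from the extra factor \<open>x_i+x_j\<close> and the part in which \<open>x_j\<close> is
  taken.\<close>

lemma subst_rel_var:
  assumes "i \<noteq> j" "pascal c"
  shows "subst_rel c i j (mvar i) (mvar i + mvar j)"
proof -
  have pas: "c k d = c (k - 1) d + c k (d - 1)" for k d
    using assms(2) unfolding pascal_def by blast
  have "summ c i j (act (mvar i) A) \<and> subst c i j (act (mvar i) A) e = act (mvar i + mvar j) (subst c i j A) e"
    if A: "summ c i j A" for A e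
  proof
    let ?e1 = "\<lambda>e::nat \<Rightarrow> int. e(i := e i - 1)" and ?e2 = "\<lambda>e::nat \<Rightarrow> int. e(j := e j - 1)"
    \<comment> \<open>Taking \<open>x_j\<close> lowers both \<open>e j\<close> and the index
      \<open>d\<close> by one, hence the shifted second support.\<close>
    let ?D = "\<lambda>e. subst_supp c i j A (?e1 e) \<union> (\<lambda>d. d + 1) ` subst_supp c i j A (?e2 e)"
    have fin: "finite (?D e)" for e using A by (simp add: summ_def)
    have A1: "act (mvar i) A (e(i := e i + d, j := e j - d)) = A (e(i := e i + d - 1, j := e j - d))" for e d
      using assms(1) unfolding act_mvar upd_upd[OF assms(1)] by simp
    have B1: "(?e1 e)(i := ?e1 e i + d, j := ?e1 e j - d) = e(i := e i + d - 1, j := e j - d)" for e d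
      using assms(1) by (auto simp: fun_eq_iff algebra_simps)
    have B2: "(?e2 e)(i := ?e2 e i + (d - 1), j := ?e2 e j - (d - 1)) = e(i := e i + d - 1, j := e j - d)" for e d
      using assms(1) by (auto simp: fun_eq_iff algebra_simps)
    have sub: "subst_supp c i j (act (mvar i) A) e \<subseteq> ?D e" for e
    proof
      fix d assume "d \<in> subst_supp c i j (act (mvar i) A) e"
      hence d: "c (e i) d \<noteq> 0" "A (e(i := e i + d - 1, j := e j - d)) \<noteq> 0"
        by (auto simp: subst_supp_def A1)
      hence "c (e i - 1) d \<noteq> 0 \<or> c (e i) (d - 1) \<noteq> 0" using pas[of "e i" d] by auto
      thus "d \<in> ?D e"
      proof
        assume "c (e i - 1) d \<noteq> 0"
        hence "d \<in> subst_supp c i j A (?e1 e)"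
          using d unfolding subst_supp_def B1 by simp
        thus ?thesis by simp
      next
        assume "c (e i) (d - 1) \<noteq> 0"
        hence "d - 1 \<in> subst_supp c i j A (?e2 e)"
          using d assms(1) unfolding subst_supp_def mem_Collect_eq B2 by simp
        thus ?thesis by (intro UnI2 image_eqI[of d _ "d - 1"]) simp_all
      qed
    qed
    show "summ c i j (act (mvar i) A)"
      unfolding summ_def using sub fin by (meson finite_subset)
    let ?F = "\<lambda>d. A (e(i := e i + d - 1, j := e j - d))"
    have "subst c i j A (?e1 e) = (\<Sum>d\<in>?D e. s (c (e i - 1) d) (?F d))"
      using subst_eq_sum[OF fin[of e], of c i j A "?e1 e"] unfolding B1 by simp
    moreover have "subst c i j A (?e2 e) = (\<Sum>d\<in>?D e. s (c (e i) (d - 1)) (?F d))"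
    proof -
      have "finite ((\<lambda>d. d - 1) ` ?D e)" using fin[of e] by simp
      moreover have "subst_supp c i j A (?e2 e) \<subseteq> (\<lambda>d. d - 1) ` ?D e"
        by (blast intro: image_eqI[of d "\<lambda>d. d - 1" "d + 1" for d, OF add_diff_cancel_right'[symmetric]])
      ultimately have "subst c i j A (?e2 e) =
          (\<Sum>d\<in>(\<lambda>d. d - 1) ` ?D e. s (c (?e2 e i) d) (A ((?e2 e)(i := ?e2 e i + d, j := ?e2 e j - d))))"
        by (rule subst_eq_sum)
      also have "\<dots> = (\<Sum>d\<in>?D e. s (c (?e2 e i) (d - 1)) (A ((?e2 e)(i := ?e2 e i + (d - 1), j := ?e2 e j - (d - 1)))))"
        by (subst sum.reindex) (auto simp: inj_on_def)
      also have "\<dots> = (\<Sum>d\<in>?D e. s (c (e i) (d - 1)) (?F d))"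
        unfolding B2 using assms(1) by simp
      finally show ?thesis .
    qed
    moreover have "subst c i j (act (mvar i) A) e = (\<Sum>d\<in>?D e. s (c (e i) d) (?F d))"
      using subst_eq_sum[OF fin sub] unfolding A1 by simp
    ultimately show "subst c i j (act (mvar i) A) e = act (mvar i + mvar j) (subst c i j A) e"
      unfolding act_add act_mvar
      by (simp add: sum.distrib[symmetric] scale_left_distrib[symmetric] pas[symmetric])
  qed
  thus ?thesis by (auto simp: subst_rel_def fun_eq_iff)
qed

section \<open>Partial derivatives and the chain rule\<close>

definition dv :: "nat \<Rightarrow> 'w dist \<Rightarrow> 'w dist" where
  "dv i A = (\<lambda>e. s (of_int (e i + 1)) (A (e(i := e i + 1))))"

lemma dv_subst_other:
  assumes "l \<noteq> i" "l \<noteq> j" "summ c i j A"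
  shows "dv l (subst c i j A) = subst c i j (dv l A)"
proof
  fix e :: "nat \<Rightarrow> int"
  have eq: "(e(i := a, j := b))(l := (e(i := a, j := b)) l + 1) = (e(l := e l + 1))(i := a, j := b)" for a b
    using assms by (auto simp: fun_eq_iff algebra_simps)
  let ?D = "subst_supp c i j A (e(l := e l + 1))"
  have "finite ?D" using assms by (simp add: summ_def)
  moreover have "subst_supp c i j (dv l A) e \<subseteq> ?D"
    using assms unfolding subst_supp_def dv_def eq by auto
  ultimately show "dv l (subst c i j A) e = subst c i j (dv l A) e"
    using assms unfolding dv_def
    by (simp add: subst_eq_sum[of ?D] eq scale_sum_right mult.commute fun_upd_twist)
qed

lemma dv_subst_var:
  assumes "i \<noteq> j" "pascal c" "summ c i j A"
  shows "summ c i j (dv i A)" "dv i (subst c i j A) = subst c i j (dv i A)"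
proof -
  have pas: "of_int (k + 1) * c (k + 1) d = of_int (k + d + 1) * c k d" for k d
    using assms(2) unfolding pascal_def by blast
  let ?e = "\<lambda>e::nat \<Rightarrow> int. e(i := e i + 1)"
  let ?D = "\<lambda>e. subst_supp c i j A (?e e)"
  have eq: "(?e e)(i := ?e e i + d, j := ?e e j - d) = e(i := e i + d + 1, j := e j - d)" for e d
    using assms by (auto simp: fun_eq_iff algebra_simps)
  have eq': "dv i A (e(i := e i + d, j := e j - d)) = s (of_int (e i + d + 1)) (A (e(i := e i + d + 1, j := e j - d)))" for e d
    using assms(1) unfolding dv_def upd_upd[OF assms(1)] by simp
  have fin: "finite (?D e)" for e using assms by (simp add: summ_def)
  \<comment> \<open>A nonzero term has \<open>e i + d + 1\<close> nonzero, and then the recurrence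
    forces \<open>c (e i + 1) d\<close> to be nonzero too. So summability of the derivative comes
    from that of \<open>A\<close> one exponent higher.\<close>
  have sub: "subst_supp c i j (dv i A) e \<subseteq> ?D e" for e
  proof
    fix d assume "d \<in> subst_supp c i j (dv i A) e"
    hence "c (e i) d \<noteq> 0" "of_int (e i + d + 1) \<noteq> (0 :: complex)" "A (e(i := e i + d + 1, j := e j - d)) \<noteq> 0"
      unfolding subst_supp_def eq' by auto
    moreover from this have "of_int (e i + d + 1) * c (e i) d \<noteq> 0" by (simp only: mult_eq_0_iff simp_thms)
    hence "c (e i + 1) d \<noteq> 0" unfolding pas[of "e i" d, symmetric] by (rule contrapos_nn) simp
    ultimately show "d \<in> ?D e" unfolding subst_supp_def eq by simp
  qed
  show "summ c i j (dv i A)" unfolding summ_def using sub fin by (meson finite_subset)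
  show "dv i (subst c i j A) = subst c i j (dv i A)"
  proof
    fix e
    have "dv i (subst c i j A) e = (\<Sum>d\<in>?D e. s (of_int (e i + 1) * c (e i + 1) d) (A (e(i := e i + d + 1, j := e j - d))))"
      unfolding dv_def subst_eq_sum[OF fin subset_refl] eq by (simp add: scale_sum_right)
    thus "dv i (subst c i j A) e = subst c i j (dv i A) e"
      unfolding subst_eq_sum[OF fin sub] eq' pas by (simp add: mult.commute)
  qed
qed

text \<open>The chain rule: after the substitution \<open>x_j\<close> also occurs inside
  \<open>x_i+x_j\<close>, which produces the second summand.\<close>

lemma dv_subst_base:
  assumes "i \<noteq> j" "pascal c" "summ c i j A"
  shows "summ c i j (dv j A)"
    "dv j (subst c i j A) = (\<lambda>e. subst c i j (dv i A) e + subst c i j (dv j A) e)"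
proof -
  have pas: "of_int (d + 1) * c k (d + 1) = of_int (k + d + 1) * c k d" for k d
    using assms(2) unfolding pascal_def by blast
  let ?e = "\<lambda>e::nat \<Rightarrow> int. e(j := e j + 1)"
  let ?D = "\<lambda>e. subst_supp c i j A (?e e)"
  have eq: "(?e e)(i := ?e e i + d, j := ?e e j - d) = e(i := e i + d, j := e j - d + 1)" for e d
    using assms by (auto simp: fun_eq_iff algebra_simps)
  have eqi: "dv i A (e(i := e i + d, j := e j - d)) = s (of_int (e i + d + 1)) (A (e(i := e i + d + 1, j := e j - d)))" for e d
    using assms(1) unfolding dv_def upd_upd[OF assms(1)] by simp
  have eqj: "dv j A (e(i := e i + d, j := e j - d)) = s (of_int (e j - d + 1)) (A (e(i := e i + d, j := e j - d + 1)))" for e d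
    using assms(1) unfolding dv_def upd_upd[OF assms(1)] by simp
  have fin: "finite (?D e)" for e using assms by (simp add: summ_def)
  have subj: "subst_supp c i j (dv j A) e \<subseteq> ?D e" for e
    using assms(1) unfolding subst_supp_def eqj eq by auto
  show "summ c i j (dv j A)" unfolding summ_def using subj fin by (meson finite_subset)
  have subi: "subst_supp c i j (dv i A) e \<subseteq> (\<lambda>d. d - 1) ` ?D e" for e
  proof
    fix d assume "d \<in> subst_supp c i j (dv i A) e"
    hence *: "c (e i) d \<noteq> 0" "of_int (e i + d + 1) \<noteq> (0 :: complex)" "A (e(i := e i + d + 1, j := e j - d)) \<noteq> 0"
      unfolding subst_supp_def eqi by auto
    have "of_int (e i + d + 1) * c (e i) d \<noteq> 0" using * by (simp only: mult_eq_0_iff simp_thms)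
    hence "c (e i) (d + 1) \<noteq> 0" unfolding pas[of d "e i", symmetric] by (rule contrapos_nn) simp
    hence "d + 1 \<in> ?D e" using * assms(1) unfolding subst_supp_def mem_Collect_eq eq
      by (simp add: algebra_simps)
    thus "d \<in> (\<lambda>d. d - 1) ` ?D e" by (intro image_eqI[of d _ "d + 1"]) simp_all
  qed
  show "dv j (subst c i j A) = (\<lambda>e. subst c i j (dv i A) e + subst c i j (dv j A) e)"
  proof
    fix e
    let ?F = "\<lambda>d. A (e(i := e i + d, j := e j - d + 1))"
    have l: "dv j (subst c i j A) e = (\<Sum>d\<in>?D e. s (of_int (e j + 1) * c (e i) d) (?F d))"
      unfolding dv_def subst_eq_sum[OF fin subset_refl] eq using assms(1) by (simp add: scale_sum_right)
    have r2: "subst c i j (dv j A) e = (\<Sum>d\<in>?D e. s (c (e i) d * of_int (e j - d + 1)) (?F d))"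
      unfolding subst_eq_sum[OF fin subj] eqj by simp
    have "subst c i j (dv i A) e = (\<Sum>d\<in>(\<lambda>d. d - 1) ` ?D e. s (c (e i) d * of_int (e i + d + 1)) (A (e(i := e i + d + 1, j := e j - d))))"
      using subst_eq_sum[OF finite_imageI[OF fin] subi] unfolding eqi by simp
    also have "\<dots> = (\<Sum>d\<in>?D e. s (c (e i) (d - 1) * of_int (e i + d)) (?F d))"
      by (subst sum.reindex) (auto simp: inj_on_def algebra_simps)
    also have "\<dots> = (\<Sum>d\<in>?D e. s (of_int d * c (e i) d) (?F d))"
      using pas[of "_ - 1" "e i"] by (intro sum.cong arg_cong2[of _ _ _ _ s]) (auto simp: algebra_simps)
    finally have r1: "subst c i j (dv i A) e = (\<Sum>d\<in>?D e. s (of_int d * c (e i) d) (?F d))" .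
    \<comment> \<open>The weights \<open>d\<close> and \<open>e j - d + 1\<close> add up to the
      factor \<open>e j + 1\<close> on the left.\<close>
    show "dv j (subst c i j A) e = subst c i j (dv i A) e + subst c i j (dv j A) e"
      unfolding l r1 r2 sum.distrib[symmetric] scale_left_distrib[symmetric]
      by (intro sum.cong arg_cong2[of _ _ _ _ s]) (auto simp: algebra_simps)
  qed
qed

lemma deriv1_funpow:
  "(deriv1 s ^^ k) A m n = s (pochhammer (of_int m + 1) k) (A (m + int k) n)"
proof (induction k arbitrary: m)
  case (Suc k)
  have "(deriv1 s ^^ Suc k) A m n = s (of_int (m + 1)) ((deriv1 s ^^ k) A (m + 1) n)"
    by (simp add: deriv1_def)
  thus ?case unfolding Suc by (simp add: pochhammer_rec algebra_simps)
qed simp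

lemma subst_taylor:
  assumes "i \<noteq> j"
  shows "taylor i j A e = taylor_subst s (\<lambda>m n. A (e(i := m, j := n))) (e i) (e j)"
proof (cases "e i < 0")
  case False
  have "taylor_coeff (e i) d = 1 / fact (nat (e i)) * pochhammer (of_int d + 1) (nat (e i))" for d
    using False by (simp add: taylor_coeff_def gbinomial_pochhammer' algebra_simps)
  thus ?thesis
    using False by (simp add: subst_def taylor_subst_def deriv1_funpow algebra_simps)
qed (simp add: subst_def taylor_subst_def taylor_coeff_def)

lemma Sum_any_int:
  assumes "\<And>d::int. d < 0 \<Longrightarrow> f d = (0 :: 'w)"
  shows "Sum_any f = Sum_any (\<lambda>n::nat. f (int n))"
proof -
  have "{d. f d \<noteq> 0} = int ` {n. f (int n) \<noteq> 0}"
    using assms by (force simp: image_iff intro: exI[of _ "nat _"] dest: leI)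
  thus ?thesis unfolding Sum_any.expand_set by (simp add: sum.reindex)
qed

lemma subst_binom:
  assumes "i \<noteq> j"
  shows "subst binom_coeff i j A e = binom_subst s (\<lambda>m n. A (e(i := m, j := n))) (e i) (e j)"
  unfolding subst_def binom_subst_def
  by (subst Sum_any_int) (auto simp: binom_coeff_def taylor_coeff_def add.commute)

lemma subst_linear:
  assumes "Vector_Spaces.linear s s L" "finite (subst_supp c i j A e)"
  shows "L (subst c i j A e) = subst c i j (\<lambda>e. L (A e)) e"
proof -
  interpret L: Vector_Spaces.linear s s L by fact
  have "subst_supp c i j (\<lambda>e. L (A e)) e \<subseteq> subst_supp c i j A e"
    by (auto simp: subst_supp_def L.zero)
  thus ?thesis using assms(2)
    by (simp add: subst_eq_sum[of "subst_supp c i j A e"] L.sum L.scale)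
qed

section \<open>Joint upper bounds on exponents\<close>

definition Bd :: "nat set \<Rightarrow> 'w dist \<Rightarrow> bool" where
  "Bd I A \<longleftrightarrow> (\<exists>N. \<forall>e. A e \<noteq> 0 \<longrightarrow> (\<forall>i\<in>I. e i \<le> N))"

lemma Bd_mono: "Bd I A \<Longrightarrow> J \<subseteq> I \<Longrightarrow> Bd J A"
  unfolding Bd_def by blast

lemma Bd_zero: "Bd I (\<lambda>e. 0)"
  by (simp add: Bd_def)

lemma Bd_add: "Bd I A \<Longrightarrow> Bd I B \<Longrightarrow> Bd I (\<lambda>e. A e + B e)"
proof -
  assume "Bd I A" "Bd I B"
  then obtain N M where N: "\<And>e. A e \<noteq> 0 \<Longrightarrow> \<forall>i\<in>I. e i \<le> N" and M: "\<And>e. B e \<noteq> 0 \<Longrightarrow> \<forall>i\<in>I. e i \<le> M"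
    unfolding Bd_def by blast
  have "\<forall>i\<in>I. e i \<le> max N M" if "A e + B e \<noteq> 0" for e
  proof -
    have "A e \<noteq> 0 \<or> B e \<noteq> 0" using that by auto
    thus ?thesis using N[of e] M[of e] by (auto simp: le_max_iff_disj)
  qed
  thus ?thesis unfolding Bd_def by blast
qed

lemma Bd_act:
  assumes "Bd I A" shows "Bd I (act q A)"
proof (rule act_closed[of "Bd I", OF Bd_zero Bd_add _ assms])
  fix c A and \<mu> :: "nat \<Rightarrow>\<^sub>0 nat" assume "Bd I A"
  then obtain N where N: "\<And>e. A e \<noteq> 0 \<Longrightarrow> \<forall>i\<in>I. e i \<le> N" unfolding Bd_def by blast
  let ?m = "\<Sum>i\<in>Poly_Mapping.keys \<mu>. int (Poly_Mapping.lookup \<mu> i)"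
  have m: "int (Poly_Mapping.lookup \<mu> i) \<le> ?m" for i
  proof (cases "i \<in> Poly_Mapping.keys \<mu>")
    case True
    thus ?thesis by (intro member_le_sum) auto
  next
    case False
    thus ?thesis by (simp add: in_keys_iff sum_nonneg)
  qed
  have "\<forall>i\<in>I. e i \<le> N + ?m" if "s c (A (lower e \<mu>)) \<noteq> 0" for e :: "nat \<Rightarrow> int"
  proof
    fix i assume "i \<in> I"
    have "A (lower e \<mu>) \<noteq> 0" using that by auto
    from N[OF this] \<open>i \<in> I\<close> have "e i - int (Poly_Mapping.lookup \<mu> i) \<le> N" by blast
    thus "e i \<le> N + ?m" using m[of i] by linarith
  qed
  thus "Bd I (\<lambda>e. s c (A (lower e \<mu>)))" unfolding Bd_def by blast
qed

lemma Bd_summ: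
  assumes "Bd {i, j} A" "i \<noteq> j"
  shows "summ c i j A"
proof -
  obtain N where N: "\<And>e. A e \<noteq> 0 \<Longrightarrow> e i \<le> N \<and> e j \<le> N" using assms unfolding Bd_def by blast
  have "subst_supp c i j A e \<subseteq> {e j - N..N - e i}" for e
  proof
    fix d assume "d \<in> subst_supp c i j A e"
    hence "A (e(i := e i + d, j := e j - d)) \<noteq> 0" by (simp add: subst_supp_def)
    from N[OF this] show "d \<in> {e j - N..N - e i}" using assms(2) by auto
  qed
  thus ?thesis unfolding summ_def by (meson finite_atLeastAtMost_int finite_subset)
qed

lemma subst_taylor_neg: "e i < 0 \<Longrightarrow> taylor i j A e = 0"
  by (rule subst_eq_0) (simp add: taylor_coeff_def)

lemma Bd_subst_taylor:
  assumes "Bd (insert i (insert j I)) A" "i \<noteq> j" "i \<notin> I"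
  shows "Bd (insert j I) (taylor i j A)"
proof -
  obtain N where N: "\<And>e l. A e \<noteq> 0 \<Longrightarrow> l \<in> insert i (insert j I) \<Longrightarrow> e l \<le> N"
    using assms unfolding Bd_def by blast
  \<comment> \<open>Since \<open>e i + d \<le> N\<close> with \<open>e i \<ge> 0\<close>, at most
    \<open>N\<close> is added to an exponent of \<open>x_j\<close> that was at most \<open>N\<close>
    before. The maximum covers negative \<open>N\<close>.\<close>
  have "\<forall>l\<in>insert j I. e l \<le> max N (N + N)" if *: "taylor i j A e \<noteq> 0" for e
  proof
    fix l assume l: "l \<in> insert j I"
    have k: "e i \<ge> 0" using * subst_taylor_neg[of e i j A] by force
    from * obtain d where d: "A (e(i := e i + d, j := e j - d)) \<noteq> 0" by (elim subst_nonzero)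
    have "e i + d \<le> N" "e j - d \<le> N" using N[OF d, of i] N[OF d, of j] assms(2) by auto
    moreover have "e l \<le> N" if "l \<noteq> j" using N[OF d, of l] l that assms(3) by (cases "l = i") auto
    ultimately show "e l \<le> max N (N + N)" using k by (cases "l = j") auto
  qed
  thus ?thesis unfolding Bd_def by blast
qed

end

section \<open>Cancellation\<close>

lemma finite_bound:
  fixes Q :: "'i \<Rightarrow> int \<Rightarrow> bool"
  assumes "finite I" "\<And>i. i \<in> I \<Longrightarrow> \<exists>B. \<forall>n>B. Q i n"
  shows "\<exists>B. \<forall>n>B. \<forall>i\<in>I. Q i n"
  using assms
proof (induction I rule: finite_induct)
  case (insert x I)
  then obtain B C where "\<forall>n>B. \<forall>i\<in>I. Q i n" "\<forall>n>C. Q x n" by (metis insertI1 insertI2)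
  hence "\<forall>n>max B C. \<forall>i\<in>insert x I. Q i n" by simp
  thus ?case by blast
qed simp

lemma poly_split_monom:
  fixes p :: "'a::comm_ring_1 poly"
  assumes "p \<noteq> 0"
  obtains k h g where "h \<noteq> 0" "p = [:0, 1:] ^ k * pCons h g"
  using assms
proof (induction p arbitrary: thesis)
  case (pCons a p)
  show ?case
  proof (cases "a = 0")
    case False
    show ?thesis by (rule pCons.prems(1)[of a 0 p]) (use False in simp_all)
  next
    case True
    hence "p \<noteq> 0" using pCons.prems(2) by auto
    then obtain k h g where "h \<noteq> 0" "p = [:0, 1:] ^ k * pCons h g" using pCons.IH by blast
    thus ?thesis using True by (intro pCons.prems(1)[of h "Suc k" g]) (simp_all add: mult.assoc)
  qed
qed simp

lemma pcompose_shift_eq_0: "pcompose p (var1 + var2) = 0 \<longleftrightarrow> p = 0"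
proof -
  have "degree (var1 + var2) = Suc 0" by (simp add: var1_def var2_def)
  thus ?thesis by (auto dest: pcompose_eq_0)
qed

text \<open>\<open>h\<close> is the lowest nonzero coefficient of \<open>p(z+x,x)\<close> in powers
  of z. The identity is kept for arbitrary \<open>S\<close> and \<open>Q\<close>, because sums of
  variables will be inserted for both z and x.\<close>

lemma ev2_shift_split:
  assumes "p \<noteq> 0"
  shows "\<exists>k h g. h \<noteq> 0 \<and> (\<forall>S Q. ev2 p (S + Q) Q = S ^ k * (ev1 h Q + S * ev2 g S Q))"
proof -
  have "pcompose p (var1 + var2) \<noteq> 0" using assms by (simp add: pcompose_shift_eq_0)
  then obtain k h g where h: "h \<noteq> 0" and eq: "pcompose p (var1 + var2) = var1 ^ k * pCons h g"
    unfolding var1_def by (rule poly_split_monom)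
  have "ev2 p (S + Q) Q = S ^ k * (ev1 h Q + S * ev2 g S Q)" for S Q
    unfolding ev2_shift[symmetric] eq ev2_simps ev2_power ev2_vars ..
  thus ?thesis using h by blast
qed

lemma vector_space_pscale: "vector_space t \<Longrightarrow> vector_space (pscale t)"
  unfolding vector_space_def pscale_def by (auto simp: fun_eq_iff)

context complex_space
begin

text \<open>Unlike in \<open>Bd {b}\<close>, the bound may vary with the other exponents. This is
  all that is available when an operator acts on coefficients of a product, where each choice of
  exponents gives another vector.\<close>

definition bdd_in :: "nat \<Rightarrow> 'w dist \<Rightarrow> bool" where
  "bdd_in b A \<longleftrightarrow> (\<forall>e. \<exists>N. \<forall>n>N. A (e(b := n)) = 0)"

lemma bdd_in_add:
  assumes "bdd_in b A" "bdd_in b B"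
  shows "bdd_in b (\<lambda>e. A e + B e)"
  unfolding bdd_in_def
proof
  fix e
  obtain N M where "\<forall>n>N. A (e(b := n)) = 0" "\<forall>n>M. B (e(b := n)) = 0"
    using assms unfolding bdd_in_def by blast
  hence "\<forall>n>max N M. A (e(b := n)) + B (e(b := n)) = 0" by simp
  thus "\<exists>N. \<forall>n>N. A (e(b := n)) + B (e(b := n)) = 0" by blast
qed

lemma bdd_in_act:
  assumes "bdd_in b A" shows "bdd_in b (act q A)"
proof (rule act_closed[of "bdd_in b", OF _ _ _ assms])
  show "bdd_in b (\<lambda>e. A e + B e)" if "bdd_in b A" "bdd_in b B" for A B
    using that by (rule bdd_in_add)
next
  fix c A and \<mu> :: "nat \<Rightarrow>\<^sub>0 nat" assume A: "bdd_in b A"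
  show "bdd_in b (\<lambda>e. s c (A (lower e \<mu>)))"
    unfolding bdd_in_def
  proof
    fix e :: "nat \<Rightarrow> int"
    let ?e = "lower e \<mu>"
    obtain N where N: "\<And>n. n > N \<Longrightarrow> A (?e(b := n)) = 0"
      using A unfolding bdd_in_def by blast
    have "(lower (e(b := n)) \<mu>) = ?e(b := n - int (Poly_Mapping.lookup \<mu> b))" for n
      by auto
    hence "\<forall>n > N + int (Poly_Mapping.lookup \<mu> b). s c (A (lower (e(b := n)) \<mu>)) = 0"
      using N by simp
    thus "\<exists>N. \<forall>n>N. s c (A (lower (e(b := n)) \<mu>)) = 0" by blast
  qed
qed (simp add: bdd_in_def)

lemma bdd_in_diff:
  assumes "bdd_in b A" "bdd_in b B"
  shows "bdd_in b (\<lambda>e. A e - B e)"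
  using bdd_in_add[OF assms(1) bdd_in_act[OF assms(2), of "mconst (- 1)"]]
  by (simp add: act_mconst)

lemma Bd_bdd_in: "Bd I A \<Longrightarrow> b \<in> I \<Longrightarrow> bdd_in b A"
  unfolding bdd_in_def Bd_def by (metis fun_upd_same linorder_not_le)

text \<open>A nonzero \<open>h\<close> is invertible in Laurent series in the inverse variable.
  Concretely, the highest nonzero term of \<open>A\<close> at some exponent
  \<open>m \<ge> n0\<close>, times the leading term of \<open>h\<close>, could not be cancelled at
  exponent \<open>m + degree h\<close>.\<close>

lemma act_ev1_vanish:
  assumes h: "h \<noteq> 0" and A: "bdd_in b A"
    and 0: "\<And>n. n \<ge> n0 \<Longrightarrow> act (ev1 h (mvar b)) A (e(b := n)) = 0"
    and n: "n \<ge> n0"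
  shows "A (e(b := n)) = 0"
proof (rule ccontr)
  assume nz: "A (e(b := n)) \<noteq> 0"
  obtain N where N: "\<forall>n>N. A (e(b := n)) = 0" using A unfolding bdd_in_def by blast
  let ?S = "{m. n0 \<le> m \<and> A (e(b := m)) \<noteq> 0}"
  have "?S \<subseteq> {n0..N}" using N by force
  hence fin: "finite ?S" by (rule finite_subset) simp
  define m where "m = Max ?S"
  have m: "m \<in> ?S" unfolding m_def using fin nz n by (intro Max_in) auto
  have above: "A (e(b := k)) = 0" if "k > m" for k
  proof (rule ccontr)
    assume "A (e(b := k)) \<noteq> 0"
    hence "k \<in> ?S" using that m by auto
    thus False using Max_ge[OF fin, of k] that unfolding m_def by simp
  qed
  have "0 = act (ev1 h (mvar b)) A (e(b := m + int (degree h)))"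
    using 0[of "m + int (degree h)"] m by simp
  also have "\<dots> = (\<Sum>i\<le>degree h. s (coeff h i) (A (e(b := m + int (degree h) - int i))))"
    by (simp add: act_ev1)
  also have "\<dots> = (\<Sum>i\<in>{degree h}. s (coeff h i) (A (e(b := m + int (degree h) - int i))))"
    by (rule sum.mono_neutral_right) (auto intro!: above)
  finally show False using h m by auto
qed

text \<open>Dividing by \<open>h\<close> preserves the very bound \<open>N\<close>: if some exponent
  of \<open>e\<close> exceeds \<open>N\<close>, then the multiple vanishes at \<open>e\<close> and
  wherever only the exponent of \<open>x_b\<close> is raised, so \<open>act_ev1_vanish\<close>
  applies at \<open>e\<close>.\<close>

lemma Bd_cancel:
  assumes "h \<noteq> 0" "bdd_in b A" "b \<in> I" "Bd I (act (ev1 h (mvar b)) A)"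
  shows "Bd I A"
proof -
  let ?H = "act (ev1 h (mvar b)) A"
  obtain N where N: "\<And>e i. ?H e \<noteq> 0 \<Longrightarrow> i \<in> I \<Longrightarrow> e i \<le> N"
    using assms(4) unfolding Bd_def by blast
  have "e i \<le> N" if "A e \<noteq> 0" "i \<in> I" for e i
  proof (rule ccontr)
    assume i: "\<not> e i \<le> N"
    have "\<And>n. n \<ge> e b \<Longrightarrow> ?H (e(b := n)) = 0"
    proof (rule ccontr)
      fix n assume n: "n \<ge> e b" and "?H (e(b := n)) \<noteq> 0"
      from N[OF this(2) \<open>i \<in> I\<close>] show False using i n by (cases "i = b") auto
    qed
    from act_ev1_vanish[where e = e and n = "e b" and ?n0.0 = "e b", OF assms(1,2) this order_refl] show False using \<open>A e \<noteq> 0\<close> by simp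
  qed
  thus ?thesis unfolding Bd_def by blast
qed

text \<open>Laurent series in \<open>x_i\<close> whose coefficients are Laurent series in
  \<open>x_l\<close>, uniformly in all other exponents. The second clause covers all levels up to
  \<open>m\<close> at once, which makes it stable under multiplication by polynomials. For
  \<open>i = l\<close> it is a plain lower bound.\<close>

definition lex_below :: "nat \<Rightarrow> nat \<Rightarrow> 'w dist \<Rightarrow> bool" where
  "lex_below i l A \<longleftrightarrow> (\<exists>M. \<forall>e. e i < M \<longrightarrow> A e = 0) \<and>
     (\<forall>m. \<exists>M. \<forall>e. e i \<le> m \<longrightarrow> e l < M \<longrightarrow> A e = 0)"

lemma lex_belowI:
  assumes M: "\<And>e. e i < M \<Longrightarrow> A e = 0" and lev: "\<And>m. \<exists>M. \<forall>e. e i = m \<longrightarrow> e l < M \<longrightarrow> A e = 0"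
  shows "lex_below i l A"
proof -
  have "\<exists>M'. \<forall>e. e i \<le> m \<longrightarrow> e l < M' \<longrightarrow> A e = 0" for m
  proof -
    have "\<exists>B. \<forall>n>B. \<forall>k\<in>{M..m}. \<forall>e. e i = k \<longrightarrow> e l < - n \<longrightarrow> A e = 0"
    proof (rule finite_bound)
      fix k
      obtain N where "\<forall>e. e i = k \<longrightarrow> e l < N \<longrightarrow> A e = 0" using lev by blast
      thus "\<exists>B. \<forall>n>B. \<forall>e. e i = k \<longrightarrow> e l < - n \<longrightarrow> A e = 0" by (intro exI[of _ "- N"]) auto
    qed simp
    then obtain B where B: "\<And>n k e. n > B \<Longrightarrow> k \<in> {M..m} \<Longrightarrow> e i = k \<Longrightarrow> e l < - n \<Longrightarrow> A e = 0"
      by blast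
    have "A e = 0" if "e i \<le> m" "e l < - (B + 1)" for e
    proof (cases "e i < M")
      case False
      thus ?thesis using B[of "B + 1" "e i" e] that by simp
    qed (rule M)
    thus ?thesis by blast
  qed
  thus ?thesis using M unfolding lex_below_def by blast
qed

lemma lex_below_act: "lex_below i l A \<Longrightarrow> lex_below i l (act q A)"
proof -
  assume A: "lex_below i l A"
  obtain M where M: "\<forall>e. e i < M \<longrightarrow> A e = 0" using A unfolding lex_below_def by blast
  have "act q A e = 0" if "e i < M" for e
  proof (rule act_eq_0)
    fix e' assume "\<forall>x. e' x \<le> e x"
    from this[rule_format, of i] show "A e' = 0" using that M by simp
  qed
  moreover have "\<exists>N. \<forall>e. e i \<le> m \<longrightarrow> e l < N \<longrightarrow> act q A e = 0" for m
  proof -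
    obtain N where N: "\<forall>e. e i \<le> m \<longrightarrow> e l < N \<longrightarrow> A e = 0" using A unfolding lex_below_def by blast
    have "act q A e = 0" if "e i \<le> m" "e l < N" for e
    proof (rule act_eq_0)
      fix e' assume *: "\<forall>x. e' x \<le> e x"
      show "A e' = 0" using that N *[rule_format, of i] *[rule_format, of l] by simp
    qed
    thus ?thesis by blast
  qed
  ultimately show ?thesis unfolding lex_below_def by blast
qed

text \<open>Double induction upwards, on the level of \<open>x_i\<close> and inside it on that of
  \<open>x_l\<close>: the terms with \<open>x_i\<close> and \<open>x_l\<close> read \<open>F\<close>
  only where it is already known to vanish, so \<open>h F\<close> vanishes and \<open>h\<close> is
  divided out. The downward closed region \<open>D\<close> permits conclusions where the product is
  known only in part.\<close>

lemma lex_cancel: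
  assumes h: "h \<noteq> 0" and b: "b \<noteq> i" "b \<noteq> l" and F: "bdd_in b F" and lex: "lex_below i l F"
    and D: "\<And>e e'. D e \<Longrightarrow> e' i \<le> e i \<Longrightarrow> e' l \<le> e l \<Longrightarrow> D e'"
    and 0: "\<And>e. D e \<Longrightarrow> act (ev1 h (mvar b) + mvar i * K + mvar l * K') F e = 0"
    and e: "D e"
  shows "F e = 0"
proof -
  obtain M where M: "\<And>e. e i < M \<Longrightarrow> F e = 0" using lex unfolding lex_below_def by blast
  have "D e \<Longrightarrow> e i < M + int k \<Longrightarrow> F e = 0" for e k
  proof (induction k arbitrary: e)
    case 0
    thus ?case using M by simp
  next
    case (Suc k)
    define m where "m = M + int k"
    obtain M' where M': "\<And>e. e i \<le> m \<Longrightarrow> e l < M' \<Longrightarrow> F e = 0"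
      using lex unfolding lex_below_def by blast
    have outer: "F e = 0" if "D e" "e i < m" for e using Suc.IH that unfolding m_def by blast
    have inner: "D e \<Longrightarrow> e i = m \<Longrightarrow> e l < M' + int q \<Longrightarrow> F e = 0" for e q
    proof (induction q arbitrary: e)
      case 0
      thus ?case using M' by simp
    next
      case (Suc q)
      have "act (ev1 h (mvar b)) F (e(b := n)) = 0" for n
      proof -
        let ?e = "e(b := n)"
        have De: "D ?e" by (rule D[OF Suc.prems(1)]) (use b in simp_all)
        have "act K F (?e(i := ?e i - 1)) = 0"
        proof (rule act_eq_0)
          fix e' assume le: "\<forall>j. e' j \<le> (?e(i := ?e i - 1)) j"
          have "e' i \<le> e i - 1" "e' l \<le> e l" using le[rule_format, of i] le[rule_format, of l] b
            by (auto split: if_splits)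
          thus "F e' = 0" using Suc.prems b by (intro outer D[OF De]) auto
        qed
        moreover have "act K' F (?e(l := ?e l - 1)) = 0"
        proof (rule act_eq_0)
          fix e' assume le: "\<forall>j. e' j \<le> (?e(l := ?e l - 1)) j"
          have *: "e' i \<le> e i" "e' l \<le> e l - 1" using le[rule_format, of i] le[rule_format, of l] b
            by (auto split: if_splits)
          have D': "D e'" using * b by (intro D[OF De]) auto
          show "F e' = 0"
          proof (cases "e' i = m")
            case True
            show ?thesis by (rule Suc.IH[OF D' True]) (use * Suc.prems in auto)
          next
            case False
            show ?thesis by (rule outer[OF D']) (use * False Suc.prems in auto)
          qed
        qed
        ultimately show ?thesis using 0[OF De] by (simp add: act_add act_mult act_mvar)
      qed
      from act_ev1_vanish[where e = e and n = "e b" and ?n0.0 = "e b", OF h F this order_refl] show ?case by simp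
    qed
    show ?case
    proof (cases "e i = m")
      case True
      show ?thesis by (rule inner[OF Suc.prems(1) True, of "nat (e l - M' + 1)"]) simp
    next
      case False
      thus ?thesis using Suc.prems by (intro outer) (auto simp: m_def)
    qed
  qed
  from this[OF e, of "nat (e i - M + 1)"] show ?thesis by simp
qed

lemma mvar_power_cancel:
  assumes "\<And>e. act (mvar i ^ k) A e = act (mvar i ^ k) B e"
  shows "A = B"
proof
  fix e
  show "A e = B e" using assms[of "e(i := e i + int k)"] by (simp add: act_mvar_power)
qed

lemma shift_cancel:
  assumes "p \<noteq> 0" "i \<noteq> j" "bdd_in j F" "bdd_in j G"
    and "\<And>e. e i < M \<Longrightarrow> F e = 0" "\<And>e. e i < M \<Longrightarrow> G e = 0"
    and "act (at2_shift i j p) F = act (at2_shift i j p) G"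
  shows "F = G"
proof -
  obtain k h g where h: "h \<noteq> 0"
    and eq: "\<forall>S Q. ev2 p (S + Q) Q = S ^ k * (ev1 h Q + S * ev2 g S Q)"
    using ev2_shift_split[OF assms(1)] by (elim exE conjE)
  let ?P = "ev1 h (mvar j) + mvar i * at2 i j g"
  let ?D = "\<lambda>e. F e - G e"
  have PFG: "act ?P F = act ?P G"
  proof (rule mvar_power_cancel[of i k])
    fix e
    show "act (mvar i ^ k) (act ?P F) e = act (mvar i ^ k) (act ?P G) e"
      using fun_cong[OF assms(7), of e] unfolding eq[rule_format] act_mult[of "mvar i ^ k"] .
  qed
  have 0: "act (?P + mvar i * 0) ?D e = 0" for e
    unfolding mult_zero_right add_0_right act_diff_right PFG by (rule diff_self)
  \<comment> \<open>One lower variable suffices here, so both roles go to \<open>i\<close> and the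
    third summand of the multiplier is \<open>mvar i * 0\<close>.\<close>
  have "F e - G e = 0" for e
  proof (rule lex_cancel[where D = "\<lambda>_. True" and i = i and l = i])
    show "bdd_in j ?D" by (rule bdd_in_diff[OF assms(3,4)])
    have "?D e = 0" if "e i < M" for e using assms(5)[of e] assms(6)[of e] that by simp
    thus "lex_below i i ?D" unfolding lex_below_def by blast
    show "act (?P + mvar i * 0) ?D e = 0" for e by (rule 0)
  qed (rule h, use assms(2) in auto)
  thus ?thesis by (auto simp: fun_eq_iff)
qed

section \<open>The operation \<open>Y\<close>\<close>

definition emb2 :: "(int \<Rightarrow> int \<Rightarrow> 'w) \<Rightarrow> 'w dist" where
  "emb2 A = (\<lambda>e. A (e 0) (e 1))"

lemma emb2_eqD: "emb2 A = emb2 B \<Longrightarrow> A = B"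
proof (intro ext)
  fix m n assume "emb2 A = emb2 B"
  from fun_cong[OF this, of "\<lambda>i. if i = 0 then m else n"] show "A m n = B m n" by (simp add: emb2_def)
qed

lemma emb2_pmul: "emb2 (pmul s p A) = act (at2 0 1 p) (emb2 A)"
  by (simp add: fun_eq_iff act_ev2 emb2_def)

lemma emb2_pmul_shift:
  "emb2 (pmul s (pcompose p (var1 + var2)) A) = act (at2_shift 0 1 p) (emb2 A)"
  by (simp add: emb2_pmul ev2_shift)

lemma emb2_taylor: "emb2 (taylor_subst s A) = taylor 0 1 (emb2 A)"
  by (simp add: fun_eq_iff subst_taylor emb2_def)

lemma pmul_simps:
  "pmul s (p + q) A = (\<lambda>m n. pmul s p A m n + pmul s q A m n)"
  "pmul s (p * q) A = pmul s p (pmul s q A)"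
  "pmul s [:[:c:]:] A = (\<lambda>m n. s c (A m n))"
  "pmul s var1 A = (\<lambda>m n. A (m - 1) n)"
  "pmul s var2 A = (\<lambda>m n. A m (n - 1))"
proof -
  show "pmul s (p + q) A = (\<lambda>m n. pmul s p A m n + pmul s q A m n)"
  proof (rule emb2_eqD)
    have "emb2 (pmul s (p + q) A) = (\<lambda>e. emb2 (pmul s p A) e + emb2 (pmul s q A) e)"
      by (simp only: emb2_pmul ev2_simps act_add)
    thus "emb2 (pmul s (p + q) A) = emb2 (\<lambda>m n. pmul s p A m n + pmul s q A m n)"
      by (simp only: emb2_def)
  qed
  show "pmul s (p * q) A = pmul s p (pmul s q A)"
    by (rule emb2_eqD) (simp add: emb2_pmul ev2_simps act_mult)
  show "pmul s [:[:c:]:] A = (\<lambda>m n. s c (A m n))"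
    by (rule emb2_eqD) (simp add: emb2_pmul ev2_simps ev1_simps act_mconst, simp add: emb2_def)
  show "pmul s var1 A = (\<lambda>m n. A (m - 1) n)" "pmul s var2 A = (\<lambda>m n. A m (n - 1))"
    by (rule emb2_eqD, simp add: emb2_pmul ev2_vars act_mvar, simp add: emb2_def)+
qed

lemma laurent_inf_iff: "f \<in> laurent_inf \<longleftrightarrow> (\<exists>N. \<forall>n>N. f n = 0)"
  unfolding laurent_inf_def mem_Collect_eq by (meson not_le)

text \<open>This is \<open>W((x^-1))((x_0))\<close>, with the exponent of \<open>x_0\<close> first.
  The upper bound in x may grow with the power of \<open>x_0\<close>.\<close>

definition LL :: "(int \<Rightarrow> int \<Rightarrow> 'w) set" where
  "LL = {F. (\<exists>M. \<forall>k<M. F k = 0) \<and> (\<forall>k. F k \<in> laurent_inf)}"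

lemma LL_emb2:
  assumes "F \<in> LL"
  shows "bdd_in 1 (emb2 F)" "\<exists>M. \<forall>e. e 0 < M \<longrightarrow> emb2 F e = 0"
proof -
  have "\<exists>N. \<forall>n>N. F k n = 0" for k
    using assms by (simp add: LL_def laurent_inf_iff)
  thus "bdd_in 1 (emb2 F)" by (simp add: bdd_in_def emb2_def)
  show "\<exists>M. \<forall>e. e 0 < M \<longrightarrow> emb2 F e = 0"
  proof -
    obtain M where "\<forall>k<M. F k = 0" using assms unfolding LL_def by blast
    thus ?thesis by (intro exI[of _ M]) (simp add: emb2_def)
  qed
qed

lemma LL_cancel:
  assumes "p \<noteq> 0" "F \<in> LL" "G \<in> LL"
    and "pmul s (pcompose p (var1 + var2)) F = pmul s (pcompose p (var1 + var2)) G"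
  shows "F = G"
proof (rule emb2_eqD)
  obtain M M' where M: "\<And>e. e 0 < M \<Longrightarrow> emb2 F e = 0" "\<And>e. e 0 < M' \<Longrightarrow> emb2 G e = 0"
    using LL_emb2(2)[OF assms(2)] LL_emb2(2)[OF assms(3)] by blast
  show "emb2 F = emb2 G"
    by (rule shift_cancel[OF assms(1), of 0 1 _ _ "min M M'"])
      (use LL_emb2(1)[OF assms(2)] LL_emb2(1)[OF assms(3)] M emb2_pmul_shift[of p] assms(4) in \<open>simp_all, metis\<close>)
qed

section \<open>The action of Laurent series coefficients, reduced to polynomial multiples\<close>

definition fls_supp :: "complex fls fls \<Rightarrow> (int \<Rightarrow> int \<Rightarrow> 'w) \<Rightarrow> int \<Rightarrow> int \<Rightarrow> (int \<times> int) set" where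
  "fls_supp z F k n = {(i, j). fls_nth (fls_nth z i) (- j) \<noteq> 0 \<and> F (k - i) (n - j) \<noteq> 0}"

lemma finite_fls_supp:
  assumes "F \<in> LL" shows "finite (fls_supp z F k n)"
proof -
  obtain M where M: "\<And>k n. k < M \<Longrightarrow> F k n = 0"
    using assms unfolding LL_def mem_Collect_eq by (metis zero_fun_apply)
  have "\<forall>k. \<exists>N. \<forall>n. F k n \<noteq> 0 \<longrightarrow> n \<le> N" using assms by (auto simp: LL_def laurent_inf_def)
  then obtain N where N: "\<And>k n. F k n \<noteq> 0 \<Longrightarrow> n \<le> N k" by metis
  have "fls_supp z F k n \<subseteq> (SIGMA i:{fls_subdegree z..k - M}. {n - N (k - i)..- fls_subdegree (fls_nth z i)})"
  proof
    fix x assume "x \<in> fls_supp z F k n"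
    then obtain i j where x: "x = (i, j)" "fls_nth (fls_nth z i) (- j) \<noteq> 0" "F (k - i) (n - j) \<noteq> 0"
      by (auto simp: fls_supp_def)
    have "fls_nth z i \<noteq> 0" using x by auto
    hence "fls_subdegree z \<le> i" by (rule fls_subdegree_leI)
    moreover have "fls_subdegree (fls_nth z i) \<le> - j" using x by (intro fls_subdegree_leI)
    moreover have "k - i \<ge> M" using x M[of "k - i" "n - j"] by force
    ultimately show "x \<in> (SIGMA i:{fls_subdegree z..k - M}. {n - N (k - i)..- fls_subdegree (fls_nth z i)})"
      using N[OF x(3)] x(1) by auto
  qed
  thus ?thesis by (rule finite_subset) simp
qed

lemma fls_mul_eq_sum:
  assumes "finite D" "fls_supp z F k n \<subseteq> D"
  shows "fls_mul s z F k n = (\<Sum>(i, j)\<in>D. s (fls_nth (fls_nth z i) (- j)) (F (k - i) (n - j)))"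
  unfolding fls_mul_def
  by (rule Sum_any.expand_superset) (use assms in \<open>auto simp: fls_supp_def\<close>)

lemma fls_mul_add:
  assumes "F \<in> LL"
  shows "fls_mul s (z + z') F k n = fls_mul s z F k n + fls_mul s z' F k n"
proof -
  let ?D = "fls_supp z F k n \<union> fls_supp z' F k n"
  have "finite ?D" using assms by (simp add: finite_fls_supp)
  moreover have "fls_supp (z + z') F k n \<subseteq> ?D" by (auto simp: fls_supp_def)
  ultimately show ?thesis
    by (simp add: fls_mul_eq_sum[of ?D] case_prod_unfold scale_left_distrib sum.distrib)
qed

lemma fls_mul_one: "fls_mul s 1 F = F"
proof (intro ext)
  fix k n
  have "fls_supp 1 F k n \<subseteq> {(0, 0)}" by (auto simp: fls_supp_def split: if_splits)
  thus "fls_mul s 1 F k n = F k n" by (simp add: fls_mul_eq_sum[of "{(0, 0)}"])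
qed

lemma emb_basic:
  "emb [:[:c:]:] = fls_const (fls_const c)" "emb var1 = fls_X" "emb var2 = fls_const fls_X_inv"
  by (simp_all add: emb_def emb_x_def var1_def var2_def map_poly_pCons)

lemma fls_mul_const: "fls_mul s (emb [:[:c:]:] * z) F k n = s c (fls_mul s z F k n)"
proof (cases "c = 0")
  case False
  have "fls_mul s (emb [:[:c:]:] * z) F k n =
      Sum_any (\<lambda>x. s c (case x of (i, j) \<Rightarrow> s (fls_nth (fls_nth z i) (- j)) (F (k - i) (n - j))))"
    unfolding fls_mul_def emb_basic by (simp add: case_prod_unfold)
  also have "\<dots> = s c (fls_mul s z F k n)"
    unfolding fls_mul_def Sum_any.expand_set scale_sum_right using False by simp
  finally show ?thesis .
qed (simp add: fls_mul_def emb_hom)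

lemma fls_mul_var1: "fls_mul s (emb var1 * z) F k n = fls_mul s z F (k - 1) n"
  unfolding fls_mul_def emb_basic fls_X_times_conv_shift
  by (rule Sum_any.reindex_cong[of "\<lambda>(i, j). (i + 1, j)"])
    (auto simp: fun_eq_iff algebra_simps intro!: o_bij[of "\<lambda>(i, j). (i - 1, j)"])

lemma fls_mul_var2: "fls_mul s (emb var2 * z) F k n = fls_mul s z F k (n - 1)"
  unfolding fls_mul_def emb_basic
  by (rule Sum_any.reindex_cong[of "\<lambda>(i, j). (i, j + 1)"])
    (auto simp: fun_eq_iff algebra_simps fls_X_inv_times_conv_shift intro!: o_bij[of "\<lambda>(i, j). (i, j - 1)"])

text \<open>Associativity between a polynomial and a series, built up from constants and the two
  variables. With \<open>emb P * z = 1\<close> it turns multiplication by \<open>z\<close> into a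
  solution of an equation with polynomial multiplier \<open>P\<close>.\<close>

lemma fls_mul_emb:
  assumes "F \<in> LL"
  shows "fls_mul s (emb P * z) F = pmul s P (fls_mul s z F)"
proof -
  have inner: "fls_mul s (emb [:h:] * z) F = pmul s [:h:] (fls_mul s z F)" for h z
  proof (induction h arbitrary: z)
    case 0
    show ?case by (simp add: fls_mul_def pmul_def emb_hom fun_eq_iff)
  next
    case (pCons c h)
    have eq: "[:pCons c h:] = [:[:c:]:] + var2 * [:h:]" by (simp add: var2_def)
    define H where "H = [:h:]"
    have e: "emb (var2 * H) * z = emb var2 * (emb H * z)" by (simp only: emb_hom mult.assoc)
    have IH: "fls_mul s (emb H * z) F = pmul s H (fls_mul s z F)" unfolding H_def by (rule pCons.IH)
    show ?case unfolding eq emb_hom(2) distrib_right H_def[symmetric]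
      by (simp add: fun_eq_iff fls_mul_add[OF assms] fls_mul_const fls_mul_var2 pmul_simps e IH)
  qed
  show ?thesis
  proof (induction P arbitrary: z)
    case 0
    show ?case by (simp add: fls_mul_def pmul_def emb_hom fun_eq_iff)
  next
    case (pCons h P)
    have eq: "pCons h P = [:h:] + var1 * P" by (simp add: var1_def)
    have e: "emb (var1 * P) * z = emb var1 * (emb P * z)" by (simp only: emb_hom mult.assoc)
    show ?case unfolding eq emb_hom(2) distrib_right
      by (simp add: fun_eq_iff fls_mul_add[OF assms] fls_mul_var1 inner pCons.IH pmul_simps e)
  qed
qed

text \<open>For each power of \<open>x_0\<close> only finitely many coefficients of \<open>z\<close>
  meet the support of \<open>F\<close>. The explicit lower bound matters because it depends on
  \<open>F\<close> only through \<open>M\<close>: for the Taylor expansions below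
  \<open>M = 0\<close> works for every vector, so \<open>Y_Eo\<close> is truncated
  uniformly.\<close>

lemma fls_mul_LL:
  assumes "F \<in> LL" and M: "\<And>k n. k < M \<Longrightarrow> F k n = 0"
  shows "fls_mul s z F \<in> LL" "k < M + fls_subdegree z \<Longrightarrow> fls_mul s z F k n = 0"
proof -
  have nz: "\<exists>i j. fls_nth (fls_nth z i) (- j) \<noteq> 0 \<and> F (k - i) (n - j) \<noteq> 0" if "fls_mul s z F k n \<noteq> 0" for k n
  proof (rule ccontr)
    assume "\<not> ?thesis"
    hence "fls_supp z F k n = {}" by (auto simp: fls_supp_def)
    thus False using that fls_mul_eq_sum[of "{}" z F k n] by simp
  qed
  have sub: "fls_subdegree z \<le> i" if "fls_nth (fls_nth z i) (- j) \<noteq> 0" for i j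
  proof -
    have "fls_nth z i \<noteq> 0" using that by auto
    thus ?thesis by (rule fls_subdegree_leI)
  qed
  have low: "fls_mul s z F k n = 0" if "k < M + fls_subdegree z" for k n
  proof (rule ccontr)
    assume "fls_mul s z F k n \<noteq> 0"
    then obtain i j where ij: "fls_nth (fls_nth z i) (- j) \<noteq> 0" "F (k - i) (n - j) \<noteq> 0" using nz by blast
    have "\<not> k - i < M" using ij(2) M by blast
    thus False using sub[OF ij(1)] that by simp
  qed
  thus "k < M + fls_subdegree z \<Longrightarrow> fls_mul s z F k n = 0" .
  have "\<forall>k. \<exists>N. \<forall>n. F k n \<noteq> 0 \<longrightarrow> n \<le> N" using assms by (auto simp: LL_def laurent_inf_def)
  then obtain N where N: "\<And>k n. F k n \<noteq> 0 \<Longrightarrow> n \<le> N k" by metis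
  have "fls_mul s z F k \<in> laurent_inf" for k
  proof -
    let ?I = "{fls_subdegree z..k - M}"
    have "\<exists>B. \<forall>n>B. \<forall>i\<in>?I. N (k - i) - fls_subdegree (fls_nth z i) < n"
      by (rule finite_bound) auto
    then obtain B where B: "\<And>n i. n > B \<Longrightarrow> i \<in> ?I \<Longrightarrow> N (k - i) - fls_subdegree (fls_nth z i) < n" by blast
    have "n \<le> B" if nz0: "fls_mul s z F k n \<noteq> 0" for n
    proof (rule ccontr)
      assume n: "\<not> n \<le> B"
      obtain i j where ij: "fls_nth (fls_nth z i) (- j) \<noteq> 0" "F (k - i) (n - j) \<noteq> 0" using nz[OF nz0] by blast
      have "\<not> k - i < M" using ij(2) M by blast
      hence "N (k - i) - fls_subdegree (fls_nth z i) < n" using sub[OF ij(1)] n by (intro B) auto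
      moreover have "fls_subdegree (fls_nth z i) \<le> - j" using ij by (intro fls_subdegree_leI)
      ultimately show False using N[OF ij(2)] by simp
    qed
    thus ?thesis unfolding laurent_inf_def by blast
  qed
  thus "fls_mul s z F \<in> LL" unfolding LL_def using low by (auto simp: fun_eq_iff)
qed

section \<open>Regular pairs and the characterisation of \<open>Y_Eo\<close>\<close>

definition pair :: "complex poly poly \<Rightarrow> ('w \<Rightarrow> int \<Rightarrow> 'w) \<Rightarrow> ('w \<Rightarrow> int \<Rightarrow> 'w) \<Rightarrow> bool" where
  "pair p a b \<longleftrightarrow> (\<lambda>w. pmul s p (op_prod a b w)) \<in> Hom_inf2 s"

lemma laurent_inf2_Bd: "A \<in> laurent_inf2 \<longleftrightarrow> Bd {0, 1} (emb2 A)"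
proof -
  have "(\<forall>e. emb2 A e \<noteq> 0 \<longrightarrow> (\<forall>i\<in>{0, 1}. e i \<le> N)) \<longleftrightarrow> (\<forall>m n. A m n \<noteq> 0 \<longrightarrow> m \<le> N \<and> n \<le> N)" for N
  proof (intro iffI allI impI)
    fix m n assume *: "\<forall>e. emb2 A e \<noteq> 0 \<longrightarrow> (\<forall>i\<in>{0, 1}. e i \<le> N)" and nz: "A m n \<noteq> 0"
    show "m \<le> N \<and> n \<le> N" using *[rule_format, of "\<lambda>i. if i = 0 then m else n" 0]
      *[rule_format, of "\<lambda>i. if i = 0 then m else n" 1] nz by (simp add: emb2_def)
  qed (auto simp: emb2_def)
  thus ?thesis unfolding laurent_inf2_def Bd_def by simp
qed

lemma Eo_iff:
  "a \<in> Eo s \<longleftrightarrow> (\<forall>x y n. a (x + y) n = a x n + a y n) \<and>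
     (\<forall>c x n. a (s c x) n = s c (a x n)) \<and> (\<forall>w. a w \<in> laurent_inf)"
proof -
  have "Vector_Spaces.linear s (pscale s) a \<longleftrightarrow> (\<forall>x y. a (x + y) = a x + a y) \<and>
     (\<forall>c x. a (s c x) = pscale s c (a x))"
    unfolding Vector_Spaces.linear_iff using vector_space_axioms vector_space_pscale[OF vector_space_axioms] by blast
  thus ?thesis unfolding Eo_def by (simp add: fun_eq_iff pscale_def)
qed

lemma Eo_zero: "a \<in> Eo s \<Longrightarrow> a 0 n = 0"
  using Eo_iff[of a] by (metis scale_zero_left)

lemma Eo_linear: "a \<in> Eo s \<Longrightarrow> Vector_Spaces.linear s s (\<lambda>w. a w n)"
  unfolding Vector_Spaces.linear_iff using vector_space_axioms by (simp add: Eo_iff)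

lemma op_prod_linear:
  assumes "a \<in> Eo s" "b \<in> Eo s"
  shows "op_prod a b (x + y) = (\<lambda>m n. op_prod a b x m n + op_prod a b y m n)"
    "op_prod a b (s c x) = (\<lambda>m n. s c (op_prod a b x m n))"
  using assms by (simp_all add: op_prod_def Eo_iff)

lemma pmul_add_right:
  "pmul s p (\<lambda>m n. A m n + B m n) = (\<lambda>m n. pmul s p A m n + pmul s p B m n)"
proof (rule emb2_eqD)
  have "emb2 (\<lambda>m n. A m n + B m n) = (\<lambda>e. emb2 A e + emb2 B e)" for A B by (simp add: emb2_def)
  thus "emb2 (pmul s p (\<lambda>m n. A m n + B m n)) = emb2 (\<lambda>m n. pmul s p A m n + pmul s p B m n)"
    by (simp only: emb2_pmul act_add_right)
qed

lemma pmul_scale_right: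
  "pmul s p (\<lambda>m n. s c (A m n)) = (\<lambda>m n. s c (pmul s p A m n))"
proof (rule emb2_eqD)
  have "emb2 (\<lambda>m n. s c (A m n)) = (\<lambda>e. s c (emb2 A e))" for A by (simp add: emb2_def)
  thus "emb2 (pmul s p (\<lambda>m n. s c (A m n))) = emb2 (\<lambda>m n. s c (pmul s p A m n))"
    by (simp only: emb2_pmul act_scale_right)
qed

lemma pmul_linear:
  assumes "Vector_Spaces.linear s s L"
  shows "L (pmul s p A m n) = pmul s p (\<lambda>m n. L (A m n)) m n"
proof -
  interpret L: Vector_Spaces.linear s s L by fact
  show ?thesis by (simp add: pmul_def L.sum L.scale)
qed

lemma pair_iff:
  assumes "a \<in> Eo s" "b \<in> Eo s"
  shows "pair p a b \<longleftrightarrow> (\<forall>w. pmul s p (op_prod a b w) \<in> laurent_inf2)"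
proof -
  have "Vector_Spaces.linear s (pscale (pscale s)) (\<lambda>w. pmul s p (op_prod a b w))"
    unfolding Vector_Spaces.linear_iff op_prod_linear[OF assms] pmul_add_right pmul_scale_right
    using vector_space_axioms vector_space_pscale[OF vector_space_pscale[OF vector_space_axioms]]
    by (auto simp: fun_eq_iff pscale_def)
  thus ?thesis by (simp add: pair_def Hom_inf2_def)
qed

lemma pairD: "pair p a b \<Longrightarrow> pmul s p (op_prod a b w) \<in> laurent_inf2"
  by (simp add: pair_def Hom_inf2_def)

lemma pair_mult:
  assumes "a \<in> Eo s" "b \<in> Eo s" "pair p a b"
  shows "pair (q * p) a b"
  using pairD[OF assms(3)] unfolding pair_iff[OF assms(1,2)] laurent_inf2_Bd pmul_simps
  by (simp add: emb2_pmul Bd_act)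

lemma laurent_inf_add:
  assumes "f \<in> laurent_inf" "g \<in> laurent_inf"
  shows "(\<lambda>n. f n + g n :: 'w) \<in> laurent_inf"
proof -
  obtain N M where "\<forall>n>N. f n = 0" "\<forall>n>M. g n = 0" using assms unfolding laurent_inf_iff by blast
  hence "\<forall>n>max N M. f n + g n = 0" by simp
  thus ?thesis unfolding laurent_inf_iff by blast
qed

lemma laurent_inf_scale: "f \<in> laurent_inf \<Longrightarrow> (\<lambda>n. s c (f n)) \<in> laurent_inf"
  unfolding laurent_inf_def by auto

lemma LL_add:
  assumes "F \<in> LL" "G \<in> LL" shows "(\<lambda>k n. F k n + G k n) \<in> LL"
proof -
  obtain M M' where "\<forall>k<M. F k = 0" "\<forall>k<M'. G k = 0" using assms unfolding LL_def by blast
  hence "\<forall>k<min M M'. (\<lambda>n. F k n + G k n) = 0" by (simp add: fun_eq_iff)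
  thus ?thesis using assms unfolding LL_def by (blast intro: laurent_inf_add)
qed

lemma LL_scale:
  assumes "F \<in> LL" shows "(\<lambda>k n. s c (F k n)) \<in> LL"
proof -
  obtain M where "\<forall>k<M. F k = 0" using assms unfolding LL_def by blast
  hence "\<forall>k<M. (\<lambda>n. s c (F k n)) = 0" by (simp add: fun_eq_iff)
  thus ?thesis using assms unfolding LL_def by (blast intro: laurent_inf_scale)
qed

lemma taylor_neg: "k < 0 \<Longrightarrow> taylor_subst s A k n = 0"
  by (simp add: taylor_subst_def)

lemma taylor_LL:
  assumes "A \<in> laurent_inf2" shows "taylor_subst s A \<in> LL"
proof -
  have "Bd (insert 0 (insert 1 {})) (emb2 A)" using assms by (simp add: laurent_inf2_Bd)
  hence "Bd {1} (emb2 (taylor_subst s A))" unfolding emb2_taylor by (rule Bd_subst_taylor) auto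
  then obtain N where N: "\<And>e. emb2 (taylor_subst s A) e \<noteq> 0 \<Longrightarrow> e 1 \<le> N" unfolding Bd_def by blast
  have "n \<le> N" if "taylor_subst s A k n \<noteq> 0" for k n
    using N[of "\<lambda>i. if i = 0 then k else n"] that by (simp add: emb2_def)
  hence "taylor_subst s A k \<in> laurent_inf" for k unfolding laurent_inf_def by blast
  moreover have "\<forall>k<0. taylor_subst s A k = 0" by (simp add: taylor_neg fun_eq_iff)
  ultimately show ?thesis unfolding LL_def by blast
qed

lemma laurent_inf2_summ: "A \<in> laurent_inf2 \<Longrightarrow> summ c 0 1 (emb2 A)"
  by (simp add: laurent_inf2_Bd Bd_summ)

lemma taylor_add:
  assumes "A \<in> laurent_inf2" "B \<in> laurent_inf2"
  shows "taylor_subst s (\<lambda>m n. A m n + B m n) = (\<lambda>k n. taylor_subst s A k n + taylor_subst s B k n)"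
proof (rule emb2_eqD)
  have *: "emb2 (\<lambda>m n. A m n + B m n) = (\<lambda>e. emb2 A e + emb2 B e)" for A B by (simp add: emb2_def)
  show "emb2 (taylor_subst s (\<lambda>m n. A m n + B m n)) =
      emb2 (\<lambda>k n. taylor_subst s A k n + taylor_subst s B k n)"
    unfolding emb2_taylor * by (rule subst_add) (intro laurent_inf2_summ assms)+
qed

lemma taylor_scale:
  assumes "A \<in> laurent_inf2"
  shows "taylor_subst s (\<lambda>m n. s c (A m n)) = (\<lambda>k n. s c (taylor_subst s A k n))"
proof (rule emb2_eqD)
  have *: "emb2 (\<lambda>m n. s c (A m n)) = (\<lambda>e. s c (emb2 A e))" for A by (simp add: emb2_def)
  show "emb2 (taylor_subst s (\<lambda>m n. s c (A m n))) = emb2 (\<lambda>k n. s c (taylor_subst s A k n))"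
    unfolding emb2_taylor * by (rule subst_scale) (intro laurent_inf2_summ assms)
qed

lemma subst_rel_shift: "i \<noteq> j \<Longrightarrow> pascal c \<Longrightarrow>
    subst_rel c i j (at2 i j p) (at2_shift i j p)"
  by (intro subst_rel_ev2 subst_rel_var subst_rel_base)

lemma taylor_pmul:
  assumes "A \<in> laurent_inf2"
  shows "taylor_subst s (pmul s p A) = pmul s (pcompose p (var1 + var2)) (taylor_subst s A)"
  by (rule emb2_eqD, unfold emb2_taylor emb2_pmul_shift, unfold emb2_pmul)
    (rule subst_relD[OF subst_rel_shift laurent_inf2_summ[OF assms]], simp_all add: pascal_taylor)

lemma pmul_LL: "F \<in> LL \<Longrightarrow> pmul s p F \<in> LL"
proof -
  assume F: "F \<in> LL"
  obtain M where M: "\<And>e. e 0 < M \<Longrightarrow> emb2 F e = 0" using LL_emb2(2)[OF F] by blast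
  have b: "bdd_in 1 (emb2 (pmul s p F))"
    unfolding emb2_pmul by (rule bdd_in_act[OF LL_emb2(1)[OF F]])
  have "pmul s p F k n = 0" if "k < M" for k n
  proof -
    let ?e = "\<lambda>i::nat. if i = 0 then k else n"
    have "act (at2 0 1 p) (emb2 F) ?e = 0"
    proof (rule act_eq_0)
      fix e' assume "\<forall>i. e' i \<le> ?e i"
      from this[rule_format, of 0] show "emb2 F e' = 0" using that by (intro M) simp
    qed
    thus ?thesis unfolding emb2_pmul[symmetric] by (simp add: emb2_def)
  qed
  moreover have "pmul s p F k \<in> laurent_inf" for k
    using b[unfolded bdd_in_def, rule_format, of "\<lambda>i. k"] by (simp add: laurent_inf_iff emb2_def)
  ultimately show ?thesis unfolding LL_def by (auto simp: fun_eq_iff)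
qed

text \<open>Only the polynomial \<open>p0\<close> picked by \<open>SOME\<close> satisfies the
  relation by construction. For any other \<open>q\<close> both sides are multiplied by
  \<open>p0\<close>, compared, and \<open>p0\<close> is cancelled in \<open>LL\<close>.\<close>

lemma Y_Eo_char:
  assumes ab: "a \<in> Eo s" "b \<in> Eo s" and p: "p \<noteq> 0" "pair p a b"
  shows "Y_Eo s a b k \<in> Eo s" "\<exists>M. \<forall>k<M. Y_Eo s a b k = 0"
    "pair q a b \<Longrightarrow> pmul s (pcompose q (var1 + var2)) (\<lambda>k n. Y_Eo s a b k w n) =
       taylor_subst s (pmul s q (op_prod a b w))"
proof -
  define p0 where "p0 = (SOME p. p \<noteq> 0 \<and> pair p a b)"
  have "p0 \<noteq> 0 \<and> pair p0 a b" unfolding p0_def by (rule someI[of _ p]) (use p in simp)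
  hence p0: "p0 \<noteq> 0" "pair p0 a b" by auto
  define P where "P = pcompose p0 (var1 + var2)"
  define z where "z = iota (Fract 1 P)"
  define T where "T = (\<lambda>w. taylor_subst s (pmul s p0 (op_prod a b w)))"
  have P: "P \<noteq> 0" unfolding P_def using p0 by (simp add: pcompose_shift_eq_0)
  hence z: "emb P * z = 1" by (simp add: z_def iota_Fract emb_hom emb_eq_0_iff)
  have Y: "Y_Eo s a b k w = fls_mul s z (T w) k" for k w
    unfolding Y_Eo_def Let_def z_def T_def P_def p0_def pair_def ..
  have TL: "T w \<in> LL" for w unfolding T_def by (rule taylor_LL[OF pairD[OF p0(2)]])
  have T0: "k < 0 \<Longrightarrow> T w k n = 0" for w k n unfolding T_def by (rule taylor_neg)
  have YL: "(\<lambda>k n. Y_Eo s a b k w n) \<in> LL" for w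
    unfolding Y using fls_mul_LL(1)[OF TL T0] by simp
  have eq0: "pmul s P (\<lambda>k n. Y_Eo s a b k w n) = T w" for w
    using fls_mul_emb[OF TL, of P z w] unfolding Y z fls_mul_one by simp
  have Tadd: "T (x + y) = (\<lambda>k n. T x k n + T y k n)" for x y
    unfolding T_def op_prod_linear[OF ab] pmul_add_right by (rule taylor_add) (rule pairD[OF p0(2)])+
  have Tscale: "T (s c x) = (\<lambda>k n. s c (T x k n))" for c x
    unfolding T_def op_prod_linear[OF ab] pmul_scale_right by (rule taylor_scale) (rule pairD[OF p0(2)])
  \<comment> \<open>Linearity in the vector is a case of uniqueness: both sides are truncated and
    have the same multiple.\<close>
  have "(\<lambda>k n. Y_Eo s a b k (x + y) n) = (\<lambda>k n. Y_Eo s a b k x n + Y_Eo s a b k y n)" for x y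
    by (rule LL_cancel[OF p0(1) YL LL_add[OF YL YL]])
      (simp add: P_def[symmetric] eq0 pmul_add_right Tadd)
  moreover have "(\<lambda>k n. Y_Eo s a b k (s c x) n) = (\<lambda>k n. s c (Y_Eo s a b k x n))" for c x
    by (rule LL_cancel[OF p0(1) YL LL_scale[OF YL]])
      (simp add: P_def[symmetric] eq0 pmul_scale_right Tscale)
  moreover have "Y_Eo s a b k w \<in> laurent_inf" for w using YL[of w] by (simp add: LL_def)
  ultimately show "Y_Eo s a b k \<in> Eo s" unfolding Eo_iff by (simp add: fun_eq_iff)
  show "\<exists>M. \<forall>k<M. Y_Eo s a b k = 0"
  proof (intro exI allI impI)
    fix k assume "k < 0 + fls_subdegree z"
    thus "Y_Eo s a b k = 0" using fls_mul_LL(2)[OF TL T0] by (simp add: fun_eq_iff Y)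
  qed
  assume q: "pair q a b"
  let ?Q = "pcompose q (var1 + var2)" and ?Y = "\<lambda>k n. Y_Eo s a b k w n" and ?A = "op_prod a b w"
  show "pmul s ?Q ?Y = taylor_subst s (pmul s q ?A)"
  proof (rule LL_cancel[OF p0(1) pmul_LL[OF YL] taylor_LL[OF pairD[OF q]]])
    have "pmul s P (pmul s ?Q ?Y) = pmul s ?Q (T w)"
      by (simp only: pmul_simps(2)[symmetric] mult.commute[of P]) (simp only: pmul_simps(2) eq0)
    also have "\<dots> = taylor_subst s (pmul s q (pmul s p0 ?A))"
      unfolding T_def by (rule taylor_pmul[OF pairD[OF p0(2)], symmetric])
    also have "pmul s q (pmul s p0 ?A) = pmul s p0 (pmul s q ?A)"
      by (simp only: pmul_simps(2)[symmetric] mult.commute)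
    also have "taylor_subst s \<dots> = pmul s P (taylor_subst s (pmul s q ?A))"
      unfolding P_def by (rule taylor_pmul[OF pairD[OF q]])
    finally show "pmul s (pcompose p0 (var1 + var2)) (pmul s ?Q ?Y) =
        pmul s (pcompose p0 (var1 + var2)) (taylor_subst s (pmul s q ?A))"
      unfolding P_def .
  qed
qed

lemma Y_Eo_LL:
  assumes "a \<in> Eo s" "b \<in> Eo s" "p \<noteq> 0" "pair p a b"
  shows "(\<lambda>k n. Y_Eo s a b k w n) \<in> LL"
proof -
  obtain M where "\<forall>k<M. Y_Eo s a b k = 0" using Y_Eo_char(2)[OF assms] by blast
  hence "\<forall>k<M. (\<lambda>n. Y_Eo s a b k w n) = 0" by (simp add: fun_eq_iff)
  moreover have "(\<lambda>n. Y_Eo s a b k w n) \<in> laurent_inf" for k using Y_Eo_char(1)[OF assms] by (simp add: Eo_iff)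
  ultimately show ?thesis unfolding LL_def by blast
qed

lemma Y_Eo_unique:
  assumes "a \<in> Eo s" "b \<in> Eo s" "p \<noteq> 0" "pair p a b" "F \<in> LL"
    and "pmul s (pcompose p (var1 + var2)) F = taylor_subst s (pmul s p (op_prod a b w))"
  shows "Y_Eo s a b k w = F k"
proof -
  have "(\<lambda>k n. Y_Eo s a b k w n) = F"
    by (rule LL_cancel[OF assms(3) Y_Eo_LL[OF assms(1-4)] assms(5)])
      (simp add: assms(6) Y_Eo_char(3)[OF assms(1-4,4)])
  thus ?thesis by (simp add: fun_eq_iff)
qed

section \<open>The relation for \<open>Y_Eo\<close> inside longer products\<close>

lemma taylor_linear:
  assumes L: "Vector_Spaces.linear s s L" and B: "B \<in> laurent_inf2"
  shows "L (taylor_subst s B k n) = taylor_subst s (\<lambda>m n. L (B m n)) k n"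
proof -
  let ?e = "\<lambda>x::nat. if x = 0 then k else n"
  have "L (taylor 0 1 (emb2 B) ?e) = taylor 0 1 (\<lambda>e. L (emb2 B e)) ?e"
    by (rule subst_linear[OF L]) (use laurent_inf2_summ[OF B] in \<open>simp add: summ_def\<close>)
  moreover have "(\<lambda>e. L (emb2 B e)) = emb2 (\<lambda>m n. L (B m n))" by (simp add: emb2_def)
  ultimately have "L (emb2 (taylor_subst s B) ?e) = emb2 (taylor_subst s (\<lambda>m n. L (B m n))) ?e"
    unfolding emb2_taylor by simp
  thus ?thesis by (simp add: emb2_def)
qed

text \<open>Stated at a single \<open>e\<close>, so that different levels of a third variable may
  satisfy it with different denominators.\<close>

definition subst_to :: "nat \<Rightarrow> nat \<Rightarrow> 'w dist \<Rightarrow> 'w dist \<Rightarrow> (nat \<Rightarrow> int) \<Rightarrow> bool" where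
  "subst_to i j A B e \<longleftrightarrow>
     finite (taylor_supp i j A e) \<and> B e = taylor i j A e"

lemma subst_to_all:
  "(\<forall>e. subst_to i j A B e) \<longleftrightarrow> taylor_summ i j A \<and> B = taylor i j A"
  by (auto simp: subst_to_def summ_def)

lemma subst_to_act:
  assumes "\<forall>e. subst_to i j A B e" "taylor_rel i j G G'"
  shows "\<forall>e. subst_to i j (act G A) (act G' B) e"
  using assms subst_relD[of taylor_coeff i j G G' A] unfolding subst_to_all by simp

text \<open>The operators to the left form a linear map \<open>L\<close>, those to the right have
  produced a vector \<open>z\<close>. Neither depends on the exponents of \<open>x_i\<close> and
  \<open>x_j\<close>, so the relation for \<open>Y_Eo\<close> can be transported through
  \<open>L\<close>.\<close>

lemma Y_Eo_context:
  assumes ij: "i \<noteq> j" and ab: "a \<in> Eo s" "b \<in> Eo s" and p: "p \<noteq> 0" "pair p a b" and q: "pair q a b"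
    and L: "Vector_Spaces.linear s s L"
    and C: "\<And>m n. C (e(i := m, j := n)) = L (Y_Eo s a b m z n)"
    and A: "\<And>m n. A (e(i := m, j := n)) = L (a (b z n) m)"
  shows "subst_to i j (act (at2 i j q) A) (act (at2_shift i j q) C) e"
  unfolding subst_to_def
proof
  define B where "B = pmul s q (op_prod a b z)"
  have B: "B \<in> laurent_inf2" unfolding B_def by (rule pairD[OF q])
  have upd: "e(i := m, j := n, i := m', j := n') = e(i := m', j := n')" for m n m' n'
    using ij by auto
  have act: "act (at2 i j q) A (e(i := m, j := n)) = L (B m n)" for m n
    unfolding act_ev2[OF ij] upd A B_def pmul_linear[OF L] op_prod_def using ij by simp
  show "act (at2_shift i j q) C e =
      taylor i j (act (at2 i j q) A) e"
    unfolding act_ev2_shift[OF ij] C subst_taylor[OF ij] act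
    unfolding taylor_linear[OF L B, symmetric] pmul_linear[OF L, symmetric]
    by (simp only: Y_Eo_char(3)[OF ab p q] B_def)
  let ?e = "\<lambda>x::nat. if x = 0 then e i else e j"
  interpret L: Vector_Spaces.linear s s L by fact
  have "taylor_supp i j (act (at2 i j q) A) e \<subseteq>
      taylor_supp 0 1 (emb2 B) ?e"
    unfolding subst_supp_def act by (auto simp: emb2_def L.zero)
  thus "finite (taylor_supp i j (act (at2 i j q) A) e)"
    using laurent_inf2_summ[OF B, of taylor_coeff] unfolding summ_def by (meson finite_subset)
qed

definition lev :: "nat \<Rightarrow> int set \<Rightarrow> 'w dist \<Rightarrow> 'w dist" where
  "lev l \<Lambda> A = (\<lambda>e. if e l \<in> \<Lambda> then A e else 0)"

lemma act_lev: "loc l q \<Longrightarrow> act q (lev l \<Lambda> A) = lev l \<Lambda> (act q A)"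
  using locD[of l q _ "lev l \<Lambda> A" A] locD[of l q _ "lev l \<Lambda> A" "\<lambda>_. 0"]
  by (auto simp: lev_def act_zero_right fun_eq_iff)

lemma act_lev_atMost: "e l \<le> n \<Longrightarrow> act q (lev l {..n} A) e = act q A e"
  by (rule act_cong) (auto simp: lev_def intro: order.trans)

lemma subst_to_lev:
  assumes "i \<noteq> l" "j \<noteq> l"
  shows "subst_to i j (lev l \<Lambda> A) (lev l \<Lambda> B) e \<longleftrightarrow> (e l \<in> \<Lambda> \<longrightarrow> subst_to i j A B e)"
  using assms by (auto simp: subst_to_def subst_supp_def subst_def lev_def)

lemma loc_var: "i \<noteq> l \<Longrightarrow> j \<noteq> l \<Longrightarrow> loc l (at2 i j q)"
  "i \<noteq> l \<Longrightarrow> j \<noteq> l \<Longrightarrow> loc l (at2_shift i j q)"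
  by (intro loc_ev2 loc_add loc_mvar; assumption)+

text \<open>Each level of \<open>x\<^sub>l\<close> comes with its own denominator \<open>q\<close>, but up to a given level finitely many
  of them suffice, and these are cancelled afterwards.\<close>

lemma subst_levels:
  assumes ij: "i \<noteq> j" and l: "i \<noteq> l" "j \<noteq> l"
    and C0: "\<And>e. e l < M \<Longrightarrow> C e = 0" "\<And>e. e l < M \<Longrightarrow> C' e = 0"
    and q: "\<And>n. \<exists>q. q \<noteq> 0 \<and> (\<forall>e. e l = n \<longrightarrow> subst_to i j (act (at2 i j q) C) (act (at2_shift i j q) C') e)"
    and F: "Bd {i, j} F" "act G C = F" and G: "taylor_rel i j G G'"
    and low: "\<And>n. \<exists>M. \<forall>e. e l = n \<longrightarrow> e i < M \<longrightarrow> C' e = 0"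
    and above: "bdd_in j C'"
  shows "act G' C' = taylor i j F"
proof
  fix e0 :: "nat \<Rightarrow> int"
  define n where "n = e0 l"
  let ?S = "taylor i j"
  obtain q where q: "q n \<noteq> 0"
    "e l = n \<Longrightarrow> subst_to i j (act (at2 i j (q n)) C) (act (at2_shift i j (q n)) C') e" for n e
    using q by metis
  \<comment> \<open>Below \<open>M\<close> everything vanishes, so the levels from \<open>M\<close>
    to \<open>n\<close> are the only ones that need a denominator.\<close>
  define Q where "Q = (\<Prod>m\<in>{M..n}. q m)"
  let ?Q1 = "at2 i j Q" and ?Q2 = "at2_shift i j Q"
  have Q0: "Q \<noteq> 0" unfolding Q_def using q(1) by simp
  have lQ: "loc l (at2 i j p)" "loc l (at2_shift i j p)" for p using l by (simp_all add: loc_var)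
  have step: "subst_to i j (act ?Q1 C) (act ?Q2 C') e" if e: "e l \<le> n" for e
  proof (cases "e l < M")
    case True
    have z: "act p C e' = 0" "act p C' e' = 0" if "e' l = e l" for p e'
      by (rule act_eq_0; rule C0; metis True le_less_trans that)+
    have "act ?Q1 C (e(i := m, j := m')) = 0" for m m' by (rule z) (use l in auto)
    thus ?thesis using z(2)[of e] by (simp add: subst_to_def subst_supp_def subst_def)
  next
    case False
    define m where "m = e l"
    have m: "m \<in> {M..n}" using False e by (simp add: m_def)
    define R where "R = (\<Prod>m\<in>{M..n} - {m}. q m)"
    have QR: "Q = R * q m" unfolding Q_def R_def using m by (subst prod.remove[of _ m]) auto
    have "\<forall>e. subst_to i j (act (at2 i j (q m)) (lev l {m} C)) (act (at2_shift i j (q m)) (lev l {m} C')) e"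
      by (rule allI) (use q(2)[where n = m] in \<open>simp add: act_lev lQ subst_to_lev l\<close>)
    from subst_to_act[OF this subst_rel_shift[OF ij pascal_taylor, of R]]
    have "e l = m \<longrightarrow> ?thesis"
      by (simp add: act_mult[symmetric] ev2_simps(4)[symmetric] QR[symmetric] act_lev lQ subst_to_lev l)
    thus ?thesis by (simp add: m_def)
  qed
  \<comment> \<open>\<open>G\<close> may contain \<open>x_l\<close> and mix levels. Multiplication
    only raises exponents, so cutting above \<open>n\<close> keeps the levels up to \<open>n\<close>
    correct while \<open>Q\<close> serves all levels that are left.\<close>
  define Cn where "Cn = lev l {..n} C"
  define Cn' where "Cn' = lev l {..n} C'"
  have "\<forall>e. subst_to i j (act ?Q1 Cn) (act ?Q2 Cn') e"
    unfolding Cn_def Cn'_def using step by (simp add: act_lev lQ subst_to_lev l)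
  from subst_to_act[OF this G]
  have Cn: "\<forall>e. subst_to i j (act ?Q1 (act G Cn)) (act ?Q2 (act G' Cn')) e"
    by (simp only: act_commute[of G] act_commute[of G'] simp_thms)
  have "\<forall>e. subst_to i j F (?S F) e" unfolding subst_to_all using Bd_summ[OF F(1) ij] by simp
  note QF = subst_to_act[OF this subst_rel_shift[OF ij pascal_taylor, of Q]]
  have main: "act ?Q2 (act G' Cn') e = act ?Q2 (?S F) e" if e: "e l \<le> n" for e
  proof -
    have "?S (act ?Q1 (act G Cn)) e = ?S (act ?Q1 F) e"
    proof (intro subst_cong act_cong)
      fix d e' assume "\<forall>x. e' x \<le> (e(i := e i + d, j := e j - d)) x"
      from this[rule_format, of l] have "e' l \<le> n" using l e by simp
      thus "act G Cn e' = F e'" unfolding Cn_def F(2)[symmetric] by (rule act_lev_atMost)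
    qed
    thus ?thesis using Cn QF by (simp add: subst_to_def)
  qed
  \<comment> \<open>Cancelling \<open>Q\<close> requires one lower bound in \<open>x_i\<close>,
    obtained from those of the finitely many remaining levels.\<close>
  have "\<exists>B. \<forall>k>B. \<forall>m\<in>{M..n}. \<forall>e. e l = m \<longrightarrow> e i < - k \<longrightarrow> C' e = 0"
  proof (rule finite_bound)
    fix m
    obtain N where "\<forall>e. e l = m \<longrightarrow> e i < N \<longrightarrow> C' e = 0" using low by blast
    thus "\<exists>B. \<forall>k>B. \<forall>e. e l = m \<longrightarrow> e i < - k \<longrightarrow> C' e = 0"
      by (intro exI[of _ "- N"]) auto
  qed simp
  then obtain B where B: "\<And>k m e. k > B \<Longrightarrow> m \<in> {M..n} \<Longrightarrow> e l = m \<Longrightarrow> e i < - k \<Longrightarrow> C' e = 0"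
    by blast
  have Bn: "Cn' e = 0" if "e i < - (B + 1)" for e
  proof (cases "e l \<in> {M..n}")
    case True
    thus ?thesis unfolding Cn'_def lev_def using B[of "B + 1" "e l" e] that by simp
  next
    case False
    thus ?thesis unfolding Cn'_def lev_def using C0(2)[of e] by (auto simp: not_le)
  qed
  have "lev l {..n} (act G' Cn') = lev l {..n} (?S F)"
  proof (rule shift_cancel[OF Q0 ij])
    have rb: "bdd_in j (lev l \<Lambda> A)" if "bdd_in j A" for \<Lambda> A
      using that unfolding bdd_in_def lev_def by meson
    show "bdd_in j (lev l {..n} (act G' Cn'))"
      unfolding Cn'_def by (intro rb bdd_in_act above)
    have "Bd {j} (?S F)" by (rule Bd_subst_taylor) (use F(1) ij in simp_all)
    thus "bdd_in j (lev l {..n} (?S F))" by (intro rb Bd_bdd_in[of "{j}"]) simp_all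
    have Bn: "Cn' e = 0" if "e i < - (B + 1)" for e
      using B[of "B + 1" "e l" e] C0(2)[of e] that by (cases "e l < M") (auto simp: Cn'_def lev_def)
    show "lev l {..n} (act G' Cn') e = 0" if "e i < min 0 (- (B + 1))" for e
    proof -
      have "act G' Cn' e = 0"
      proof (rule act_eq_0)
        fix e' assume "\<forall>x. e' x \<le> e x"
        from this[rule_format, of i] show "Cn' e' = 0" using that by (intro Bn) simp
      qed
      thus ?thesis by (simp add: lev_def)
    qed
    show "lev l {..n} (?S F) e = 0" if "e i < min 0 (- (B + 1))" for e
      using that by (simp add: lev_def subst_taylor_neg)
    show "act ?Q2 (lev l {..n} (act G' Cn')) = act ?Q2 (lev l {..n} (?S F))"
      unfolding act_lev[OF lQ(2)] using main by (auto simp: lev_def)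
  qed
  from fun_cong[OF this, of e0] have "act G' Cn' e0 = ?S F e0"
    by (simp add: lev_def n_def[symmetric])
  moreover have "act G' Cn' e0 = act G' C' e0"
    unfolding Cn'_def by (rule act_lev_atMost) (simp add: n_def)
  ultimately show "act G' C' e0 = ?S F e0" by simp
qed

end

section \<open>Compatibility of sequences\<close>

text \<open>Recursion over a list of variables makes it possible to split off the factors at chosen
  positions by \<open>pairs_poly_append\<close>; \<open>prod_pairs_poly\<close> is the link with the
  product over index pairs in \<open>compat_via\<close>.\<close>

fun pairs_poly :: "complex poly poly \<Rightarrow> nat list \<Rightarrow> mpoly" where
  "pairs_poly p [] = 1"
| "pairs_poly p (v # vs) = (\<Prod>u\<leftarrow>vs. at2 v u p) * pairs_poly p vs"

definition cross_poly :: "complex poly poly \<Rightarrow> nat list \<Rightarrow> nat list \<Rightarrow> mpoly" where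
  "cross_poly p us vs = (\<Prod>u\<leftarrow>us. \<Prod>v\<leftarrow>vs. at2 u v p)"

lemma cross_poly_simps:
  "cross_poly p [] vs = 1" "cross_poly p us [] = 1"
  "cross_poly p (u # us) vs = (\<Prod>v\<leftarrow>vs. at2 u v p) * cross_poly p us vs"
  "cross_poly p us (v # vs) = (\<Prod>u\<leftarrow>us. at2 u v p) * cross_poly p us vs"
proof -
  show "cross_poly p us [] = 1" by (induction us) (simp_all add: cross_poly_def)
  show "cross_poly p us (v # vs) = (\<Prod>u\<leftarrow>us. at2 u v p) * cross_poly p us vs"
    by (induction us) (simp_all add: cross_poly_def mult_ac)
qed (simp_all add: cross_poly_def)

lemma pairs_poly_append:
  "pairs_poly p (us @ vs) = pairs_poly p us * pairs_poly p vs * cross_poly p us vs"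
  by (induction us) (simp_all add: cross_poly_simps mult_ac)

lemma prod_list_mult_distrib: "(\<Prod>x\<leftarrow>xs. f x * g x) = (\<Prod>x\<leftarrow>xs. f x) * (\<Prod>x\<leftarrow>xs. g x :: 'a::comm_monoid_mult)"
  by (induction xs) (simp_all add: mult_ac)

lemma pairs_poly_mult: "pairs_poly (p * q) vs = pairs_poly p vs * pairs_poly q vs"
  by (induction vs) (simp_all add: ev2_simps prod_list_mult_distrib mult_ac)

lemma pairs_poly_power: "pairs_poly (p ^ n) vs = pairs_poly p vs ^ n"
proof (induction n)
  case 0
  have "(\<Prod>u\<leftarrow>vs. 1 :: mpoly) = 1" for vs :: "nat list" by (induction vs) simp_all
  hence "pairs_poly 1 vs = 1" by (induction vs) (simp_all add: ev2_simps)
  thus ?case by simp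
qed (simp add: pairs_poly_mult)

lemma prod_list_nth: "(\<Prod>u\<leftarrow>vs. f u) = (\<Prod>j<length vs. f (vs ! j) :: 'a::comm_monoid_mult)"
  by (induction vs) (simp_all add: prod.lessThan_Suc_shift del: prod.lessThan_Suc)

lemma prod_pairs_poly:
  "(\<Prod>(i, j)\<in>{(i, j). i < j \<and> j < length vs}. at2 (vs ! i) (vs ! j) p) = pairs_poly p vs"
proof (induction vs)
  case (Cons v vs)
  let ?f = "\<lambda>(i, j). at2 ((v # vs) ! i) ((v # vs) ! j) p"
  let ?A = "(\<lambda>j. (0, Suc j)) ` {..<length vs}"
  let ?B = "map_prod Suc Suc ` {(i, j). i < j \<and> j < length vs}"
  have "{(i, j). i < j \<and> j < length (v # vs)} = ?A \<union> ?B"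
  proof (intro set_eqI iffI)
    fix x assume x: "x \<in> {(i, j). i < j \<and> j < length (v # vs)}"
    obtain i j where ij: "x = (i, j)" by fastforce
    obtain j' where j': "j = Suc j'" using x ij by (cases j) auto
    show "x \<in> ?A \<union> ?B"
    proof (cases i)
      case 0
      thus ?thesis using x ij j' by auto
    next
      case (Suc i')
      hence "x = map_prod Suc Suc (i', j')" "(i', j') \<in> {(i, j). i < j \<and> j < length vs}"
        using x ij j' by auto
      thus ?thesis by blast
    qed
  qed auto
  moreover have fin: "finite {(i, j). i < j \<and> j < length vs}"
    by (rule finite_subset[of _ "{..<length vs} \<times> {..<length vs}"]) auto
  moreover have "?A \<inter> ?B = {}" by auto
  ultimately have "prod ?f {(i, j). i < j \<and> j < length (v # vs)} = prod ?f ?A * prod ?f ?B"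
    by (simp add: prod.union_disjoint)
  also have "prod ?f ?A = (\<Prod>j<length vs. at2 v (vs ! j) p)"
    by (subst prod.reindex) (auto simp: inj_on_def)
  also have "\<dots> = (\<Prod>u\<leftarrow>vs. at2 v u p)"
    by (simp add: prod_list_nth)
  also have "prod ?f ?B = pairs_poly p vs"
    unfolding Cons[symmetric] by (subst prod.reindex) (auto simp: inj_on_def intro!: prod.cong)
  finally show ?case by simp
qed simp

context complex_space
begin

section \<open>Products of operators as distributions\<close>

lemma op_prod_list_append:
  assumes "length as = length vs" "length bs = length us"
  shows "op_prod_list (as @ bs) z (map e (vs @ us)) =
    op_prod_list as (op_prod_list bs z (map e us)) (map e vs)"
  using assms by (simp add: op_prod_list_def)

lemma op_prod_list_simps:
  "op_prod_list [] z [] = z" "op_prod_list (a # as) z (n # es) = a (op_prod_list as z es) n"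
  if "length as = length es"
  using that by (simp_all add: op_prod_list_def)

lemma op_prod_list_linear:
  assumes "set as \<subseteq> Eo s"
  shows "op_prod_list as (x + y) es = op_prod_list as x es + op_prod_list as y es" (is ?A)
    and "op_prod_list as (s c x) es = s c (op_prod_list as x es)" (is ?B)
proof -
  have "?A \<and> ?B"
  proof (cases "length as = length es")
    case True
    thus ?thesis using assms
    proof (induction as es rule: list_induct2)
      case (Cons a as n es)
      thus ?case by (simp add: op_prod_list_simps Eo_iff)
    qed (simp add: op_prod_list_def)
  qed (simp add: op_prod_list_def)
  thus ?A ?B by auto
qed

lemma op_prod_list_is_linear:
  "set as \<subseteq> Eo s \<Longrightarrow> Vector_Spaces.linear s s (\<lambda>z. op_prod_list as z es)"
  unfolding Vector_Spaces.linear_iff using vector_space_axioms by (simp add: op_prod_list_linear)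

lemma op_prod_list_zero: "set as \<subseteq> Eo s \<Longrightarrow> op_prod_list as 0 es = 0"
  using op_prod_list_linear(2)[of as 0 0 es] by simp

definition op_series :: "('w \<Rightarrow> int \<Rightarrow> 'w) list \<Rightarrow> nat list \<Rightarrow> 'w \<Rightarrow> 'w dist" where
  "op_series as vs z = (\<lambda>e. op_prod_list as z (map e vs))"

definition compat_on :: "complex poly poly \<Rightarrow> ('w \<Rightarrow> int \<Rightarrow> 'w) list \<Rightarrow> nat list \<Rightarrow> bool" where
  "compat_on p as vs \<longleftrightarrow> (\<forall>z. Bd (set vs) (act (pairs_poly p vs) (op_series as vs z)))"

lemma pmul_list_act:
  "length es = n \<Longrightarrow> pmul_list s q A es = act q (\<lambda>e. A (map e [0..<n])) (\<lambda>i. es ! i)"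
  by (simp add: pmul_list_def act_def)

text \<open>\<open>q'\<close> is \<open>q\<close> with each \<open>x\<^sub>i\<close> renamed to the variable \<open>vs ! i\<close>.\<close>

definition rename_rel :: "nat list \<Rightarrow> mpoly \<Rightarrow> mpoly \<Rightarrow> bool" where
  "rename_rel vs q q' \<longleftrightarrow>
     (\<forall>A e. pmul_list s q A (map e vs) = act q' (\<lambda>e. A (map e vs)) e)"

lemma pmul_list_add: "pmul_list s (p + q) A es = pmul_list s p A es + pmul_list s q A es"
  by (simp add: pmul_list_act[OF refl] act_add)

lemma pmul_list_mult: "pmul_list s (p * q) A es = pmul_list s p (pmul_list s q A) es"
proof -
  have "act q (\<lambda>e. A (map e [0..<length es])) = (\<lambda>e. pmul_list s q A (map e [0..<length es]))"
    unfolding act_def pmul_list_def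
    by (intro ext sum.cong arg_cong2[of _ _ _ _ s] arg_cong[of _ _ A]) auto
  thus ?thesis by (simp add: pmul_list_act[OF refl] act_mult)
qed

lemma rename_rel_add: "rename_rel vs p p' \<Longrightarrow> rename_rel vs q q' \<Longrightarrow> rename_rel vs (p + q) (p' + q')"
  by (simp add: rename_rel_def pmul_list_add act_add)

lemma rename_rel_mult: "rename_rel vs p p' \<Longrightarrow> rename_rel vs q q' \<Longrightarrow> rename_rel vs (p * q) (p' * q')"
  unfolding rename_rel_def pmul_list_mult act_mult by simp

lemma rename_rel_mconst: "rename_rel vs (mconst c) (mconst c)"
proof -
  have "map (\<lambda>i. map e vs ! i) [0..<length vs] = map e vs" for e :: "nat \<Rightarrow> int"
    by (rule nth_equalityI) simp_all
  thus ?thesis by (simp add: rename_rel_def pmul_list_act[OF refl] act_mconst)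
qed

lemma rename_rel_mvar:
  assumes "distinct vs" "i < length vs"
  shows "rename_rel vs (mvar i) (mvar (vs ! i))"
proof -
  have "map ((\<lambda>i. map e vs ! i)(i := map e vs ! i - 1)) [0..<length vs] =
      map (e(vs ! i := e (vs ! i) - 1)) vs" for e :: "nat \<Rightarrow> int"
    by (rule nth_equalityI) (use assms in \<open>auto simp: nth_eq_iff_index_eq\<close>)
  thus ?thesis by (simp add: rename_rel_def pmul_list_act[OF refl] act_mvar)
qed

lemma rename_rel_ev2: "rename_rel vs P P' \<Longrightarrow> rename_rel vs Q Q' \<Longrightarrow> rename_rel vs (ev2 f P Q) (ev2 f P' Q')"
  by (rule ev2_rel[of "rename_rel vs"])
    (auto intro: rename_rel_mconst rename_rel_add rename_rel_mult)

lemma rename_rel_prod: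
  assumes "\<And>x. x \<in> I \<Longrightarrow> rename_rel vs (f x) (g x)"
  shows "rename_rel vs (prod f I) (prod g I)"
  using assms
proof (induction I rule: infinite_finite_induct)
  case (insert x I)
  thus ?case by (auto intro: rename_rel_mult)
qed (use rename_rel_mconst[of vs 1] in \<open>simp_all add: mconst_hom\<close>)

lemma rename_rel_pairs:
  assumes "distinct vs"
  shows "rename_rel vs (\<Prod>(i, j)\<in>{(i, j). i < j \<and> j < length vs}. at_vars p i j) (pairs_poly p vs)"
  unfolding prod_pairs_poly[symmetric]
  by (rule rename_rel_prod) (auto simp: at_vars_eq intro!: rename_rel_ev2 rename_rel_mvar assms)

text \<open>The names of the variables do not matter as long as they are distinct. This allows
  reserving particular variables for the operators that are to be merged or inserted. The linearity
  demanded by \<open>Hom_inf_list\<close> is automatic for operators in \<open>Eo s\<close>.\<close>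

lemma compat_via_iff:
  assumes vs: "distinct vs" "length vs = length as" and as: "set as \<subseteq> Eo s"
  shows "compat_via s p as \<longleftrightarrow> compat_on p as vs"
proof -
  let ?q = "\<Prod>(i, j)\<in>{(i, j). i < j \<and> j < length as}. at_vars p i j"
  let ?A = "\<lambda>z. pmul_list s ?q (op_prod_list as z)"
  have lin: "Vector_Spaces.linear s (pscale s) ?A"
    unfolding Vector_Spaces.linear_iff
    using vector_space_axioms vector_space_pscale[OF vector_space_axioms]
    by (auto simp: fun_eq_iff pscale_def pmul_list_act[OF refl] op_prod_list_linear[OF as] act_add_right act_scale_right)
  have len: "?A z es = 0" if "length es \<noteq> length as" for z es
    using that by (simp add: pmul_list_def op_prod_list_def)
  have eq: "?A z (map e vs) = act (pairs_poly p vs) (op_series as vs z) e" for z e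
    using rename_rel_pairs[OF vs(1), of p] unfolding rename_rel_def op_series_def vs(2) by blast
  have "?A z \<in> laurent_inf_list (length as) \<longleftrightarrow> Bd (set vs) (act (pairs_poly p vs) (op_series as vs z))" for z
  proof
    assume "?A z \<in> laurent_inf_list (length as)"
    then obtain N where N: "\<And>es. ?A z es \<noteq> 0 \<Longrightarrow> \<forall>e\<in>set es. e \<le> N" unfolding laurent_inf_list_def by blast
    have "\<forall>i\<in>set vs. e i \<le> N" if "act (pairs_poly p vs) (op_series as vs z) e \<noteq> 0" for e
      using N[of "map e vs"] that unfolding eq by auto
    thus "Bd (set vs) (act (pairs_poly p vs) (op_series as vs z))" unfolding Bd_def by blast
  next
    assume "Bd (set vs) (act (pairs_poly p vs) (op_series as vs z))"
    then obtain N where N: "\<And>e. act (pairs_poly p vs) (op_series as vs z) e \<noteq> 0 \<Longrightarrow> \<forall>i\<in>set vs. e i \<le> N"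
      unfolding Bd_def by blast
    have "length es = length as \<and> (\<forall>e\<in>set es. e \<le> N)" if nz: "?A z es \<noteq> 0" for es
    proof -
      have l: "length es = length as" using len nz by blast
      \<comment> \<open>As \<open>vs\<close> is distinct, every list of exponents arises from an
        exponent function.\<close>
      define e where "e = (\<lambda>v. the (map_of (zip vs es) v))"
      have es: "es = map e vs"
        by (rule nth_equalityI) (use l vs in \<open>simp_all add: e_def map_of_zip_nth\<close>)
      have "\<forall>i\<in>set vs. e i \<le> N" using N[of e] nz unfolding es eq by blast
      thus ?thesis using l unfolding es by auto
    qed
    thus "?A z \<in> laurent_inf_list (length as)" unfolding laurent_inf_list_def by blast
  qed
  thus ?thesis unfolding compat_via_def Hom_inf_list_def compat_on_def using lin by simp
qed

lemma compat_on_mult: "compat_on p as vs \<Longrightarrow> compat_on (q * p) as vs"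
  unfolding compat_on_def pairs_poly_mult act_mult by (simp add: Bd_act)

lemma compat_via_mult:
  assumes "set as \<subseteq> Eo s" "compat_via s p as"
  shows "compat_via s (q * p) as"
  using assms compat_on_mult by (simp add: compat_via_iff[of "[0..<length as]"])

lemma compat_via_pair:
  assumes "a \<in> Eo s" "b \<in> Eo s"
  shows "compat_via s p [a, b] \<longleftrightarrow> pair p a b"
proof -
  have "emb2 (op_prod a b z) = op_series [a, b] [0, 1] z" for z
    by (simp add: fun_eq_iff emb2_def op_prod_def op_series_def op_prod_list_def)
  thus ?thesis
    using assms by (simp add: compat_via_iff[of "[0, 1]"] pair_iff compat_on_def laurent_inf2_Bd emb2_pmul)
qed

text \<open>Quasi-compatibility and compatibility are the instances \<open>\<Phi> = {p. p \<noteq> 0}\<close> and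
  \<open>\<Phi> = {(x\<^sub>1 - x\<^sub>2)\<^sup>k}\<close> of what follows.\<close>

definition admissible :: "complex poly poly set \<Rightarrow> bool" where
  "admissible \<Phi> \<longleftrightarrow> 1 \<in> \<Phi> \<and> 0 \<notin> \<Phi> \<and> (\<forall>p\<in>\<Phi>. \<forall>q\<in>\<Phi>. p * q \<in> \<Phi>)"

lemma admissible_power: "admissible \<Phi> \<Longrightarrow> p \<in> \<Phi> \<Longrightarrow> p ^ n \<in> \<Phi>"
  by (induction n) (auto simp: admissible_def)

definition Pcompat :: "complex poly poly set \<Rightarrow> ('w \<Rightarrow> int \<Rightarrow> 'w) list \<Rightarrow> bool" where
  "Pcompat \<Phi> as \<longleftrightarrow> set as \<subseteq> Eo s \<and> (\<exists>p\<in>\<Phi>. compat_via s p as)"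

lemma Pcompat_common:
  assumes "admissible \<Phi>" "Pcompat \<Phi> as" "Pcompat \<Phi> bs"
  obtains p where "p \<in> \<Phi>" "compat_via s p as" "compat_via s p bs"
proof -
  obtain p q where "p \<in> \<Phi>" "compat_via s p as" "q \<in> \<Phi>" "compat_via s q bs"
    using assms(2,3) unfolding Pcompat_def by blast
  moreover from this have "compat_via s (q * p) as" "compat_via s (p * q) bs"
    using assms(2,3) unfolding Pcompat_def by (blast intro: compat_via_mult)+
  ultimately show thesis using assms(1) that[of "q * p"] unfolding admissible_def
    by (metis mult.commute)
qed

lemma op_series_lincomb_at:
  assumes "set xs \<subseteq> Eo s"
  shows "op_series (xs @ (\<lambda>w n. s x (a w n) + s y (b w n)) # ys) vs z e =
    s x (op_series (xs @ a # ys) vs z e) + s y (op_series (xs @ b # ys) vs z e)"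
proof (cases "length vs = length (xs @ a # ys)")
  case True
  define us where "us = take (length xs) vs"
  define v where "v = vs ! length xs"
  define ws where "ws = drop (Suc (length xs)) vs"
  have vs: "vs = us @ v # ws" using True by (simp add: us_def v_def ws_def id_take_nth_drop)
  have len: "length us = length xs" "length ws = length ys" using True by (simp_all add: us_def ws_def)
  show ?thesis unfolding vs op_series_def using len
    by (simp add: op_prod_list_append[where us = "v # ws", simplified] op_prod_list_simps op_prod_list_linear[OF assms])
qed (simp add: op_series_def op_prod_list_def)

lemma Eo_lincomb: "a \<in> Eo s \<Longrightarrow> b \<in> Eo s \<Longrightarrow> (\<lambda>w n. s x (a w n) + s y (b w n)) \<in> Eo s"
  by (simp add: Eo_iff laurent_inf_add laurent_inf_scale scale_right_distrib mult.commute add_ac)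

lemma Eo_id: "id_op \<in> Eo s"
  by (auto simp: Eo_iff id_op_def laurent_inf_def)

lemma Pcompat_lincomb:
  assumes \<Phi>: "admissible \<Phi>" and "Pcompat \<Phi> (xs @ a # ys)" "Pcompat \<Phi> (xs @ b # ys)"
  shows "Pcompat \<Phi> (xs @ (\<lambda>w n. s x (a w n) + s y (b w n)) # ys)"
proof -
  let ?c = "\<lambda>w n. s x (a w n) + s y (b w n)"
  obtain p where p: "p \<in> \<Phi>" "compat_via s p (xs @ a # ys)" "compat_via s p (xs @ b # ys)"
    using Pcompat_common[OF assms] .
  have E: "set (xs @ a # ys) \<subseteq> Eo s" "set (xs @ b # ys) \<subseteq> Eo s"
    using assms by (auto simp: Pcompat_def)
  have E': "set (xs @ ?c # ys) \<subseteq> Eo s" using E by (simp add: Eo_lincomb)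
  let ?vs = "[0..<length (xs @ a # ys)]"
  have "compat_on p (xs @ a # ys) ?vs" "compat_on p (xs @ b # ys) ?vs"
    using p E by (simp_all add: compat_via_iff[of ?vs])
  moreover have "op_series (xs @ ?c # ys) ?vs z = (\<lambda>e. act (mconst x) (op_series (xs @ a # ys) ?vs z) e +
      act (mconst y) (op_series (xs @ b # ys) ?vs z) e)" for z
    unfolding act_mconst using E(1) by (intro ext op_series_lincomb_at) simp
  ultimately have "compat_on p (xs @ ?c # ys) ?vs"
    unfolding compat_on_def by (simp add: act_add_right act_commute[of _ "mconst _"] Bd_add Bd_act)
  hence "compat_via s p (xs @ ?c # ys)"
    by (subst compat_via_iff[of ?vs]) (use E' in simp_all)
  thus ?thesis unfolding Pcompat_def using E' p(1) by blast
qed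

text \<open>The identity gets the variable 0 and contributes only exponent 0 of it. The polynomial
  of the old sequence does not contain that variable and acts on this slice as before; the new
  factors, collected in \<open>q\<close>, preserve boundedness.\<close>

lemma Pcompat_id:
  assumes "Pcompat \<Phi> (xs @ ys)"
  shows "Pcompat \<Phi> (xs @ id_op # ys)"
proof -
  obtain p where p: "p \<in> \<Phi>" "compat_via s p (xs @ ys)"
    using assms unfolding Pcompat_def by blast
  have E: "set (xs @ ys) \<subseteq> Eo s" using assms by (auto simp: Pcompat_def)
  have E': "set (xs @ id_op # ys) \<subseteq> Eo s" using E by (simp add: Eo_id)
  define us where "us = [1..<Suc (length xs)]"
  define ws where "ws = [Suc (length xs)..<Suc (length xs + length ys)]"
  have len: "length us = length xs" "length ws = length ys" by (simp_all add: us_def ws_def del: upt_Suc)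
  have d: "distinct (us @ 0 # ws)" "distinct (us @ ws)" by (auto simp: us_def ws_def)
  have c: "compat_on p (xs @ ys) (us @ ws)"
    using p(2) compat_via_iff[OF d(2) _ E] len by simp
  have ser: "op_series (xs @ id_op # ys) (us @ 0 # ws) z = (\<lambda>e. if e 0 = 0 then op_series (xs @ ys) (us @ ws) z e else 0)" for z
  proof
    fix e
    show "op_series (xs @ id_op # ys) (us @ 0 # ws) z e = (if e 0 = 0 then op_series (xs @ ys) (us @ ws) z e else 0)"
      using len E op_prod_list_append[of "xs" us "id_op # ys" "0 # ws" z e] op_prod_list_append[of "xs" us "ys" "ws" z e]
      by (simp add: op_series_def op_prod_list_simps id_op_def op_prod_list_zero)
  qed
  define q where "q = (\<Prod>u\<leftarrow>us. at2 u 0 p) * (\<Prod>v\<leftarrow>ws. at2 0 v p)"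
  have pq: "pairs_poly p (us @ 0 # ws) = q * pairs_poly p (us @ ws)"
    by (simp add: pairs_poly_append cross_poly_simps q_def mult_ac)
  have loc: "loc 0 (pairs_poly p (us @ ws))"
  proof -
    have l1: "loc 0 1" using loc_mconst[of 0 1] by (simp add: mconst_hom)
    have "loc 0 (\<Prod>v\<leftarrow>vs. at2 u v p)" if "u \<noteq> 0" "0 \<notin> set vs" for u and vs :: "nat list"
      using that(2) by (induction vs) (auto intro!: l1 loc_mult loc_var that(1))
    hence "loc 0 (pairs_poly p vs)" if "0 \<notin> set vs" for vs
      using that by (induction vs) (auto intro!: l1 loc_mult)
    thus ?thesis using d by simp
  qed
  have "Bd (set (us @ 0 # ws)) (act (pairs_poly p (us @ ws)) (op_series (xs @ id_op # ys) (us @ 0 # ws) z))" for z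
  proof -
    let ?A = "op_series (xs @ ys) (us @ ws) z" and ?B = "op_series (xs @ id_op # ys) (us @ 0 # ws) z"
    obtain N where N: "\<And>e i. act (pairs_poly p (us @ ws)) ?A e \<noteq> 0 \<Longrightarrow> i \<in> set (us @ ws) \<Longrightarrow> e i \<le> N"
      using c unfolding compat_on_def Bd_def by blast
    have "e i \<le> max N 0" if nz: "act (pairs_poly p (us @ ws)) ?B e \<noteq> 0" and i: "i \<in> set (us @ 0 # ws)" for e i
    proof (cases "e 0 = 0")
      case True
      have "act (pairs_poly p (us @ ws)) ?B e = act (pairs_poly p (us @ ws)) ?A e"
        by (rule locD[OF loc]) (simp add: ser True)
      thus ?thesis using N[of e i] nz i True by (cases "i = 0") auto
    next
      case False
      have "act (pairs_poly p (us @ ws)) ?B e = act (pairs_poly p (us @ ws)) (\<lambda>_. 0) e"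
        by (rule locD[OF loc]) (simp add: ser False)
      thus ?thesis using nz by (simp add: act_zero_right)
    qed
    thus ?thesis unfolding Bd_def by blast
  qed
  hence "compat_on p (xs @ id_op # ys) (us @ 0 # ws)"
    unfolding compat_on_def pq act_mult by (simp add: Bd_act)
  hence "compat_via s p (xs @ id_op # ys)" using compat_via_iff[OF d(1) _ E'] len by simp
  thus ?thesis unfolding Pcompat_def using E' p(1) by blast
qed

end

lemma prod_list_rel:
  assumes "R 1 1" "\<And>p q p' q'. R p p' \<Longrightarrow> R q q' \<Longrightarrow> R (p * q) (p' * q')"
    and "\<And>x. x \<in> set xs \<Longrightarrow> R (f x) (g x)"
  shows "R (\<Prod>x\<leftarrow>xs. f x) (\<Prod>x\<leftarrow>xs. g x :: mpoly)"
  using assms(3)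
proof (induction xs)
  case (Cons x xs)
  show ?case unfolding list.map prod_list.Cons by (intro assms(2) Cons) simp_all
qed (simp add: assms(1))

context complex_space
begin

section \<open>Replacing two neighbours by a mode\<close>

lemma subst_rel_prod_list:
  "(\<And>x. x \<in> set xs \<Longrightarrow> subst_rel c i j (f x) (g x)) \<Longrightarrow>
    subst_rel c i j (\<Prod>x\<leftarrow>xs. f x) (\<Prod>x\<leftarrow>xs. g x)"
  by (rule prod_list_rel[of "subst_rel c i j"]) (auto intro: subst_rel_one subst_rel_mult)

lemma loc_one: "loc l 1"
  using loc_mconst[of l 1] by (simp add: mconst_hom)

lemma loc_prod_list: "(\<And>x. x \<in> set xs \<Longrightarrow> loc l (f x)) \<Longrightarrow> loc l (\<Prod>x\<leftarrow>xs. f x)"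
  by (rule prod_list_rel[of "\<lambda>p _. loc l p" xs f f]) (auto intro: loc_one loc_mult)

lemma subst_rel_pairs:
  assumes "i \<notin> set vs" "j \<notin> set vs"
  shows "subst_rel c i j (pairs_poly p vs) (pairs_poly p vs)"
  using assms
  by (induction vs)
    (auto intro!: subst_rel_one subst_rel_mult subst_rel_prod_list subst_rel_ev2 subst_rel_other)

lemma subst_rel_cross:
  assumes "i \<notin> set us" "j \<notin> set us" "i \<notin> set vs" "j \<notin> set vs"
  shows "subst_rel c i j (cross_poly p us vs) (cross_poly p us vs)"
  unfolding cross_poly_def using assms
  by (intro subst_rel_prod_list subst_rel_ev2 subst_rel_other) auto

lemma loc_pairs: "l \<notin> set vs \<Longrightarrow> loc l (pairs_poly p vs)"
  by (induction vs) (auto intro!: loc_one loc_mult loc_prod_list loc_var)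

lemma loc_cross: "l \<notin> set us \<Longrightarrow> l \<notin> set vs \<Longrightarrow> loc l (cross_poly p us vs)"
  unfolding cross_poly_def by (intro loc_prod_list loc_var) auto

text \<open>Evaluation is a ring homomorphism, so it may be computed modulo \<open>x\<close>. With
  \<open>x = mvar 0\<close> this compares factors at \<open>x_0+x_1\<close> with those at
  \<open>x_1\<close>.\<close>

lemma cong_ev2:
  fixes x :: mpoly
  assumes "x dvd P - P'" "x dvd Q - Q'"
  shows "x dvd ev2 f P Q - ev2 f P' Q'"
proof (rule ev2_rel[of "\<lambda>p p'. x dvd p - p'"])
  fix p q p' q' :: mpoly assume *: "x dvd p - p'" "x dvd q - q'"
  have "p + q - (p' + q') = (p - p') + (q - q')" "p * q - p' * q' = (p - p') * q + p' * (q - q')"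
    by (simp_all add: algebra_simps)
  thus "x dvd p + q - (p' + q')" "x dvd p * q - p' * q'" using * by (metis dvd_add dvd_mult dvd_mult2)+
qed (use assms in simp_all)

lemma cong_mult:
  fixes x :: mpoly
  assumes "x dvd p - p'" "x dvd q - q'"
  shows "x dvd p * q - p' * q'"
proof -
  have "p * q - p' * q' = (p - p') * q + p' * (q - q')" by (simp add: algebra_simps)
  thus ?thesis using assms by simp
qed

lemma cong_prod_list:
  fixes x :: mpoly
  shows "(\<And>y. y \<in> set xs \<Longrightarrow> x dvd f y - g y) \<Longrightarrow> x dvd (\<Prod>y\<leftarrow>xs. f y) - (\<Prod>y\<leftarrow>xs. g y)"
  by (rule prod_list_rel[of "\<lambda>p p'. x dvd p - p'"]) (auto intro: cong_mult)

lemma Bd_lev: "Bd I A \<Longrightarrow> Bd I (lev l \<Lambda> A)"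
  unfolding Bd_def lev_def by meson

lemma Bd_diff: "Bd I A \<Longrightarrow> Bd I B \<Longrightarrow> Bd I (\<lambda>e. A e - B e)"
  using Bd_add[of I A "act (mconst (- 1)) B"] Bd_act[of I B "mconst (- 1)"] by (simp add: act_mconst)

text \<open>The coefficients of \<open>Z = (H + x\<^sub>l J) C\<close> determine \<open>H\<^sup>q C\<close> recursively on the levels
  of \<open>x\<^sub>l\<close>, with one more power of \<open>H\<close> on each level.\<close>

lemma Bd_levels:
  assumes C0: "\<And>e. e l < M \<Longrightarrow> C e = 0" and Z: "Bd I (act (H + mvar l * J) C)"
  shows "Bd I (lev l {..M - 1 + int q} (act (H ^ q) C))"
proof (induction q)
  case 0
  have "lev l {..M - 1 + int 0} (act (H ^ 0) C) = (\<lambda>_. 0)"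
    using C0 by (auto simp: lev_def act_one)
  thus ?case by (simp only: Bd_zero)
next
  case (Suc q)
  define m where "m = M - 1 + int q"
  define B where "B = act (H ^ q) C"
  let ?Z = "act (H + mvar l * J) C"
  have "lev l {..m + 1} (act (H ^ Suc q) C) =
      lev l {..m + 1} (\<lambda>e. act (H ^ q) ?Z e - act (mvar l * J) (lev l {..m} B) e)"
  proof
    fix e
    show "lev l {..m + 1} (act (H ^ Suc q) C) e =
      lev l {..m + 1} (\<lambda>e. act (H ^ q) ?Z e - act (mvar l * J) (lev l {..m} B) e) e"
    proof (cases "e l \<le> m + 1")
      case True
      \<comment> \<open>The factor \<open>x_l\<close> lowers the level read in \<open>B\<close> to
        at most \<open>m\<close>, where the induction hypothesis gives the bound.\<close>
      have "act (mvar l * J) (lev l {..m} B) e = act (mvar l * J) B e"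
        unfolding act_mult act_mvar by (rule act_lev_atMost) (use True in simp)
      moreover have "act (H ^ q) ?Z = (\<lambda>e. act (H ^ Suc q) C e + act (mvar l * J) B e)"
      proof -
        have "H ^ q * (H + mvar l * J) = H ^ Suc q + mvar l * J * H ^ q" by (simp add: algebra_simps)
        thus ?thesis unfolding B_def act_mult[symmetric] act_add[symmetric] by simp
      qed
      ultimately show ?thesis by (simp add: lev_def)
    qed (simp add: lev_def)
  qed
  moreover have "Bd I (lev l {..m + 1} (\<lambda>e. act (H ^ q) ?Z e - act (mvar l * J) (lev l {..m} B) e))"
    by (rule Bd_lev, rule Bd_diff, rule Bd_act, rule Z, rule Bd_act)
      (use Suc.IH in \<open>simp add: m_def B_def\<close>)
  ultimately show ?case by (simp add: m_def algebra_simps)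
qed

lemma act_indep:
  assumes "\<And>e x. A (e(l := x)) = A e"
  shows "act q A (e(l := x)) = act q A e"
proof -
  have "A (lower (e(l := x)) \<mu>) = A (lower e \<mu>)" for \<mu>
  proof -
    have "(lower (e(l := x)) \<mu>) =
        (lower e \<mu>)(l := x - int (Poly_Mapping.lookup \<mu> l))"
      by auto
    thus ?thesis by (simp only: assms)
  qed
  thus ?thesis unfolding act_def by simp
qed

lemma op_series_split:
  assumes "length us = length xs" "length ws = length ys"
  shows "op_series (xs @ a # ys) (us @ v # ws) z e =
    op_prod_list xs (a (op_prod_list ys z (map e ws)) (e v)) (map e us)"
    "op_series (xs @ a # b # ys) (us @ v # u # ws) z e =
    op_prod_list xs (a (b (op_prod_list ys z (map e ws)) (e u)) (e v)) (map e us)"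
  using assms op_prod_list_append[of xs us "a # ys" "v # ws" z e]
    op_prod_list_append[of xs us "a # b # ys" "v # u # ws" z e]
  by (simp_all add: op_series_def op_prod_list_simps)

lemma map_upd_notin: "v \<notin> set vs \<Longrightarrow> map (e(v := x)) vs = map e vs"
  by (rule map_cong) auto

text \<open>\<open>a\<close> and \<open>b\<close> get the variables 0 and 1. When
  \<open>x_0+x_1\<close> replaces \<open>x_0\<close>, the factors joining \<open>a\<close> to the
  other operators become, modulo \<open>x_0\<close>, those joining \<open>b\<close> to them, and the
  factor joining \<open>a\<close> to \<open>b\<close> becomes a power of \<open>x_0\<close> times
  \<open>h(x_1)\<close>. Hence the regular multiple has the form required by
  \<open>Bd_levels\<close>, with \<open>H\<close> free of \<open>x_0\<close>, so that powers of
  \<open>H\<close> act on each mode separately.\<close>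

lemma compat_mode:
  assumes E: "set (xs @ a # b # ys) \<subseteq> Eo s" and f: "f \<noteq> 0"
    and ab: "compat_via s f [a, b]" and all: "compat_via s f (xs @ a # b # ys)"
  shows "\<exists>N. compat_via s (f ^ N) (xs @ Y_Eo s a b k # ys)"
proof -
  have Eab: "a \<in> Eo s" "b \<in> Eo s" and Exy: "set xs \<subseteq> Eo s" "set ys \<subseteq> Eo s" using E by auto
  have pair: "pair f a b" using ab compat_via_pair[OF Eab] by simp
  let ?Y = "Y_Eo s a b"
  have YE: "?Y k \<in> Eo s" for k by (rule Y_Eo_char(1)[OF Eab f pair])
  obtain M where M: "\<forall>k<M. ?Y k = 0" using Y_Eo_char(2)[OF Eab f pair] by blast
  define ups where "ups = [2..<2 + length xs]"
  define downs where "downs = [2 + length xs..<2 + length xs + length ys]"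
  have len: "length ups = length xs" "length downs = length ys" by (simp_all only: ups_def downs_def length_upt add_diff_cancel_left')
  have nin: "0 \<notin> set ups" "0 \<notin> set downs" "1 \<notin> set ups" "1 \<notin> set downs"
    by (auto simp: ups_def downs_def)
  note upd = nin[THEN map_upd_notin]
  have dist: "distinct (ups @ 0 # 1 # downs)" "distinct (ups @ 1 # downs)"
    using nin by (auto simp: ups_def downs_def)
  let ?I = "set (ups @ 1 # downs)"
  define A where "A = op_series (xs @ a # b # ys) (ups @ 0 # 1 # downs)"
  \<comment> \<open>All modes at once: the exponent of \<open>x_0\<close> selects the coefficient of
    \<open>Y(a,x_0)b\<close>.\<close>
  define C where "C = (\<lambda>z e. op_series (xs @ ?Y (e 0) # ys) (ups @ 1 # downs) z e)"
  define K0 where "K0 = pairs_poly f ups * pairs_poly f downs * cross_poly f ups downs"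
  define H1 where "H1 = (\<Prod>d\<leftarrow>downs. at2 1 d f) * (\<Prod>u\<leftarrow>ups. at2 u 1 f)"
  define H0 where "H0 = (\<Prod>d\<leftarrow>downs. at2 0 d f) * (\<Prod>u\<leftarrow>ups. at2 u 0 f)"
  define H0' where "H0' = (\<Prod>d\<leftarrow>downs. ev2 f (mvar 0 + mvar 1) (mvar d)) *
    (\<Prod>u\<leftarrow>ups. ev2 f (mvar u) (mvar 0 + mvar 1))"
  define G0 where "G0 = K0 * H1 * H1"
  have pp: "pairs_poly f (ups @ 0 # 1 # downs) = (K0 * H1 * H0) * at2 0 1 f"
    by (simp add: pairs_poly_append cross_poly_simps K0_def H1_def H0_def mult_ac)
  have pp1: "pairs_poly f (ups @ 1 # downs) = K0 * H1"
    by (simp add: pairs_poly_append cross_poly_simps K0_def H1_def mult_ac)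
  have K0: "taylor_rel 0 1 K0 K0" "loc 0 K0"
    unfolding K0_def using nin
    by (intro subst_rel_mult subst_rel_pairs subst_rel_cross loc_mult loc_pairs loc_cross; simp)+
  have ne: "d \<noteq> 0 \<and> d \<noteq> 1" if "d \<in> set ups \<or> d \<in> set downs" for d
    using that nin by metis
  have sr: "taylor_rel 0 1 (mvar d) (mvar d)" "loc 0 (mvar d)"
    if "d \<in> set ups \<or> d \<in> set downs" for d
    using ne[OF that] by (simp_all add: subst_rel_other loc_mvar)
  have s01: "taylor_rel 0 1 (mvar 1) (mvar 1)" "loc 0 (mvar 1)"
    "taylor_rel 0 1 (mvar 0) (mvar 0 + mvar 1)"
    by (simp_all add: subst_rel_base subst_rel_var loc_mvar pascal_taylor)
  have H1: "taylor_rel 0 1 H1 H1"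
    unfolding H1_def by (intro subst_rel_mult subst_rel_prod_list subst_rel_ev2 s01(1) sr(1)) simp_all
  have H1l: "loc 0 H1"
    unfolding H1_def by (intro loc_mult loc_prod_list loc_ev2 s01(2) sr(2)) simp_all
  have H0: "taylor_rel 0 1 H0 H0'"
    unfolding H0_def H0'_def by (intro subst_rel_mult subst_rel_prod_list subst_rel_ev2 s01(3) sr(1)) simp_all
  have G: "taylor_rel 0 1 (K0 * H1 * H0) (K0 * H1 * H0')"
    by (intro subst_rel_mult K0 H1 H0)
  have "mvar 0 dvd H0' - H1"
    unfolding H0'_def H1_def by (intro cong_mult cong_prod_list cong_ev2) simp_all
  hence "mvar 0 dvd K0 * H1 * H0' - G0"
    unfolding G0_def by (intro cong_mult) simp_all
  then obtain K where K: "K0 * H1 * H0' = G0 + mvar 0 * K"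
    unfolding dvd_def by (metis add.commute diff_add_cancel)
  obtain k0 h g where h: "h \<noteq> 0"
    and split: "\<forall>S Q. ev2 f (S + Q) Q = S ^ k0 * (ev1 h Q + S * ev2 g S Q)"
    using ev2_shift_split[OF f] by (elim exE conjE)
  define H where "H = G0 * ev1 h (mvar 1)"
  define J where "J = K * ev1 h (mvar 1) + G0 * at2 0 1 g + mvar 0 * K * at2 0 1 g"
  have HJ: "(K0 * H1 * H0') * at2_shift 0 1 f = mvar 0 ^ k0 * (H + mvar 0 * J)"
    unfolding K split[rule_format] H_def J_def by (simp add: algebra_simps)
  have Z: "Bd ?I (act (H + mvar 0 * J) (C z))" for z
  proof -
    let ?f = "at2 0 1 f"
    have ctx: "subst_to 0 1 (act ?f (A z)) (act (at2_shift 0 1 f) (C z)) e" for e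
    proof -
      have L: "Vector_Spaces.linear s s (\<lambda>v. op_prod_list xs v (map e ups))"
        by (rule op_prod_list_is_linear[OF Exy(1)])
      have c: "C z (e(0 := m, 1 := n)) =
          op_prod_list xs (?Y m (op_prod_list ys z (map e downs)) n) (map e ups)" for m n
        unfolding C_def op_series_split(1)[OF len] upd by simp
      have d: "A z (e(0 := m, 1 := n)) =
          op_prod_list xs (a (b (op_prod_list ys z (map e downs)) n) m) (map e ups)" for m n
        unfolding A_def op_series_split(2)[OF len] upd by simp
      show ?thesis using Y_Eo_context[OF zero_neq_one Eab f pair pair L c d] by blast
    qed
    hence "\<forall>e. subst_to 0 1 (act (K0 * H1 * H0) (act ?f (A z)))
        (act (K0 * H1 * H0') (act (at2_shift 0 1 f) (C z))) e"
      by (intro subst_to_act[OF _ G]) simp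
    hence "act (mvar 0 ^ k0) (act (H + mvar 0 * J) (C z)) =
        taylor 0 1 (act (K0 * H1 * H0) (act ?f (A z)))"
      unfolding subst_to_all act_mult[symmetric] HJ by simp
    also have "act (K0 * H1 * H0) (act ?f (A z)) = act (pairs_poly f (ups @ 0 # 1 # downs)) (A z)"
      unfolding pp act_mult ..
    finally have eq: "act (mvar 0 ^ k0) (act (H + mvar 0 * J) (C z)) =
      taylor 0 1 (act (pairs_poly f (ups @ 0 # 1 # downs)) (A z))" .
    have "compat_on f (xs @ a # b # ys) (ups @ 0 # 1 # downs)"
      using all compat_via_iff[OF dist(1) _ E] len by simp
    hence "Bd (insert 0 (insert 1 (set ups \<union> set downs))) (act (pairs_poly f (ups @ 0 # 1 # downs)) (A z))"
      unfolding compat_on_def A_def by (auto elim: Bd_mono)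
    hence "Bd (insert 1 (set ups \<union> set downs)) (act (mvar 0 ^ k0) (act (H + mvar 0 * J) (C z)))"
      unfolding eq by (rule Bd_subst_taylor) (use nin in simp_all)
    then obtain N where N: "\<And>e i. act (mvar 0 ^ k0) (act (H + mvar 0 * J) (C z)) e \<noteq> 0 \<Longrightarrow> i \<in> ?I \<Longrightarrow> e i \<le> N"
      unfolding Bd_def by auto
    have "e i \<le> N" if nz: "act (H + mvar 0 * J) (C z) e \<noteq> 0" and i: "i \<in> ?I" for e i
    proof -
      have "i \<noteq> 0" using i ne[of i] by auto
      thus ?thesis using N[of "e(0 := e 0 + int k0)" i] nz i by (simp add: act_mvar_power)
    qed
    thus ?thesis unfolding Bd_def by blast
  qed
  \<comment> \<open>The coefficients start at \<open>M\<close>, so \<open>q\<close> counts the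
    levels from \<open>M\<close> to \<open>k\<close>, each of which costs one power of
    \<open>H\<close>.\<close>
  define q where "q = nat (k - M + 1)"
  have kq: "k \<le> M - 1 + int q" by (simp add: q_def)
  have "compat_on (f ^ (2 * q)) (xs @ ?Y k # ys) (ups @ 1 # downs)"
    unfolding compat_on_def
  proof
    fix z
    let ?C = "op_series (xs @ ?Y k # ys) (ups @ 1 # downs) z"
    have C0: "C z e = 0" if "e 0 < M" for e
      using that M op_prod_list_zero[OF Exy(1)] by (simp add: C_def op_series_split(1)[OF len])
    have "Bd ?I (lev 0 {..M - 1 + int q} (act (H ^ q) (C z)))"
      by (rule Bd_levels[where J = J]) (rule C0, assumption, rule Z)
    then obtain N where N: "\<And>e i. lev 0 {..M - 1 + int q} (act (H ^ q) (C z)) e \<noteq> 0 \<Longrightarrow> i \<in> ?I \<Longrightarrow> e i \<le> N"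
      unfolding Bd_def by blast
    have lH: "loc 0 (H ^ q)"
      unfolding H_def G0_def by (intro loc_power loc_mult K0 H1l loc_ev1 s01(2))
    have indep: "?C (e(0 := x)) = ?C e" for e x
      by (simp add: op_series_split(1)[OF len] upd)
    have "e i \<le> N" if nz: "act (H ^ q) ?C e \<noteq> 0" and i: "i \<in> ?I" for e i
    proof -
      have "i \<noteq> 0" using i ne[of i] by auto
      have "act (H ^ q) ?C e = act (H ^ q) ?C (e(0 := k))" by (rule act_indep[OF indep, symmetric])
      also have "\<dots> = act (H ^ q) (C z) (e(0 := k))" by (rule locD[OF lH]) (simp add: C_def)
      also have "\<dots> = lev 0 {..M - 1 + int q} (act (H ^ q) (C z)) (e(0 := k))"
        using kq by (simp add: lev_def)
      finally show ?thesis using N[of "e(0 := k)" i] nz i \<open>i \<noteq> 0\<close> by simp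
    qed
    hence "Bd ?I (act (H ^ q) ?C)" unfolding Bd_def by blast
    moreover have "H ^ q = ev1 (h ^ q) (mvar 1) * G0 ^ q"
      by (simp add: H_def ev1_power power_mult_distrib mult.commute)
    ultimately have B: "Bd ?I (act (ev1 (h ^ q) (mvar 1)) (act (G0 ^ q) ?C))" by (simp add: act_mult)
    \<comment> \<open>With the other exponents fixed, the mode acts on one fixed vector. This gives
      the upper bound in \<open>x_1\<close> that permits dividing by
      \<open>h(x_1)^q\<close>.\<close>
    have above: "bdd_in 1 ?C"
      unfolding bdd_in_def
    proof
      fix e
      have "?Y k (op_prod_list ys z (map e downs)) \<in> laurent_inf" using YE by (simp add: Eo_iff)
      then obtain N where "\<forall>n>N. ?Y k (op_prod_list ys z (map e downs)) n = 0"
        unfolding laurent_inf_iff by blast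
      hence "\<forall>n>N. ?C (e(1 := n)) = 0"
        unfolding op_series_split(1)[OF len] upd
        by (simp add: op_prod_list_zero[OF Exy(1)])
      thus "\<exists>N. \<forall>n>N. ?C (e(1 := n)) = 0" by blast
    qed
    have "Bd ?I (act (G0 ^ q) ?C)"
      by (rule Bd_cancel[OF _ bdd_in_act[OF above] _ B]) (use h in simp_all)
    \<comment> \<open>The shortened sequence has pair polynomial \<open>K0 * H1\<close>, whereas
      \<open>G0\<close> contains \<open>H1\<close> twice: once from the factors of \<open>a\<close>
      and once from those of \<open>b\<close>. Hence the exponent \<open>2 * q\<close>, with
      \<open>K0 ^ q\<close> left over.\<close>
    moreover have "pairs_poly (f ^ (2 * q)) (ups @ 1 # downs) = K0 ^ q * G0 ^ q"
      unfolding pairs_poly_power pp1 G0_def mult_2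
      by (simp only: pairs_poly_mult pairs_poly_power pp1 power_add power_mult_distrib mult_ac)
    ultimately show "Bd ?I (act (pairs_poly (f ^ (2 * q)) (ups @ 1 # downs)) ?C)"
      by (simp add: act_mult Bd_act)
  qed
  moreover have "set (xs @ ?Y k # ys) \<subseteq> Eo s" using YE Exy by simp
  ultimately have "compat_via s (f ^ (2 * q)) (xs @ ?Y k # ys)"
    using compat_via_iff[OF dist(2)] len by simp
  thus ?thesis by blast
qed

lemma Pcompat_mode:
  assumes \<Phi>: "admissible \<Phi>" and "Pcompat \<Phi> [a, b]" "Pcompat \<Phi> (xs @ a # b # ys)"
  shows "Pcompat \<Phi> (xs @ Y_Eo s a b k # ys)"
proof -
  obtain f where f: "f \<in> \<Phi>" "compat_via s f [a, b]" "compat_via s f (xs @ a # b # ys)"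
    using Pcompat_common[OF assms] .
  have E: "set (xs @ a # b # ys) \<subseteq> Eo s" using assms(3) by (simp add: Pcompat_def)
  have f0: "f \<noteq> 0" using \<Phi> f(1) by (auto simp: admissible_def)
  have "pair f a b" using f(2) compat_via_pair[of a b f] E by simp
  hence "Y_Eo s a b k \<in> Eo s" using Y_Eo_char(1)[of a b f] E f0 by simp
  moreover obtain N where "compat_via s (f ^ N) (xs @ Y_Eo s a b k # ys)"
    using compat_mode[OF E f0 f(2,3)] by blast
  ultimately show ?thesis using E admissible_power[OF \<Phi> f(1)] unfolding Pcompat_def by auto
qed

section \<open>The set generated from below\<close>

inductive_set generated :: "('w \<Rightarrow> int \<Rightarrow> 'w) set \<Rightarrow> ('w \<Rightarrow> int \<Rightarrow> 'w) set"
  for S :: "('w \<Rightarrow> int \<Rightarrow> 'w) set" where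
  base: "a \<in> S \<Longrightarrow> a \<in> generated S"
| id_op: "id_op \<in> generated S"
| lincomb: "a \<in> generated S \<Longrightarrow> b \<in> generated S \<Longrightarrow> (\<lambda>w n. s x (a w n) + s y (b w n)) \<in> generated S"
| Y: "a \<in> generated S \<Longrightarrow> b \<in> generated S \<Longrightarrow> Y_Eo s a b k \<in> generated S"

text \<open>A mode unfolds into two neighbours, each of which may unfold further. The induction
  therefore runs for all contexts at once and assumes compatibility with whole words over
  \<open>S\<close> in the gap; the empty word serves the identity.\<close>

lemma generated_in_context:
  assumes \<Phi>: "admissible \<Phi>" and S: "\<And>ss. set ss \<subseteq> S \<Longrightarrow> Pcompat \<Phi> ss"
    and a: "a \<in> generated S" and ctx: "\<And>ss. set ss \<subseteq> S \<Longrightarrow> Pcompat \<Phi> (xs @ ss @ ys)"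
  shows "Pcompat \<Phi> (xs @ a # ys)"
  using a ctx
proof (induction a arbitrary: xs ys rule: generated.induct)
  case (base a)
  show ?case using base.prems[of "[a]"] base.hyps by simp
next
  case id_op
  show ?case by (rule Pcompat_id) (use id_op.prems[of "[]"] in simp)
next
  case (lincomb a b x y)
  show ?case by (rule Pcompat_lincomb[OF \<Phi>]) (intro lincomb.IH lincomb.prems; assumption)+
next
  case (Y a b k)
  \<comment> \<open>\<open>b\<close> is inserted to the right of an arbitrary word over
    \<open>S\<close>, and that word is then replaced by \<open>a\<close>.\<close>
  have two: "Pcompat \<Phi> (xs @ a # b # ys)" if "\<And>ss. set ss \<subseteq> S \<Longrightarrow> Pcompat \<Phi> (xs @ ss @ ys)" for xs ys
  proof (rule Y.IH(1))
    fix ss assume ss: "set ss \<subseteq> S"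
    have "Pcompat \<Phi> ((xs @ ss) @ b # ys)"
    proof (rule Y.IH(2))
      fix ss' assume "set ss' \<subseteq> S"
      thus "Pcompat \<Phi> ((xs @ ss) @ ss' @ ys)" using that[of "ss @ ss'"] ss by simp
    qed
    thus "Pcompat \<Phi> (xs @ ss @ b # ys)" by simp
  qed
  show ?case
    by (rule Pcompat_mode[OF \<Phi> _ two[OF Y.prems]]) (use two[of "[]" "[]"] S in simp_all)
qed

text \<open>Replacement proceeds from left to right: \<open>xs\<close> is the part already
  consisting of generated elements, and any word over \<open>S\<close> may still follow it.\<close>

lemma generated_Pcompat:
  assumes \<Phi>: "admissible \<Phi>" and S: "\<And>ss. set ss \<subseteq> S \<Longrightarrow> Pcompat \<Phi> ss"
    and as: "set as \<subseteq> generated S"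
  shows "Pcompat \<Phi> as"
proof -
  have "(\<And>ss. set ss \<subseteq> S \<Longrightarrow> Pcompat \<Phi> (xs @ ss)) \<Longrightarrow> Pcompat \<Phi> (xs @ as)" for xs
    using as
  proof (induction as arbitrary: xs)
    case Nil
    show ?case using Nil.prems(1)[of "[]"] by simp
  next
    case (Cons a as)
    have "Pcompat \<Phi> ((xs @ [a]) @ as)"
    proof (rule Cons.IH)
      fix ss assume ss: "set ss \<subseteq> S"
      have "Pcompat \<Phi> (xs @ a # ss)"
      proof (rule generated_in_context[OF \<Phi> S])
        fix ss' assume "set ss' \<subseteq> S"
        thus "Pcompat \<Phi> (xs @ ss' @ ss)" using Cons.prems(1)[of "ss' @ ss"] ss by simp
      qed (use Cons.prems in simp_all)
      thus "Pcompat \<Phi> ((xs @ [a]) @ ss)" by simp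
    qed (use Cons.prems in simp)
    thus ?case by simp
  qed
  from this[of "[]"] show ?thesis using S by simp
qed

lemma admissible_nonzero: "admissible {p. p \<noteq> 0}"
  by (simp add: admissible_def)

lemma admissible_diff: "admissible (range (\<lambda>k. (var1 - var2) ^ k))"
proof -
  have "var1 - var2 \<noteq> 0" by (simp add: var1_def var2_def)
  moreover have "(1 :: complex poly poly) = (var1 - var2) ^ 0" by simp
  ultimately show ?thesis unfolding admissible_def
    by (auto simp flip: power_add intro: image_eqI[of _ _ 0])
qed

lemma quasi_compatible_iff:
  "quasi_compatible s S \<longleftrightarrow> (\<forall>ss. set ss \<subseteq> S \<longrightarrow> Pcompat {p. p \<noteq> 0} ss)"
proof
  assume *: "\<forall>ss. set ss \<subseteq> S \<longrightarrow> Pcompat {p. p \<noteq> 0} ss"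
  have "S \<subseteq> Eo s"
  proof
    fix a assume "a \<in> S"
    thus "a \<in> Eo s" using *[rule_format, of "[a]"] by (simp add: Pcompat_def)
  qed
  thus "quasi_compatible s S"
    using * unfolding quasi_compatible_def quasi_compatible_seq_def Pcompat_def by auto
qed (auto simp: quasi_compatible_def quasi_compatible_seq_def Pcompat_def)

lemma compatible_Pcompat:
  "compatible s S \<Longrightarrow> set ss \<subseteq> S \<Longrightarrow> Pcompat (range (\<lambda>k. (var1 - var2) ^ k)) ss"
  by (auto simp: compatible_def compatible_seq_def Pcompat_def)

lemma module_pscale2: "module (pscale (pscale s))"
  using vector_space_pscale[OF vector_space_pscale[OF vector_space_axioms]]
  by (simp add: module_iff_vector_space)

lemma generated_subspace: "module.subspace (pscale (pscale s)) (generated S)"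
  unfolding module.subspace_def[OF module_pscale2]
proof (intro conjI ballI allI)
  have "(\<lambda>w n. s 0 (id_op w n) + s 0 (id_op w n)) \<in> generated S" by (intro generated.intros)
  thus "0 \<in> generated S" by (simp add: zero_fun_def)
next
  fix a b assume "a \<in> generated S" "b \<in> generated S"
  thus "a + b \<in> generated S" using generated.lincomb[of a S b 1 1] by (simp add: plus_fun_def)
next
  fix c a assume "a \<in> generated S"
  thus "pscale (pscale s) c a \<in> generated S" using generated.lincomb[of a S a c 0] by (simp add: pscale_def)
qed

lemma generated_quasi_compatible:
  assumes "quasi_compatible s S"
  shows "quasi_compatible_subspace s (generated S)"
  using generated_Pcompat[OF admissible_nonzero, of S] assms
  unfolding quasi_compatible_subspace_def quasi_compatible_iff
  by (simp add: generated_subspace)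

lemma generated_closed: "Y_closed s (generated S)"
  by (simp add: Y_closed_def mode_def generated.Y)

lemma Y_closedD:
  assumes "Y_closed s V" "a \<in> V" "b \<in> V"
  shows "Y_Eo s a b k \<in> V"
proof -
  have "mode s a (- k - 1) b \<in> V" using assms unfolding Y_closed_def by blast
  thus ?thesis by (simp add: mode_def)
qed

lemma generated_smallest:
  assumes "quasi_compatible s S"
  shows "is_smallest_closed s S (generated S)"
  unfolding is_smallest_closed_def
proof (intro conjI allI impI)
  show "quasi_compatible_subspace s (generated S)" by (rule generated_quasi_compatible[OF assms])
  show "Y_closed s (generated S)" by (rule generated_closed)
  show "S \<subseteq> generated S" by (auto intro: generated.base)
  show "id_op \<in> generated S" by (rule generated.id_op)
  fix K assume K: "quasi_compatible_subspace s K \<and> Y_closed s K \<and> S \<subseteq> K \<and> id_op \<in> K"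
  have sub: "module.subspace (pscale (pscale s)) K" using K by (simp add: quasi_compatible_subspace_def)
  have closed: "a + b \<in> K" "pscale (pscale s) c a \<in> K" if "a \<in> K" "b \<in> K" for a b c
    using sub that unfolding module.subspace_def[OF module_pscale2] by blast+
  show "generated S \<subseteq> K"
  proof
    fix a assume "a \<in> generated S"
    thus "a \<in> K"
    proof induction
      case (lincomb a b x y)
      thus ?case using closed(1)[OF closed(2)[of a a x] closed(2)[of b b y]] by (simp add: plus_fun_def pscale_def)
    next
      case (Y a b k)
      thus ?case using K by (blast intro: Y_closedD)
    qed (use K in auto)
  qed
qed

lemma is_smallest_unique: "is_smallest_closed s S K \<Longrightarrow> is_smallest_closed s S K' \<Longrightarrow> K = K'"
  unfolding is_smallest_closed_def by blast

lemma gen_closed_eq: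
  assumes "quasi_compatible s S" shows "gen_closed s S = generated S"
  unfolding gen_closed_def
proof (rule the_equality)
  show "is_smallest_closed s S (generated S)" by (rule generated_smallest[OF assms])
  thus "K = generated S" if "is_smallest_closed s S K" for K using that by (rule is_smallest_unique[rotated])
qed

lemma maximal_closed:
  assumes "maximal_quasi_compatible_subspace s K"
  shows "Y_closed s K" "id_op \<in> K"
proof -
  have "quasi_compatible s K"
    using assms by (simp add: maximal_quasi_compatible_subspace_def quasi_compatible_subspace_def)
  hence "quasi_compatible_subspace s (generated K)" by (rule generated_quasi_compatible)
  moreover have "K \<subseteq> generated K" by (auto intro: generated.base)
  ultimately have "generated K = K" using assms unfolding maximal_quasi_compatible_subspace_def by blast
  thus "Y_closed s K" "id_op \<in> K" using generated_closed[of K] generated.id_op[of K] by simp_all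
qed

end

section \<open>Weak associativity\<close>

text \<open>For \<open>0 \<le> k + d\<close> the power is an ordinary polynomial and has no negative
  power of its first variable.\<close>

lemma binom_coeff_eq_0: "d < 0 \<Longrightarrow> binom_coeff k d = 0" "k < 0 \<Longrightarrow> 0 \<le> k + d \<Longrightarrow> binom_coeff k d = 0"
proof -
  show "d < 0 \<Longrightarrow> binom_coeff k d = 0" by (simp add: binom_coeff_def taylor_coeff_def)
  assume k: "k < 0" "0 \<le> k + d"
  have "of_int (d + k) = (of_nat (nat (d + k)) :: complex)" using k by simp
  moreover have "(of_nat (nat (d + k)) :: complex) gchoose nat d = 0"
    unfolding binomial_gbinomial[symmetric] using k by (simp add: binomial_eq_0)
  ultimately show "binom_coeff k d = 0" unfolding binom_coeff_def taylor_coeff_def by simp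
qed

text \<open>Multiplicativity of congruence modulo the ideal generated by \<open>x\<close> and
  \<open>y\<close>, in the explicit form that \<open>lex_cancel\<close> consumes.\<close>

lemma ideal2_mult:
  fixes x y :: mpoly
  assumes "\<exists>K K'. p = a + x * K + y * K'" "\<exists>K K'. q = b + x * K + y * K'"
  shows "\<exists>K K'. p * q = a * b + x * K + y * K'"
proof -
  obtain K K' L L' where pq: "p = a + x * K + y * K'" "q = b + x * L + y * L'" using assms by blast
  have "p * q = a * b + x * (K * q + a * L) + y * (K' * q + a * L')"
    unfolding pq by (simp add: algebra_simps)
  thus ?thesis by blast
qed

context complex_space
begin

section \<open>Two orders of iterated substitution\<close>

lemma Bd_dv: "Bd I A \<Longrightarrow> Bd I (dv i A)"
proof -
  assume "Bd I A"
  then obtain N where N: "\<And>e l. A e \<noteq> 0 \<Longrightarrow> l \<in> I \<Longrightarrow> e l \<le> N" unfolding Bd_def by blast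
  have "e l \<le> N" if "dv i A e \<noteq> 0" "l \<in> I" for e l
    using N[of "e(i := e i + 1)" l] that by (cases "l = i") (auto simp: dv_def)
  thus ?thesis unfolding Bd_def by blast
qed

lemma summ_binom:
  assumes ij: "i \<noteq> j" and A: "\<And>e. e j < M \<Longrightarrow> A e = 0"
  shows "summ binom_coeff i j A"
proof -
  have "subst_supp binom_coeff i j A e \<subseteq> {0..e j - M}" for e
  proof
    fix d assume "d \<in> subst_supp binom_coeff i j A e"
    hence d: "binom_coeff (e i) d \<noteq> 0" "A (e(i := e i + d, j := e j - d)) \<noteq> 0"
      by (simp_all add: subst_supp_def)
    have "\<not> d < 0" using d(1) binom_coeff_eq_0(1) by blast
    moreover have "\<not> e j - d < M" using d(2) A[of "e(i := e i + d, j := e j - d)"] by auto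
    ultimately show "d \<in> {0..e j - M}" by simp
  qed
  thus ?thesis unfolding summ_def by (meson finite_atLeastAtMost_int finite_subset)
qed

text \<open>Both sides vanish for negative exponents of \<open>x\<^sub>0\<close> or \<open>x\<^sub>1\<close>, agree at \<open>x\<^sub>0 = x\<^sub>1 = 0\<close> and
  satisfy the same differential equations in \<open>x\<^sub>0\<close> and \<open>x\<^sub>1\<close>.\<close>

lemma subst_assoc:
  assumes "Bd {0, 1, 2} F"
  shows "taylor 1 2 (taylor 0 1 F) =
    subst binom_coeff 0 1 (taylor 0 2 (taylor 1 2 F))"
proof -
  let ?T = taylor and ?B = "subst binom_coeff"
  let ?Z1 = "\<lambda>F. ?T 1 2 (?T 0 1 F)" and ?Z2 = "\<lambda>F. ?B 0 1 (?T 0 2 (?T 1 2 F))"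
  have su: "taylor_summ 0 1 F" "taylor_summ 1 2 F" "taylor_summ 1 2 (?T 0 1 F)"
    "taylor_summ 0 2 (?T 1 2 F)" "summ binom_coeff 0 1 (?T 0 2 (?T 1 2 F))" if F: "Bd {0, 1, 2} F" for F
  proof -
    show "taylor_summ 0 1 F" "taylor_summ 1 2 F"
      by (rule Bd_summ; use Bd_mono[OF F] in simp)+
    have "Bd (insert 1 {2}) (?T 0 1 F)" by (rule Bd_subst_taylor) (use F in simp_all)
    thus "taylor_summ 1 2 (?T 0 1 F)" by (intro Bd_summ) simp_all
    have "Bd (insert 2 {0}) (?T 1 2 F)"
      by (rule Bd_subst_taylor) (use F in \<open>simp_all add: insert_commute\<close>)
    thus "taylor_summ 0 2 (?T 1 2 F)" by (intro Bd_summ) (simp_all add: insert_commute)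
    show "summ binom_coeff 0 1 (?T 0 2 (?T 1 2 F))"
    proof (rule summ_binom[of _ _ 0])
      fix e :: "nat \<Rightarrow> int" assume "e 1 < 0"
      thus "?T 0 2 (?T 1 2 F) e = 0" by - (rule subst_eq_0, rule subst_taylor_neg, simp)
    qed simp
  qed
  note dvT = dv_subst_var(2)[OF _ pascal_taylor] and dvB = dv_subst_var(2)[OF _ pascal_binom]
  have Z10: "dv 0 (?Z1 F) = ?Z1 (dv 0 F)" if F: "Bd {0, 1, 2} F" for F
    using dv_subst_other[of 0 1 2 taylor_coeff "?T 0 1 F"] dv_subst_var(2)[of 0 1 taylor_coeff F] su[OF F]
    by (simp add: pascal_taylor)
  have Z11: "dv 1 (?Z1 F) = (\<lambda>e. ?Z1 (dv 0 F) e + ?Z1 (dv 1 F) e)" if F: "Bd {0, 1, 2} F" for F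
  proof -
    have "dv 1 (?Z1 F) = ?T 1 2 (dv 1 (?T 0 1 F))"
      by (rule dvT) (use su[OF F] in simp_all)
    also have "dv 1 (?T 0 1 F) = (\<lambda>e. ?T 0 1 (dv 0 F) e + ?T 0 1 (dv 1 F) e)"
      by (rule dv_subst_base(2)) (use su[OF F] in \<open>simp_all add: pascal_taylor\<close>)
    also have "?T 1 2 \<dots> = (\<lambda>e. ?Z1 (dv 0 F) e + ?Z1 (dv 1 F) e)"
      by (rule subst_add) (intro su Bd_dv F)+
    finally show ?thesis .
  qed
  have Z20: "dv 0 (?Z2 F) = ?Z2 (dv 0 F)" if F: "Bd {0, 1, 2} F" for F
  proof -
    have "dv 0 (?Z2 F) = ?B 0 1 (dv 0 (?T 0 2 (?T 1 2 F)))"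
      by (rule dvB) (use su[OF F] in simp_all)
    also have "dv 0 (?T 0 2 (?T 1 2 F)) = ?T 0 2 (dv 0 (?T 1 2 F))"
      by (rule dvT) (use su[OF F] in simp_all)
    also have "dv 0 (?T 1 2 F) = ?T 1 2 (dv 0 F)"
      by (rule dv_subst_other) (use su[OF F] in simp_all)
    finally show ?thesis .
  qed
  have Z21: "dv 1 (?Z2 F) = (\<lambda>e. ?Z2 (dv 0 F) e + ?Z2 (dv 1 F) e)" if F: "Bd {0, 1, 2} F" for F
  proof -
    have "dv 1 (?Z2 F) = (\<lambda>e. ?B 0 1 (dv 0 (?T 0 2 (?T 1 2 F))) e + ?B 0 1 (dv 1 (?T 0 2 (?T 1 2 F))) e)"
      by (rule dv_subst_base(2)) (use su[OF F] in \<open>simp_all add: pascal_binom\<close>)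
    also have "dv 0 (?T 0 2 (?T 1 2 F)) = ?T 0 2 (dv 0 (?T 1 2 F))"
      by (rule dvT) (use su[OF F] in simp_all)
    also have "dv 0 (?T 1 2 F) = ?T 1 2 (dv 0 F)"
      by (rule dv_subst_other) (use su[OF F] in simp_all)
    also have "dv 1 (?T 0 2 (?T 1 2 F)) = ?T 0 2 (dv 1 (?T 1 2 F))"
      by (rule dv_subst_other) (use su[OF F] in simp_all)
    also have "dv 1 (?T 1 2 F) = ?T 1 2 (dv 1 F)"
      by (rule dvT) (use su[OF F] in simp_all)
    finally show ?thesis .
  qed
  have neg1: "?Z1 F e = 0" if "e 0 < 0 \<or> e 1 < 0" for F e
  proof (cases "e 1 < 0")
    case False
    thus ?thesis using that by - (rule subst_eq_0, rule subst_taylor_neg, simp)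
  qed (rule subst_taylor_neg)
  \<comment> \<open>If \<open>e 0 < 0\<close>, either \<open>e 0 + d\<close> is still negative and
    the inner Taylor substitution vanishes, or the binomial coefficient does.\<close>
  have neg2: "?Z2 F e = 0" if neg: "e 0 < 0 \<or> e 1 < 0" for F e
  proof (rule subst_eq_0)
    fix d assume c: "binom_coeff (e 0) d \<noteq> 0"
    hence d: "d \<ge> 0" using binom_coeff_eq_0(1)[of d "e 0"] by (cases "d < 0") auto
    show "?T 0 2 (?T 1 2 F) (e(0 := e 0 + d, 1 := e 1 - d)) = 0"
    proof (cases "e 0 + d < 0")
      case True
      thus ?thesis by (intro subst_taylor_neg) simp
    next
      case False
      have "\<not> e 0 < 0" using c False binom_coeff_eq_0(2)[of "e 0" d] by auto
      hence "e 1 - d < 0" using neg d by simp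
      thus ?thesis by - (rule subst_eq_0, rule subst_taylor_neg, simp)
    qed
  qed
  \<comment> \<open>At \<open>x_0 = x_1 = 0\<close> both sides are \<open>F(x_2,x_2,x_2)\<close>,
    one finite double sum taken in two orders.\<close>
  have base: "?Z1 F e = ?Z2 F e" if F: "Bd {0, 1, 2} F" and e: "e 0 = 0" "e 1 = 0" for F e
  proof -
    obtain N where N: "\<And>e i. F e \<noteq> 0 \<Longrightarrow> i \<in> {0, 1, 2} \<Longrightarrow> e i \<le> N" using F unfolding Bd_def by blast
    have c0: "taylor_coeff 0 d = 1" for d by (simp add: taylor_coeff_def)
    define n where "n = e 2"
    define E where "E = (\<lambda>a b c. e(0 := a, 1 := b, 2 := c))"
    have E: "(E a b c)(0 := a') = E a' b c" "(E a b c)(1 := b') = E a b' c" "(E a b c)(2 := c') = E a b c'"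
      "E a b c 0 = a" "E a b c 1 = b" "E a b c 2 = c" for a b c a' b' c'
      by (auto simp: E_def fun_eq_iff)
    have F0: "F (E a b c) = 0" if big: "a > N \<or> b > N \<or> c > N" for a b c
    proof (rule ccontr)
      assume "F (E a b c) \<noteq> 0"
      from N[OF this, of 0] N[OF this, of 1] N[OF this, of 2] show False using big unfolding E by auto
    qed
    \<comment> \<open>The exponents of \<open>F\<close> in the double sum are \<open>y\<close>,
      \<open>x - y\<close> and \<open>n - x\<close>. All three are at most \<open>N\<close> on the
      support, which confines \<open>x\<close> to \<open>?J\<close> and \<open>y\<close> to
      \<open>?I\<close>.\<close>
    let ?J = "{n - N..N + N}" and ?I = "{n - N - N..N}"
    have eE: "e = E 0 0 n" using e by (auto simp: n_def E_def)
    have T1: "?T 0 1 F (E 0 x (n - x)) = (\<Sum>y\<in>?I. F (E y (x - y) (n - x)))" for x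
    proof -
      have "?T 0 1 F (E 0 x (n - x)) = (\<Sum>y\<in>?I. s (taylor_coeff 0 y) (F (E y (x - y) (n - x))))"
      proof (subst subst_eq_sum[of ?I])
        show "taylor_supp 0 1 F (E 0 x (n - x)) \<subseteq> ?I"
        proof
          fix y assume "y \<in> taylor_supp 0 1 F (E 0 x (n - x))"
          hence "F (E y (x - y) (n - x)) \<noteq> 0" by (simp add: subst_supp_def E del: One_nat_def)
          hence "y \<le> N" "x - y \<le> N" "n - x \<le> N" using F0[of y "x - y" "n - x"] by (meson not_le)+
          thus "y \<in> ?I" by simp
        qed
      qed (simp_all add: E del: One_nat_def)
      thus ?thesis by (simp add: c0)
    qed
    have "?Z1 F (E 0 0 n) = (\<Sum>x\<in>?J. s (taylor_coeff 0 x) (?T 0 1 F (E 0 x (n - x))))"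
    proof (subst subst_eq_sum[of ?J])
      show "taylor_supp 1 2 (?T 0 1 F) (E 0 0 n) \<subseteq> ?J"
      proof
        fix x assume "x \<in> taylor_supp 1 2 (?T 0 1 F) (E 0 0 n)"
        hence "?T 0 1 F (E 0 x (n - x)) \<noteq> 0" by (simp add: subst_supp_def E del: One_nat_def)
        then obtain y where "F (E y (x - y) (n - x)) \<noteq> 0"
          unfolding T1 by (rule sum.not_neutral_contains_not_neutral)
        hence "y \<le> N" "x - y \<le> N" "n - x \<le> N" using F0[of y "x - y" "n - x"] by (meson not_le)+
        thus "x \<in> ?J" by simp
      qed
    qed (simp_all add: E del: One_nat_def)
    hence Z1: "?Z1 F (E 0 0 n) = (\<Sum>x\<in>?J. \<Sum>y\<in>?I. F (E y (x - y) (n - x)))"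
      unfolding T1 c0 by simp
    have T2: "?T 1 2 F (E y 0 (n - y)) = (\<Sum>x\<in>?J. F (E y (x - y) (n - x)))" for y
    proof -
      let ?D = "(\<lambda>x. x - y) ` ?J"
      have "?T 1 2 F (E y 0 (n - y)) = (\<Sum>z\<in>?D. s (taylor_coeff 0 z) (F (E y z (n - y - z))))"
      proof (subst subst_eq_sum[of ?D])
        show "taylor_supp 1 2 F (E y 0 (n - y)) \<subseteq> ?D"
        proof
          fix z assume "z \<in> taylor_supp 1 2 F (E y 0 (n - y))"
          hence "F (E y z (n - y - z)) \<noteq> 0" by (simp add: subst_supp_def E del: One_nat_def)
          hence "y \<le> N" "z \<le> N" "n - y - z \<le> N" using F0[of y z "n - y - z"] by (meson not_le)+
          thus "z \<in> ?D" by (intro image_eqI[of _ _ "z + y"]) simp_all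
        qed
      qed (simp_all add: E del: One_nat_def)
      also have "\<dots> = (\<Sum>x\<in>?J. F (E y (x - y) (n - x)))"
        unfolding c0 by (subst sum.reindex) (auto simp: inj_on_def)
      finally show ?thesis .
    qed
    have "?T 0 2 (?T 1 2 F) (E 0 0 n) = (\<Sum>y\<in>?I. s (taylor_coeff 0 y) (?T 1 2 F (E y 0 (n - y))))"
    proof (subst subst_eq_sum[of ?I])
      show "taylor_supp 0 2 (?T 1 2 F) (E 0 0 n) \<subseteq> ?I"
      proof
        fix y assume "y \<in> taylor_supp 0 2 (?T 1 2 F) (E 0 0 n)"
        hence "?T 1 2 F (E y 0 (n - y)) \<noteq> 0" by (simp add: subst_supp_def E del: One_nat_def)
        then obtain x where "F (E y (x - y) (n - x)) \<noteq> 0"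
          unfolding T2 by (rule sum.not_neutral_contains_not_neutral)
        hence "y \<le> N" "x - y \<le> N" "n - x \<le> N" using F0[of y "x - y" "n - x"] by (meson not_le)+
        thus "y \<in> ?I" by simp
      qed
    qed (simp_all add: E del: One_nat_def)
    hence Z2: "?T 0 2 (?T 1 2 F) (E 0 0 n) = (\<Sum>y\<in>?I. \<Sum>x\<in>?J. F (E y (x - y) (n - x)))"
      unfolding T2 c0 by simp
    \<comment> \<open>Negative \<open>d\<close> has coefficient 0, and positive \<open>d\<close>
      leads to the negative exponent \<open>- d\<close> of \<open>x_1\<close>.\<close>
    have "?Z2 F (E 0 0 n) = (\<Sum>d\<in>{0}. s (binom_coeff 0 d) (?T 0 2 (?T 1 2 F) (E d (- d) n)))"
    proof (subst subst_eq_sum[of "{0}"])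
      show "subst_supp binom_coeff 0 1 (?T 0 2 (?T 1 2 F)) (E 0 0 n) \<subseteq> {0}"
      proof
        fix d assume "d \<in> subst_supp binom_coeff 0 1 (?T 0 2 (?T 1 2 F)) (E 0 0 n)"
        hence d: "binom_coeff 0 d \<noteq> 0" "?T 0 2 (?T 1 2 F) (E d (- d) n) \<noteq> 0"
          by (simp_all add: subst_supp_def E del: One_nat_def)
        have "\<not> d < 0" using d(1) binom_coeff_eq_0(1) by blast
        moreover have "?T 0 2 (?T 1 2 F) (E d (- d) n) = 0" if "d > 0"
          using that by - (rule subst_eq_0, rule subst_taylor_neg, simp add: E del: One_nat_def)
        hence "\<not> d > 0" using d(2) by blast
        ultimately show "d \<in> {0}" by simp
      qed
    qed (simp_all add: E del: One_nat_def)
    hence "?Z2 F (E 0 0 n) = ?T 0 2 (?T 1 2 F) (E 0 0 n)"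
      by (simp add: binom_coeff_def c0)
    also have "\<dots> = ?Z1 F (E 0 0 n)" unfolding Z1 Z2 by (rule sum.swap)
    finally show ?thesis using eE by simp
  qed
  have dvD: "s (of_int (e i)) (A e) = dv i A (e(i := e i - 1))" for A and e :: "nat \<Rightarrow> int" and i
    by (simp add: dv_def)
  \<comment> \<open>\<open>F\<close> varies in the induction because the hypothesis is applied to
    its derivatives. A differential equation gives the coefficient times its positive exponent,
    which can be divided out over the complex numbers.\<close>
  have "Bd {0, 1, 2} F \<Longrightarrow> e 0 = int p \<Longrightarrow> e 1 = int q \<Longrightarrow> ?Z1 F e = ?Z2 F e" for p q F e
  proof (induction q arbitrary: p F e)
    case 0
    thus ?case
    proof (induction p arbitrary: F e)
      case 0
      thus ?case by (intro base) simp_all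
    next
      case (Suc p)
      have "s (of_int (e 0)) (?Z1 F e) = ?Z1 (dv 0 F) (e(0 := e 0 - 1))"
        unfolding dvD Z10[OF Suc.prems(1)] ..
      also have "\<dots> = ?Z2 (dv 0 F) (e(0 := e 0 - 1))"
        by (rule Suc.IH) (use Suc.prems in \<open>simp_all add: Bd_dv\<close>)
      also have "\<dots> = s (of_int (e 0)) (?Z2 F e)"
        unfolding dvD Z20[OF Suc.prems(1)] ..
      finally show ?case using Suc.prems(2) by (simp add: scale_cancel_left del: of_nat_Suc)
    qed
  next
    case (Suc q)
    let ?e = "e(1 := e 1 - 1)"
    have "s (of_int (e 1)) (?Z1 F e) = ?Z1 (dv 0 F) ?e + ?Z1 (dv 1 F) ?e"
      unfolding dvD Z11[OF Suc.prems(1)] ..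
    also have "?Z1 (dv 0 F) ?e = ?Z2 (dv 0 F) ?e"
      by (rule Suc.IH[where p = p]) (use Suc.prems in \<open>simp_all add: Bd_dv\<close>)
    also have "?Z1 (dv 1 F) ?e = ?Z2 (dv 1 F) ?e"
      by (rule Suc.IH[where p = p]) (use Suc.prems in \<open>simp_all add: Bd_dv\<close>)
    also have "?Z2 (dv 0 F) ?e + ?Z2 (dv 1 F) ?e = s (of_int (e 1)) (?Z2 F e)"
      unfolding dvD Z21[OF Suc.prems(1)] ..
    finally show ?case using Suc.prems(3) by (simp add: scale_cancel_left del: of_nat_Suc)
  qed
  note nonneg = this[OF assms]
  show ?thesis
  proof
    fix e
    show "?Z1 F e = ?Z2 F e"
    proof (cases "e 0 < 0 \<or> e 1 < 0")
      case True
      thus ?thesis using neg1[OF True] neg2[OF True] by simp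
    next
      case False
      thus ?thesis by (intro nonneg[where p = "nat (e 0)" and q = "nat (e 1)"]) simp_all
    qed
  qed
qed

text \<open>By uniqueness, since the combination solves the defining relation. The hypothesis speaks
  of products rather than factors, so linearity in either argument is an instance.\<close>

lemma Y_Eo_lincomb:
  assumes E: "a \<in> Eo s" "c \<in> Eo s" "a1 \<in> Eo s" "b1 \<in> Eo s" "a2 \<in> Eo s" "b2 \<in> Eo s"
    and p: "p \<noteq> 0" "pair p a1 b1" "pair p a2 b2"
    and eq: "\<And>w. op_prod a c w = (\<lambda>m n. s x (op_prod a1 b1 w m n) + s y (op_prod a2 b2 w m n))"
  shows "Y_Eo s a c k = (\<lambda>w n. s x (Y_Eo s a1 b1 k w n) + s y (Y_Eo s a2 b2 k w n))"
proof
  fix w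
  have lin: "(\<lambda>m n. s x (A m n) + s y (B m n)) \<in> laurent_inf2" "(\<lambda>m n. s x (A m n)) \<in> laurent_inf2"
    if "A \<in> laurent_inf2" "B \<in> laurent_inf2" for x y A B
    using Bd_add[OF Bd_act Bd_act, of "{0, 1}" "emb2 A" "emb2 B" "mconst x" "mconst y"]
      Bd_act[of "{0, 1}" "emb2 A" "mconst x"] that
    by (simp_all add: laurent_inf2_Bd emb2_def act_mconst)
  have pair: "pair p a c"
    unfolding pair_iff[OF E(1,2)] eq pmul_add_right pmul_scale_right by (intro allI lin pairD p)
  show "Y_Eo s a c k w = (\<lambda>n. s x (Y_Eo s a1 b1 k w n) + s y (Y_Eo s a2 b2 k w n))"
  proof (rule Y_Eo_unique[OF E(1,2) p(1) pair])
    show "(\<lambda>k n. s x (Y_Eo s a1 b1 k w n) + s y (Y_Eo s a2 b2 k w n)) \<in> LL"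
      by (intro LL_add LL_scale Y_Eo_LL[OF _ _ p(1)] E p)
    show "pmul s (pcompose p (var1 + var2)) (\<lambda>k n. s x (Y_Eo s a1 b1 k w n) + s y (Y_Eo s a2 b2 k w n)) =
        taylor_subst s (pmul s p (op_prod a c w))"
      unfolding eq pmul_add_right pmul_scale_right
      using Y_Eo_char(3)[OF E(3,4) p(1,2,2)] Y_Eo_char(3)[OF E(5,6) p(1,3,3)]
        lin(2)[OF pairD[OF p(2)] pairD[OF p(2)]] lin(2)[OF pairD[OF p(3)] pairD[OF p(3)]]
      by (simp add: taylor_add taylor_scale pairD p)
  qed
qed

lemma Y_Eo_zero:
  assumes "a \<in> Eo s"
  shows "Y_Eo s a 0 k = 0" "Y_Eo s 0 a k = 0"
proof -
  have 0: "Y_Eo s a b k = 0" if E: "a \<in> Eo s" "b \<in> Eo s" and z: "\<And>w. op_prod a b w = (\<lambda>m n. 0)" for a b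
  proof -
    have "pair 1 a b" unfolding pair_iff[OF E] z by (simp add: pmul_def laurent_inf2_def)
    \<comment> \<open>A vanishing product is the combination of itself with itself with coefficients
      0.\<close>
    hence "Y_Eo s a b k = (\<lambda>w n. s 0 (Y_Eo s a b k w n) + s 0 (Y_Eo s a b k w n))"
      by (intro Y_Eo_lincomb[OF E E E, of 1]) (simp_all add: z)
    thus ?thesis by (simp add: zero_fun_def)
  qed
  have E0: "0 \<in> Eo s" by (simp add: Eo_iff laurent_inf_def)
  show "Y_Eo s a 0 k = 0" "Y_Eo s 0 a k = 0"
    by (rule 0; use assms E0 in \<open>simp add: op_prod_def Eo_zero fun_eq_iff\<close>)+
qed

lemma pmul_one: "pmul s 1 A = A"
  by (rule emb2_eqD) (simp add: emb2_pmul ev2_simps act_one)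

lemma taylor_eq_sum:
  assumes "\<And>d. d \<notin> D \<Longrightarrow> A (k + d) (n - d) = 0" "finite D"
  shows "taylor_subst s A k n = (\<Sum>d\<in>D. s (taylor_coeff k d) (A (k + d) (n - d)))"
proof -
  let ?e = "\<lambda>x::nat. if x = 0 then k else n"
  have "taylor_subst s A k n = emb2 (taylor_subst s A) ?e" by (simp add: emb2_def)
  also have "\<dots> = taylor 0 1 (emb2 A) ?e" by (simp only: emb2_taylor)
  also have "\<dots> = (\<Sum>d\<in>D. s (taylor_coeff k d) (A (k + d) (n - d)))"
    by (subst subst_eq_sum[OF assms(2)]) (use assms(1) in \<open>auto simp: subst_supp_def emb2_def\<close>)
  finally show ?thesis .
qed

lemma pair_id:
  assumes "v \<in> Eo s"
  shows "pair 1 id_op v" "pair 1 v id_op"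
proof -
  have "op_prod id_op v w \<in> laurent_inf2" "op_prod v id_op w \<in> laurent_inf2" for w
  proof -
    have "v w \<in> laurent_inf" using assms by (simp add: Eo_iff)
    then obtain N where "\<And>n. v w n \<noteq> 0 \<Longrightarrow> n \<le> N" unfolding laurent_inf_def by blast
    hence "\<forall>m n. op_prod id_op v w m n \<noteq> 0 \<longrightarrow> m \<le> max 0 N \<and> n \<le> max 0 N"
      "\<forall>m n. op_prod v id_op w m n \<noteq> 0 \<longrightarrow> m \<le> max 0 N \<and> n \<le> max 0 N"
      by (auto simp: op_prod_def id_op_def Eo_zero[OF assms] le_max_iff_disj split: if_splits)
    thus "op_prod id_op v w \<in> laurent_inf2" "op_prod v id_op w \<in> laurent_inf2"
      unfolding laurent_inf2_def by blast+
  qed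
  thus "pair 1 id_op v" "pair 1 v id_op"
    by (simp_all add: pair_iff Eo_id assms pmul_one)
qed

lemma Y_Eo_id_left:
  assumes "v \<in> Eo s"
  shows "Y_Eo s id_op v k = (if k = 0 then v else 0)"
proof
  fix w
  have op: "op_prod id_op v w = (\<lambda>m n. if m = 0 then v w n else 0)"
    by (simp add: op_prod_def id_op_def)
  have v: "v w \<in> laurent_inf" using assms by (simp add: Eo_iff)
  note pair = pair_id(1)[OF assms]
  have "Y_Eo s id_op v k w = (if k = 0 then v w else 0)"
  proof (rule Y_Eo_unique[OF Eo_id assms _ pair])
    have "\<exists>M. \<forall>k<M. (if k = (0::int) then v w else 0) = 0" by (rule exI[of _ 0]) simp
    moreover have "(if k = 0 then v w else 0) \<in> laurent_inf" for k :: int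
      using v by (simp add: laurent_inf_def)
    ultimately show "(\<lambda>k. if k = 0 then v w else 0) \<in> LL" unfolding LL_def by blast
    \<comment> \<open>Only \<open>d = - k\<close> meets the support, and then the coefficient is 0
      choose \<open>k\<close>, which is 0 for positive \<open>k\<close>.\<close>
    have "taylor_subst s (op_prod id_op v w) k n = (if k = 0 then v w n else 0)" for k n
      by (subst taylor_eq_sum[of "{- k}"]) (auto simp: op taylor_coeff_def gbinomial_0_left)
    thus "pmul s (pcompose 1 (var1 + var2)) (\<lambda>k. if k = 0 then v w else 0) =
        taylor_subst s (pmul s 1 (op_prod id_op v w))"
      by (auto simp: pcompose_1 pmul_one fun_eq_iff)
  qed simp
  thus "Y_Eo s id_op v k w = (if k = 0 then v else 0) w" by simp
qed

lemma Y_Eo_id_right: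
  assumes "v \<in> Eo s"
  shows "k < 0 \<Longrightarrow> Y_Eo s v id_op k = 0" "Y_Eo s v id_op 0 = v"
proof -
  have op: "op_prod v id_op w = (\<lambda>m n. if n = 0 then v w m else 0)" for w
    using assms by (auto simp: op_prod_def id_op_def Eo_zero fun_eq_iff)
  note pair = pair_id(2)[OF assms]
  have "(\<lambda>k n. Y_Eo s v id_op k w n) = taylor_subst s (op_prod v id_op w)" for w
    using Y_Eo_char(3)[OF assms Eo_id _ pair pair, of w] by (simp add: pcompose_1 pmul_one)
  hence Y: "Y_Eo s v id_op k w n = taylor_subst s (op_prod v id_op w) k n" for k w n
    by (simp add: fun_eq_iff)
  show "k < 0 \<Longrightarrow> Y_Eo s v id_op k = 0" by (simp add: fun_eq_iff Y taylor_neg)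
  have "taylor_subst s (op_prod v id_op w) 0 n = v w n" for w n
    by (subst taylor_eq_sum[of "{n}"]) (auto simp: op taylor_coeff_def)
  thus "Y_Eo s v id_op 0 = v" by (simp add: fun_eq_iff Y)
qed

lemma quasi_compatible_pair:
  assumes "quasi_compatible s V" "a \<in> V" "b \<in> V"
  shows "\<exists>p. p \<noteq> 0 \<and> pair p a b" "a \<in> Eo s" "\<exists>M. \<forall>k<M. Y_Eo s a b k = 0"
proof -
  have "Pcompat {p. p \<noteq> 0} [a, b]" using assms unfolding quasi_compatible_iff by simp
  then obtain p where p: "p \<noteq> 0" "pair p a b" and E: "a \<in> Eo s" "b \<in> Eo s"
    using compat_via_pair[of a b] by (auto simp: Pcompat_def)
  thus "\<exists>p. p \<noteq> 0 \<and> pair p a b" "a \<in> Eo s" by blast+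
  show "\<exists>M. \<forall>k<M. Y_Eo s a b k = 0" by (rule Y_Eo_char(2)[OF E p])
qed

text \<open>The first distribution is a Laurent series in \<open>x\<^sub>1\<close> over Laurent series in \<open>x\<^sub>0\<close>, the second
  one conversely, so that a common factor cannot be cancelled in a common module.  If however
  the multiples coincide and are regular in \<open>x\<^sub>0\<close>, \<open>x\<^sub>1\<close>, then each distribution is regular
  itself.\<close>

lemma cancel_opposite_expansions:
  assumes h: "h \<noteq> 0"
    and A: "lex_below 1 0 A" "bdd_in 2 A" and B: "lex_below 0 1 B" "bdd_in 2 B"
    and AE: "act (ev1 h (mvar 2) + mvar 0 * K + mvar 1 * K') A = E"
    and BE: "act (ev1 h (mvar 2) + mvar 0 * K + mvar 1 * K') B = E"
    and E: "\<And>e. e 0 < 0 \<or> e 1 < 0 \<Longrightarrow> E e = 0"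
  shows "A = B"
proof
  let ?U = "ev1 h (mvar 2) + mvar 0 * K + mvar 1 * K'"
  \<comment> \<open>\<open>A\<close> has \<open>x_1\<close> as its outer variable, so the two ideal
    terms trade places.\<close>
  have U': "?U = ev1 h (mvar 2) + mvar 1 * K' + mvar 0 * K" by (simp add: algebra_simps)
  let ?D = "\<lambda>e::nat \<Rightarrow> int. e 0 < 0 \<or> e 1 < 0"
  have A0: "A e = 0" if "?D e" for e
  proof (rule lex_cancel[where D = ?D, OF h _ _ A(2,1)])
    show "act (ev1 h (mvar 2) + mvar 1 * K' + mvar 0 * K) A e = 0" if "?D e" for e
      unfolding U'[symmetric] AE by (rule E[OF that])
  qed (use that in auto)
  have B0: "B e = 0" if "?D e" for e
  proof (rule lex_cancel[where D = ?D, OF h _ _ B(2,1)])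
    show "act ?U B e = 0" if "?D e" for e unfolding BE by (rule E[OF that])
  qed (use that in auto)
  have low: "lex_below 0 1 (\<lambda>e. A e - B e)"
  proof (rule lex_belowI[of _ 0])
    show "A e - B e = 0" if "e 0 < 0" for e using A0[of e] B0[of e] that by simp
    show "\<exists>M. \<forall>e. e 0 = m \<longrightarrow> e 1 < M \<longrightarrow> A e - B e = 0" for m
      by (rule exI[of _ 0]) (simp add: A0 B0)
  qed
  fix e
  have "A e - B e = 0"
  proof (rule lex_cancel[where D = "\<lambda>_. True", OF h _ _ bdd_in_diff[OF A(2) B(2)] low])
    show "act ?U (\<lambda>e. A e - B e) e = 0" for e unfolding act_diff_right AE BE by simp
  qed simp_all
  thus "A e = B e" by simp
qed

lemma sum_apply: "(sum f I) x = (\<Sum>i\<in>I. f i x)"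
  by (induction I rule: infinite_finite_induct) simp_all

lemma pmul_eval: "pmul (pscale (pscale s)) p A m n z x = pmul s p (\<lambda>m n. A m n z x) m n"
  by (simp add: pmul_def sum_apply pscale_def)

text \<open>Both iterates come from \<open>u(x_0)v(x_1)w(x_2)\<close>. For \<open>C2\<close>,
  \<open>x_1\<close> and then \<open>x_0\<close> is shifted by \<open>x_2\<close>; for
  \<open>D2\<close>, \<open>x_0\<close> is shifted by \<open>x_1\<close> and then \<open>x_1\<close>
  by \<open>x_2\<close>. Expanding \<open>C2\<close> at \<open>x_0+x_1\<close> gives
  \<open>B2\<close>, and by \<open>subst_assoc\<close> its multiple by \<open>?P\<close> is that of
  \<open>D2\<close>.\<close>

lemma weak_associativity:
  assumes V: "quasi_compatible s V" "Y_closed s V" and uvw: "u \<in> V" "v \<in> V" "w \<in> V"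
  shows "\<exists>l::nat. pmul (pscale (pscale s)) ((var1 + var2) ^ l)
      (binom_subst (pscale (pscale s)) (op_prod (Y_Eo s u) (Y_Eo s v) w)) =
    pmul (pscale (pscale s)) ((var1 + var2) ^ l) (\<lambda>k n. Y_Eo s (Y_Eo s u v k) w n)"
proof -
  let ?Y = "Y_Eo s"
  let ?T = taylor
  note Yc = Y_closedD[OF V(2)] and E = quasi_compatible_pair(2)[OF V(1)] and P = quasi_compatible_pair(1)[OF V(1)]
  have Eu: "u \<in> Eo s" and Ev: "v \<in> Eo s" and Ew: "w \<in> Eo s" using uvw E by blast+
  note low = quasi_compatible_pair(3)[OF V(1)]
  have "Pcompat {p. p \<noteq> 0} [u, v, w]" using V(1) uvw unfolding quasi_compatible_iff by simp
  then obtain p1 where p1: "p1 \<noteq> 0" "compat_via s p1 [u, v, w]" unfolding Pcompat_def by blast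
  obtain p2 where p2: "p2 \<noteq> 0" "pair p2 u v" using P[OF uvw(1,2)] by blast
  obtain p3 where p3: "p3 \<noteq> 0" "pair p3 v w" using P[OF uvw(2,3)] by blast
  \<comment> \<open>A common choice for the triple and for the two pairs that are merged at the
    start. Pairs that contain a mode get their own denominators later.\<close>
  define f where "f = p1 * p2 * p3"
  have f: "f \<noteq> 0" using p1 p2 p3 by (simp add: f_def)
  have fuv: "pair f u v" using pair_mult[OF Eu Ev p2(2), of "p1 * p3"] by (simp add: f_def mult_ac)
  have fvw: "pair f v w" using pair_mult[OF Ev Ew p3(2), of "p1 * p2"] by (simp add: f_def mult_ac)
  have "compat_via s f [u, v, w]"
    using compat_via_mult[OF _ p1(2), of "p2 * p3"] Eu Ev Ew by (simp add: f_def mult_ac)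
  hence "compat_on f [u, v, w] [0, 1, 2]"
    using compat_via_iff[of "[0, 1, 2]" "[u, v, w]" f] Eu Ev Ew by simp
  moreover define f01 where "f01 = at2 0 1 f"
  moreover define f02 where "f02 = at2 0 2 f"
  moreover define f12 where "f12 = at2 1 2 f"
  moreover define A where "A = (\<lambda>z (e :: nat \<Rightarrow> int). u (v (w z (e 2)) (e 1)) (e 0))"
  moreover have "op_series [u, v, w] [0, 1, 2] z = A z" for z
    by (simp add: op_series_def A_def op_prod_list_def fun_eq_iff)
  ultimately have FB: "Bd {0, 1, 2} (act (f01 * f02 * f12) (A z))" for z
    unfolding compat_on_def by simp
  define F where "F = (\<lambda>z. act (f01 * f02 * f12) (A z))"
  have F: "Bd {0, 1, 2} (F z)" for z unfolding F_def by (rule FB)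
  \<comment> \<open>These are \<open>x_0\<close>, \<open>x_2\<close> and x of the overview, in this
    order.\<close>
  let ?x0 = "mvar 0" and ?x1 = "mvar 1" and ?x2 = "mvar 2"
  define C1 where "C1 = (\<lambda>z (e :: nat \<Rightarrow> int). u (?Y v w (e 1) z (e 2)) (e 0))"
  define C2 where "C2 = (\<lambda>z (e :: nat \<Rightarrow> int). ?Y u (?Y v w (e 1)) (e 0) z (e 2))"
  define D1 where "D1 = (\<lambda>z (e :: nat \<Rightarrow> int). ?Y u v (e 0) (w z (e 2)) (e 1))"
  define D2 where "D2 = (\<lambda>z (e :: nat \<Rightarrow> int). ?Y (?Y u v (e 0)) w (e 1) z (e 2))"
  let ?P = "ev2 f (?x0 + (?x1 + ?x2)) ?x2 * ev2 f (?x1 + ?x2) ?x2 * ev2 f (?x0 + (?x1 + ?x2)) (?x1 + ?x2)"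
  let ?G2 = "ev2 f (?x0 + ?x2) ?x2 * ev2 f (?x1 + ?x2) ?x2 * ev2 f (?x0 + ?x2) (?x1 + ?x2)"
  have id_lin: "Vector_Spaces.linear s s (\<lambda>z. z)"
    unfolding Vector_Spaces.linear_iff using vector_space_axioms by simp
  note subst_intros = subst_rel_mult subst_rel_ev2 subst_rel_add
  have Yabove: "?Y a b k z \<in> laurent_inf" if "a \<in> V" "b \<in> V" for a b k z
    using E[OF Yc[OF that] Yc[OF that]] by (simp add: Eo_iff)
  obtain Mv where Mv: "\<And>k. k < Mv \<Longrightarrow> ?Y v w k = 0" using low[OF uvw(2,3)] by blast
  obtain Mu where Mu: "\<And>k. k < Mu \<Longrightarrow> ?Y u v k = 0" using low[OF uvw(1,2)] by blast
  have C2low: "C2 z e = 0" if "e 1 < Mv" for z e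
    unfolding C2_def using Mv[OF that] by (simp add: Y_Eo_zero[OF Eu])
  have D2low: "D2 z e = 0" if "e 0 < Mu" for z e
    unfolding D2_def using Mu[OF that] by (simp add: Y_Eo_zero[OF Ew])
  have C2lev: "\<exists>M. \<forall>e. e 1 = m \<longrightarrow> e 0 < M \<longrightarrow> C2 z e = 0" for m z
  proof -
    obtain M where "\<forall>k<M. ?Y u (?Y v w m) k = 0" using low[OF uvw(1) Yc[OF uvw(2,3)]] by blast
    thus ?thesis by (intro exI[of _ M]) (auto simp: C2_def)
  qed
  have D2lev: "\<exists>M. \<forall>e. e 0 = m \<longrightarrow> e 1 < M \<longrightarrow> D2 z e = 0" for m z
  proof -
    obtain M where "\<forall>k<M. ?Y (?Y u v m) w k = 0" using low[OF Yc[OF uvw(1,2)] uvw(3)] by blast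
    thus ?thesis by (intro exI[of _ M]) (auto simp: D2_def)
  qed
  have C2above: "bdd_in 2 (C2 z)" for z
    unfolding bdd_in_def C2_def using Yabove[OF uvw(1) Yc[OF uvw(2,3)]] by (simp add: laurent_inf_iff)
  have D2above: "bdd_in 2 (D2 z)" for z
    unfolding bdd_in_def D2_def using Yabove[OF Yc[OF uvw(1,2)] uvw(3)] by (simp add: laurent_inf_iff)
  have C2eq: "act ?G2 (C2 z) = ?T 0 2 (?T 1 2 (F z))" for z
  proof -
    \<comment> \<open>The image of \<open>f01 * f02 * f12\<close> when \<open>x_1\<close> becomes
      \<open>x_1+x_2\<close>; replacing \<open>x_0\<close> by \<open>x_0+x_2\<close> turns it into
      \<open>?G2\<close>. Levels are taken in \<open>x_1\<close>, the variable that indexes the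
      modes of \<open>v\<close> on \<open>w\<close>.\<close>
    let ?G1 = "f02 * ev2 f (?x1 + ?x2) ?x2 * ev2 f ?x0 (?x1 + ?x2)"
    have ctx: "subst_to 1 2 (act f12 (A z)) (act (at2_shift 1 2 f) (C1 z)) e" for e
      unfolding f12_def
      using Y_Eo_context[of 1 2 v w f f "\<lambda>z. u z (e 0)" "C1 z" e z "A z",
          OF _ Ev Ew f fvw fvw Eo_linear[OF Eu]]
      by (simp add: C1_def A_def)
    have rel: "taylor_rel 1 2 (f02 * f01) (f02 * ev2 f ?x0 (?x1 + ?x2))"
      unfolding f02_def f01_def
      by (intro subst_intros subst_rel_other subst_rel_base subst_rel_var pascal_taylor) simp_all
    have "act ?G1 (C1 z) = act (f02 * ev2 f ?x0 (?x1 + ?x2)) (act (at2_shift 1 2 f) (C1 z))"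
      unfolding act_mult[symmetric] by (simp only: mult_ac)
    moreover have "F z = act (f02 * f01) (act f12 (A z))"
      unfolding F_def act_mult[symmetric] by (simp only: mult_ac)
    ultimately have C1: "act ?G1 (C1 z) = ?T 1 2 (F z)"
      using subst_to_act[OF allI[OF ctx] rel] unfolding subst_to_all by simp
    have bd: "Bd (insert 2 {0}) (?T 1 2 (F z))"
      by (rule Bd_subst_taylor) (use F in \<open>simp_all add: insert_commute\<close>)
    show ?thesis
    proof (rule subst_levels[where l = 1 and M = Mv and C = "C1 z" and G = ?G1])
      show "C1 z e = 0" if "e 1 < Mv" for e
        unfolding C1_def using Mv[OF that] by (simp add: Eo_zero[OF Eu])
      show "C2 z e = 0" if "e 1 < Mv" for e by (rule C2low) (rule that)
      show "act ?G1 (C1 z) = ?T 1 2 (F z)" by (rule C1)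
      show "Bd {0, 2} (?T 1 2 (F z))" using bd by (simp add: insert_commute)
      show "\<exists>M. \<forall>e. e 1 = n \<longrightarrow> e 0 < M \<longrightarrow> C2 z e = 0" for n by (rule C2lev)
      show "taylor_rel 0 2 ?G1 ?G2"
        unfolding f02_def
        by (intro subst_intros subst_rel_other subst_rel_base subst_rel_var pascal_taylor) simp_all
      fix n
      obtain q where q: "q \<noteq> 0" "pair q u (?Y v w n)" using P[OF uvw(1) Yc[OF uvw(2,3)]] by blast
      have "subst_to 0 2 (act (at2 0 2 q) (C1 z)) (act (at2_shift 0 2 q) (C2 z)) e" if "e 1 = n" for e
        using Y_Eo_context[of 0 2 u "?Y v w n" q q "\<lambda>z. z" "C2 z" e z "C1 z",
            OF _ Eu E[OF Yc[OF uvw(2,3)] uvw(1)] q q(2) id_lin] that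
        by (simp add: C1_def C2_def)
      thus "\<exists>q. q \<noteq> 0 \<and> (\<forall>e. e 1 = n \<longrightarrow>
          subst_to 0 2 (act (at2 0 2 q) (C1 z)) (act (at2_shift 0 2 q) (C2 z)) e)"
        using q(1) by blast
    qed (simp_all add: C2above)
  qed
  have D2eq: "act ?P (D2 z) = ?T 1 2 (?T 0 1 (F z))" for z
  proof -
    \<comment> \<open>The image of the same product when \<open>x_0\<close> becomes
      \<open>x_0+x_1\<close>. This time the modes of \<open>u\<close> on \<open>v\<close> are
      indexed by \<open>x_0\<close>, which is the level variable.\<close>
    let ?G1 = "ev2 f (?x0 + ?x1) ?x2 * f12 * ev2 f (?x0 + ?x1) ?x1"
    have ctx: "subst_to 0 1 (act f01 (A z)) (act (at2_shift 0 1 f) (D1 z)) e" for e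
      unfolding f01_def
      using Y_Eo_context[of 0 1 u v f f "\<lambda>z. z" "D1 z" e "w z (e 2)" "A z",
          OF _ Eu Ev f fuv fuv id_lin]
      by (simp add: D1_def A_def)
    have rel: "taylor_rel 0 1 (f02 * f12) (ev2 f (?x0 + ?x1) ?x2 * f12)"
      unfolding f02_def f12_def
      by (intro subst_rel_mult subst_rel_ev2 subst_rel_other[of 2] subst_rel_base subst_rel_var pascal_taylor) simp_all
    have "act ?G1 (D1 z) = act (ev2 f (?x0 + ?x1) ?x2 * f12) (act (at2_shift 0 1 f) (D1 z))"
      unfolding act_mult[symmetric] by (simp only: mult_ac)
    moreover have "F z = act (f02 * f12) (act f01 (A z))"
      unfolding F_def act_mult[symmetric] by (simp only: mult_ac)
    ultimately have D1: "act ?G1 (D1 z) = ?T 0 1 (F z)"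
      using subst_to_act[OF allI[OF ctx] rel] unfolding subst_to_all by simp
    have bd: "Bd (insert 1 {2}) (?T 0 1 (F z))"
      by (rule Bd_subst_taylor) (use F in simp_all)
    show ?thesis
    proof (rule subst_levels[where l = 0 and M = Mu and C = "D1 z" and G = ?G1])
      show "D1 z e = 0" if "e 0 < Mu" for e
        unfolding D1_def using Mu[OF that] by simp
      show "D2 z e = 0" if "e 0 < Mu" for e by (rule D2low) (rule that)
      show "act ?G1 (D1 z) = ?T 0 1 (F z)" by (rule D1)
      show "Bd {1, 2} (?T 0 1 (F z))" using bd by simp
      show "\<exists>M. \<forall>e. e 0 = n \<longrightarrow> e 1 < M \<longrightarrow> D2 z e = 0" for n by (rule D2lev)
      show "taylor_rel 1 2 ?G1 ?P"
        unfolding f12_def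
        by (intro subst_intros subst_rel_other[of 0] subst_rel_base subst_rel_var pascal_taylor) simp_all
      fix n
      obtain q where q: "q \<noteq> 0" "pair q (?Y u v n) w" using P[OF Yc[OF uvw(1,2)] uvw(3)] by blast
      have "subst_to 1 2 (act (at2 1 2 q) (D1 z)) (act (at2_shift 1 2 q) (D2 z)) e" if "e 0 = n" for e
        using Y_Eo_context[of 1 2 "?Y u v n" w q q "\<lambda>z. z" "D2 z" e z "D1 z",
            OF _ E[OF Yc[OF uvw(1,2)] uvw(1)] Ew q q(2) id_lin] that
        by (simp add: D1_def D2_def)
      thus "\<exists>q. q \<noteq> 0 \<and> (\<forall>e. e 0 = n \<longrightarrow>
          subst_to 1 2 (act (at2 1 2 q) (D1 z)) (act (at2_shift 1 2 q) (D2 z)) e)"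
        using q(1) by blast
    qed (simp_all add: D2above)
  qed
  define B2 where "B2 = (\<lambda>z. subst binom_coeff 0 1 (C2 z))"
  have C2summ: "summ binom_coeff 0 1 (C2 z)" for z
    by (rule summ_binom[of _ _ Mv]) (simp_all add: C2low)
  have B2eq: "act ?P (B2 z) = ?T 1 2 (?T 0 1 (F z))" for z
  proof -
    have "subst_rel binom_coeff 0 1 ?G2 (ev2 f ((?x0 + ?x1) + ?x2) ?x2 * ev2 f (?x1 + ?x2) ?x2 *
        ev2 f ((?x0 + ?x1) + ?x2) (?x1 + ?x2))"
      by (intro subst_intros subst_rel_other[of 2] subst_rel_base subst_rel_var pascal_binom) simp_all
    from subst_relD(2)[OF this C2summ, of z] show ?thesis
      unfolding C2eq subst_assoc[OF F] B2_def by (simp only: add.assoc)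
  qed
  have C2lex: "lex_below 1 0 (C2 z)" for z by (rule lex_belowI) (rule C2low, assumption, rule C2lev)
  have D2lex: "lex_below 0 1 (D2 z)" for z by (rule lex_belowI) (rule D2low, assumption, rule D2lev)
  have B2nz: "\<exists>d. 0 \<le> d \<and> d \<le> e 1 - Mv \<and> C2 z (e(0 := e 0 + d, 1 := e 1 - d)) \<noteq> 0"
    if "B2 z e \<noteq> 0" for z e
  proof -
    from that obtain d where d: "binom_coeff (e 0) d \<noteq> 0" "C2 z (e(0 := e 0 + d, 1 := e 1 - d)) \<noteq> 0"
      unfolding B2_def by (rule subst_nonzero)
    have "\<not> d < 0" using d(1) binom_coeff_eq_0(1) by blast
    moreover have "\<not> e 1 - d < Mv" using d(2) C2low[where e = "e(0 := e 0 + d, 1 := e 1 - d)" and z = z] by auto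
    ultimately show ?thesis using d(2) by (intro exI[of _ d]) simp
  qed
  have B2lex: "lex_below 1 0 (B2 z)" for z
  proof -
    have "B2 z e = 0" if "e 1 < Mv" for e using B2nz[where e = e and z = z] that by force
    moreover have "\<exists>M. \<forall>e. e 1 = m \<longrightarrow> e 0 < M \<longrightarrow> B2 z e = 0" for m
    proof -
      obtain M where M: "\<And>e. e 1 \<le> m \<Longrightarrow> e 0 < M \<Longrightarrow> C2 z e = 0"
        using C2lex[of z] unfolding lex_below_def by blast
      \<comment> \<open>The binomial expansion reads \<open>C2\<close> at an exponent of
        \<open>x_0\<close> that exceeds \<open>e 0\<close> by at most \<open>m - Mv\<close>.\<close>
      have "B2 z e = 0" if "e 1 = m" "e 0 < M - (m - Mv)" for e
      proof (rule ccontr)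
        assume "B2 z e \<noteq> 0"
        then obtain d where d: "0 \<le> d" "d \<le> e 1 - Mv" "C2 z (e(0 := e 0 + d, 1 := e 1 - d)) \<noteq> 0"
          using B2nz by blast
        thus False using M[of "e(0 := e 0 + d, 1 := e 1 - d)"] that by simp
      qed
      thus ?thesis by blast
    qed
    ultimately show ?thesis by (intro lex_belowI) blast+
  qed
  have B2above: "bdd_in 2 (B2 z)" for z
    unfolding bdd_in_def
  proof
    fix e :: "nat \<Rightarrow> int"
    have "\<exists>N. \<forall>n>N. \<forall>d\<in>{0..e 1 - Mv}. C2 z ((e(0 := e 0 + d, 1 := e 1 - d))(2 := n)) = 0"
      by (rule finite_bound) (use C2above[of z] in \<open>simp_all add: bdd_in_def\<close>)
    then obtain N where N: "\<And>n d. n > N \<Longrightarrow> d \<in> {0..e 1 - Mv} \<Longrightarrow>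
        C2 z ((e(0 := e 0 + d, 1 := e 1 - d))(2 := n)) = 0" by blast
    have "B2 z (e(2 := n)) = 0" if "n > N" for n
    proof (rule ccontr)
      assume "B2 z (e(2 := n)) \<noteq> 0"
      from B2nz[OF this] obtain d where d: "0 \<le> d" "d \<le> e 1 - Mv"
        "C2 z ((e(2 := n))(0 := e 0 + d, 1 := e 1 - d)) \<noteq> 0" by auto
      have "(e(2 := n))(0 := e 0 + d, 1 := e 1 - d) = (e(0 := e 0 + d, 1 := e 1 - d))(2 := n)"
        by (auto simp: fun_eq_iff)
      thus False using N[OF that, of d] d by simp
    qed
    thus "\<exists>N. \<forall>n>N. B2 z (e(2 := n)) = 0" by blast
  qed
  obtain k h g where h: "h \<noteq> 0"
    and split: "\<forall>S Q. ev2 f (S + Q) Q = S ^ k * (ev1 h Q + S * ev2 g S Q)"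
    using ev2_shift_split[OF f] by (elim exE conjE)
  have "?x1 dvd ev1 h (?x1 + ?x2) - ev1 h ?x2"
    using cong_ev2[of ?x1 ?x1 ?x1 "?x1 + ?x2" ?x2 "[:h:]"] by (simp add: ev2_simps)
  then obtain K1 where K1: "ev1 h (?x1 + ?x2) = ev1 h ?x2 + ?x1 * K1"
    unfolding dvd_def by (metis add.commute diff_add_cancel)
  let ?U1 = "ev1 h ?x2 + (?x0 + ?x1) * ev2 g (?x0 + ?x1) ?x2"
  let ?U2 = "ev1 h ?x2 + ?x1 * ev2 g ?x1 ?x2"
  let ?U3 = "ev1 h (?x1 + ?x2) + ?x0 * ev2 g ?x0 (?x1 + ?x2)"
  \<comment> \<open>The factors of \<open>?P\<close> split with z equal to \<open>x_0+x_1\<close>,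
    \<open>x_1\<close> and \<open>x_0\<close> over the bases \<open>x_2\<close>, \<open>x_2\<close>
    and \<open>x_1+x_2\<close>. The powers of z are collected in \<open>?X\<close>; the other parts
    are all congruent to \<open>h(x_2)\<close> modulo \<open>x_0\<close> and
    \<open>x_1\<close>.\<close>
  let ?X = "?x0 ^ k * (?x1 ^ k * (?x0 + ?x1) ^ k)"
  have Psplit: "?P = (?U1 * ?U2 * ?U3) * ?X"
    unfolding add.assoc[symmetric, of ?x0 ?x1 ?x2]
    unfolding split[rule_format, of "?x0 + ?x1" ?x2] split[rule_format, of ?x1 ?x2]
    unfolding add.assoc[of ?x0 ?x1 ?x2] split[rule_format, of ?x0 "?x1 + ?x2"]
    by (simp only: mult_ac)
  have "\<exists>K K'. ?U1 * ?U2 * ?U3 = ev1 h ?x2 * ev1 h ?x2 * ev1 h ?x2 + ?x0 * K + ?x1 * K'"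
  proof (intro ideal2_mult)
    show "\<exists>K K'. ?U1 = ev1 h ?x2 + ?x0 * K + ?x1 * K'"
      by (intro exI[of _ "ev2 g (?x0 + ?x1) ?x2"]) (simp add: algebra_simps)
    show "\<exists>K K'. ?U2 = ev1 h ?x2 + ?x0 * K + ?x1 * K'"
      by (intro exI[of _ 0] exI[of _ "ev2 g ?x1 ?x2"]) (simp add: algebra_simps)
    show "\<exists>K K'. ?U3 = ev1 h ?x2 + ?x0 * K + ?x1 * K'"
      unfolding K1 by (intro exI[of _ "ev2 g ?x0 (?x1 + ?x2)"] exI[of _ K1]) (simp add: algebra_simps)
  qed
  then obtain K K' where U: "?U1 * ?U2 * ?U3 = ev1 (h * h * h) ?x2 + ?x0 * K + ?x1 * K'"
    unfolding ev1_simps by blast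
  have main: "act ((?x0 + ?x1) ^ k) (B2 z) = act ((?x0 + ?x1) ^ k) (D2 z)" for z
  proof -
    have "act ?X (B2 z) = act ?X (D2 z)"
    proof (rule cancel_opposite_expansions)
      show "h * h * h \<noteq> 0" using h by simp
      show "act (ev1 (h * h * h) ?x2 + ?x0 * K + ?x1 * K') (act ?X (B2 z)) = ?T 1 2 (?T 0 1 (F z))"
        "act (ev1 (h * h * h) ?x2 + ?x0 * K + ?x1 * K') (act ?X (D2 z)) = ?T 1 2 (?T 0 1 (F z))"
        unfolding U[symmetric] act_mult[symmetric, of _ ?X] Psplit[symmetric] by (rule B2eq D2eq)+
      show "?T 1 2 (?T 0 1 (F z)) e = 0" if "e 0 < 0 \<or> e 1 < 0" for e
      proof (cases "e 1 < 0")
        case False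
        thus ?thesis using that by - (rule subst_eq_0, rule subst_taylor_neg, simp)
      qed (rule subst_taylor_neg)
    qed (intro lex_below_act bdd_in_act B2lex D2lex B2above D2above)+
    \<comment> \<open>Powers of a single variable only shift exponents. What remains is
      \<open>(x_0+x_1)^k\<close>, so \<open>k\<close> is the witness for \<open>l\<close>.\<close>
    hence "act (?x1 ^ k * (?x0 + ?x1) ^ k) (B2 z) = act (?x1 ^ k * (?x0 + ?x1) ^ k) (D2 z)"
      unfolding act_mult[of "?x0 ^ k"] by (intro mvar_power_cancel[of 0 k]) simp
    thus ?thesis
      unfolding act_mult[of "?x1 ^ k"] by (intro mvar_power_cancel[of 1 k]) simp
  qed
  let ?S = "pscale (pscale s)"
  have B: "binom_subst ?S (op_prod (?Y u) (?Y v) w) m n z x = B2 z (e(0 := m, 1 := n))"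
    if e: "e 2 = x" for m n z x and e :: "nat \<Rightarrow> int"
  proof -
    let ?f = "\<lambda>j::nat. ?S (of_int (m + int j) gchoose j) (?Y u (?Y v w (n - int j)) (m + int j))"
    \<comment> \<open>\<open>Sum_any\<close> is taken in a space of operators. Beyond
      \<open>?J\<close> the summands vanish as operators, and a finite range independent of
      \<open>z\<close> and \<open>x\<close> allows evaluation term by term.\<close>
    let ?J = "{..nat (n - Mv)}"
    have z: "?Y u (?Y v w (n - int j)) (m + int j) = 0" if "j \<notin> ?J" for j
    proof -
      have "n - int j < Mv" using that by auto
      thus ?thesis using Mv by (simp add: Y_Eo_zero[OF Eu])
    qed
    have "Sum_any ?f = sum ?f ?J"
      by (rule Sum_any.expand_superset) (use z in \<open>auto simp: pscale_def zero_fun_def\<close>)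
    hence "binom_subst ?S (op_prod (?Y u) (?Y v) w) m n z x =
        (\<Sum>j\<in>?J. s (of_int (m + int j) gchoose j) (?Y u (?Y v w (n - int j)) (m + int j) z x))"
      unfolding binom_subst_def op_prod_def by (simp add: sum_apply pscale_def)
    also have "\<dots> = Sum_any (\<lambda>j::nat. s (of_int (m + int j) gchoose j) (?Y u (?Y v w (n - int j)) (m + int j) z x))"
    proof (rule Sum_any.expand_superset[symmetric])
      show "{j. s (of_int (m + int j) gchoose j) (?Y u (?Y v w (n - int j)) (m + int j) z x) \<noteq> 0} \<subseteq> ?J"
      proof (rule subsetI, rule ccontr)
        fix j assume "j \<in> {j. s (of_int (m + int j) gchoose j) (?Y u (?Y v w (n - int j)) (m + int j) z x) \<noteq> 0}"
          and "j \<notin> ?J"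
        thus False by (simp only: z mem_Collect_eq zero_fun_apply scale_zero_right simp_thms)
      qed
    qed simp
    also have "\<dots> = binom_subst s (\<lambda>m n. C2 z (e(0 := m, 1 := n))) m n"
      unfolding binom_subst_def C2_def using e by simp
    also have "\<dots> = B2 z (e(0 := m, 1 := n))"
      unfolding B2_def by (subst subst_binom) simp_all
    finally show ?thesis .
  qed
  have ev: "ev2 ((var1 + var2) ^ k) ?x0 ?x1 = (?x0 + ?x1) ^ k"
    by (simp add: ev2_power ev2_simps ev2_vars)
  have "pmul ?S ((var1 + var2) ^ k) (binom_subst ?S (op_prod (?Y u) (?Y v) w)) m n z x =
      pmul ?S ((var1 + var2) ^ k) (\<lambda>k n. ?Y (?Y u v k) w n) m n z x" for m n z x
  proof -
    define e where "e = (\<lambda>i::nat. if i = 0 then m else if i = 1 then n else x)"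
    have e: "e 0 = m" "e 1 = n" "e 2 = x" by (simp_all add: e_def)
    have "pmul s ((var1 + var2) ^ k) (\<lambda>m n. B2 z (e(0 := m, 1 := n))) m n =
        pmul s ((var1 + var2) ^ k) (\<lambda>m n. D2 z (e(0 := m, 1 := n))) m n"
      using act_ev2[of 0 1 "(var1 + var2) ^ k" _ e] fun_cong[OF main[of z], of e] unfolding ev e by simp
    moreover have "binom_subst ?S (op_prod (?Y u) (?Y v) w) a b z x = B2 z (e(0 := a, 1 := b))" for a b
      by (rule B) (rule e(3))
    ultimately show ?thesis unfolding pmul_eval by (simp add: D2_def e)
  qed
  thus ?thesis by (intro exI[of _ k] ext)
qed

section \<open>The vertex algebra and its modules\<close>

lemma nonlocal_vertex_algebra_closed:
  assumes K: "quasi_compatible_subspace s V" "Y_closed s V" and one: "id_op \<in> V"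
  shows "nonlocal_vertex_algebra (pscale (pscale s)) V (Y_Eo s) id_op"
proof -
  let ?S = "pscale (pscale s)"
  have V: "quasi_compatible s V" and sub: "module.subspace ?S V"
    using K by (simp_all add: quasi_compatible_subspace_def)
  have E: "a \<in> Eo s" if "a \<in> V" for a using quasi_compatible_pair(2)[OF V that that] .
  have add: "a + b \<in> V" if "a \<in> V" "b \<in> V" for a b
    using sub that unfolding module.subspace_def[OF module_pscale2] by blast
  have scale: "?S c a \<in> V" if "a \<in> V" for a c
    using sub that unfolding module.subspace_def[OF module_pscale2] by blast
  have common: "\<exists>p. p \<noteq> 0 \<and> pair p a b \<and> pair p c d" if abcd: "a \<in> V" "b \<in> V" "c \<in> V" "d \<in> V" for a b c d
  proof -
    obtain p where p: "p \<noteq> 0" "pair p a b" using quasi_compatible_pair(1)[OF V abcd(1,2)] by blast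
    obtain q where q: "q \<noteq> 0" "pair q c d" using quasi_compatible_pair(1)[OF V abcd(3,4)] by blast
    have "q * p \<noteq> 0" "pair (q * p) a b" "pair (q * p) c d"
      using pair_mult[OF E[OF abcd(1)] E[OF abcd(2)] p(2), of q]
        pair_mult[OF E[OF abcd(3)] E[OF abcd(4)] q(2), of p] p q by (simp_all add: mult.commute)
    thus ?thesis by blast
  qed
  have comb: "(\<lambda>w n. s x (a w n) + s y (b w n)) \<in> V" if "a \<in> V" "b \<in> V" for x y a b
    using add[OF scale[OF that(1), of x] scale[OF that(2), of y]] by (simp add: plus_fun_def pscale_def)
  have lin: "linear_on_set V ?S (pscale ?S) f"
    if f: "\<And>a b x y k. a \<in> V \<Longrightarrow> b \<in> V \<Longrightarrow>
      f (\<lambda>w n. s x (a w n) + s y (b w n)) k = (\<lambda>w n. s x (f a k w n) + s y (f b k w n))" for f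
    unfolding linear_on_set_def
  proof (intro conjI ballI allI)
    show "f (a + b) = f a + f b" if "a \<in> V" "b \<in> V" for a b
      using f[OF that, of 1 1] by (simp add: fun_eq_iff plus_fun_def)
    show "f (?S c a) = pscale ?S c (f a)" if "a \<in> V" for c a
      using f[OF that that, of c 0] by (simp add: fun_eq_iff pscale_def)
  qed
  have lin1: "linear_on_set V ?S (pscale ?S) (Y_Eo s u)" if u: "u \<in> V" for u
  proof (rule lin)
    fix a b x y k assume ab: "a \<in> V" "b \<in> V"
    obtain p where p: "p \<noteq> 0" "pair p u a" "pair p u b" using common[OF u ab(1) u ab(2)] by blast
    show "Y_Eo s u (\<lambda>w n. s x (a w n) + s y (b w n)) k =
        (\<lambda>w n. s x (Y_Eo s u a k w n) + s y (Y_Eo s u b k w n))"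
      by (rule Y_Eo_lincomb[OF E[OF u] E[OF comb[OF ab]] E[OF u] E[OF ab(1)] E[OF u] E[OF ab(2)] p])
        (use E[OF u] in \<open>simp add: op_prod_def Eo_iff\<close>)
  qed
  have lin2: "linear_on_set V ?S (pscale ?S) (\<lambda>u. Y_Eo s u v)" if v: "v \<in> V" for v
  proof (rule lin)
    fix a b x y k assume ab: "a \<in> V" "b \<in> V"
    obtain p where p: "p \<noteq> 0" "pair p a v" "pair p b v" using common[OF ab(1) v ab(2) v] by blast
    show "Y_Eo s (\<lambda>w n. s x (a w n) + s y (b w n)) v k =
        (\<lambda>w n. s x (Y_Eo s a v k w n) + s y (Y_Eo s b v k w n))"
      by (rule Y_Eo_lincomb[OF E[OF comb[OF ab]] E[OF v] E[OF ab(1)] E[OF v] E[OF ab(2)] E[OF v] p])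
        (simp add: op_prod_def)
  qed
  have "vector_space ?S" by (rule vector_space_pscale[OF vector_space_pscale[OF vector_space_axioms]])
  thus ?thesis
    unfolding nonlocal_vertex_algebra_def
    using sub one quasi_compatible_pair(3)[OF V] lin1 lin2 Y_closedD[OF K(2)] weak_associativity[OF V K(2)]
    by (simp add: Y_Eo_id_left[OF E] Y_Eo_id_right[OF E])
qed

text \<open>\<open>Y_Eo_char\<close> provides the relation for every \<open>p\<close> that makes the
  product regular, whichever one the definition of \<open>Y_Eo\<close> picked. This is what lets a
  power of \<open>x_1-x_2\<close> serve in the compatible case.\<close>

lemma module_relation_iff:
  assumes "u \<in> Eo s" "v \<in> Eo s" "p \<noteq> 0" "pair p u v"
  shows "module_relation (Y_Eo s) s (\<lambda>\<psi>. \<psi>) u v p"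
  unfolding module_relation_def using assms(4) Y_Eo_char(3)[OF assms(1-4,4)] by (simp add: pair_def)

lemma quasi_module_closed:
  assumes K: "quasi_compatible_subspace s V" "Y_closed s V" and one: "id_op \<in> V"
  shows "quasi_module_at_infinity (pscale (pscale s)) V (Y_Eo s) id_op s (\<lambda>\<psi>. \<psi>)"
proof -
  have V: "quasi_compatible s V" using K by (simp add: quasi_compatible_subspace_def)
  have E: "a \<in> Eo s" if "a \<in> V" for a using quasi_compatible_pair(2)[OF V that that] .
  have "\<exists>p. p \<noteq> 0 \<and> module_relation (Y_Eo s) s (\<lambda>\<psi>. \<psi>) u v p" if "u \<in> V" "v \<in> V" for u v
    using quasi_compatible_pair(1)[OF V that] module_relation_iff[OF E[OF that(1)] E[OF that(2)]] by blast
  thus ?thesis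
    unfolding quasi_module_at_infinity_def
    using nonlocal_vertex_algebra_closed[OF assms] vector_space_axioms E
    by (simp add: linear_on_set_def)
qed

text \<open>Powers of \<open>x_1-x_2\<close> form an admissible class, so generating from a
  compatible set never leaves it, and each pair of generated elements is made regular by such a
  power.\<close>

lemma module_generated:
  assumes "quasi_compatible s S" "compatible s S"
  shows "module_at_infinity (pscale (pscale s)) (generated S) (Y_Eo s) id_op s (\<lambda>\<psi>. \<psi>)"
  unfolding module_at_infinity_def
proof (intro conjI ballI)
  show "quasi_module_at_infinity (pscale (pscale s)) (generated S) (Y_Eo s) id_op s (\<lambda>\<psi>. \<psi>)"
    by (intro quasi_module_closed generated_quasi_compatible generated_closed generated.id_op assms(1))
  fix u v assume uv: "u \<in> generated S" "v \<in> generated S"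
  have P: "Pcompat (range (\<lambda>k. (var1 - var2) ^ k)) [u, v]"
    by (rule generated_Pcompat[OF admissible_diff compatible_Pcompat[OF assms(2)]]) (use uv in simp_all)
  then obtain k where k: "compat_via s ((var1 - var2) ^ k) [u, v]" and E: "u \<in> Eo s" "v \<in> Eo s"
    by (auto simp: Pcompat_def)
  have "(var1 - var2) ^ k \<noteq> 0" using admissible_diff unfolding admissible_def by force
  thus "\<exists>k. module_relation (Y_Eo s) s (\<lambda>\<psi>. \<psi>) u v ((var1 - var2) ^ k)"
    using module_relation_iff[OF E] compat_via_pair[OF E] k by blast
qed

end

theorem theorem3p11:
  fixes s :: "complex \<Rightarrow> 'w::ab_group_add \<Rightarrow> 'w"
  assumes "vector_space s"
  shows "(\<forall>K. maximal_quasi_compatible_subspace s K \<longrightarrow> Y_closed s K \<and> id_op \<in> K) \<and>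
    (\<forall>S. quasi_compatible s S \<longrightarrow>
       (\<exists>!K. is_smallest_closed s S K) \<and>
       nonlocal_vertex_algebra (pscale (pscale s)) (gen_closed s S) (Y_Eo s) id_op \<and>
       quasi_module_at_infinity (pscale (pscale s)) (gen_closed s S) (Y_Eo s) id_op s (\<lambda>\<psi>. \<psi>) \<and>
       faithful_on (gen_closed s S) (\<lambda>\<psi>. \<psi> :: 'w \<Rightarrow> int \<Rightarrow> 'w) \<and>
       (compatible s S \<longrightarrow>
          module_at_infinity (pscale (pscale s)) (gen_closed s S) (Y_Eo s) id_op s (\<lambda>\<psi>. \<psi>)))"
proof -
  interpret complex_space s by (rule complex_space.intro) fact
  have "(\<exists>!K. is_smallest_closed s S K) \<and>
       nonlocal_vertex_algebra (pscale (pscale s)) (gen_closed s S) (Y_Eo s) id_op \<and>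
       quasi_module_at_infinity (pscale (pscale s)) (gen_closed s S) (Y_Eo s) id_op s (\<lambda>\<psi>. \<psi>) \<and>
       faithful_on (gen_closed s S) (\<lambda>\<psi>. \<psi> :: 'w \<Rightarrow> int \<Rightarrow> 'w) \<and>
       (compatible s S \<longrightarrow>
          module_at_infinity (pscale (pscale s)) (gen_closed s S) (Y_Eo s) id_op s (\<lambda>\<psi>. \<psi>))"
    if S: "quasi_compatible s S" for S
  proof (unfold gen_closed_eq[OF S], intro conjI impI)
    note gen = generated_quasi_compatible[OF S] generated_closed generated.id_op
    show "\<exists>!K. is_smallest_closed s S K"
      using generated_smallest[OF S] is_smallest_unique by blast
    show "nonlocal_vertex_algebra (pscale (pscale s)) (generated S) (Y_Eo s) id_op"
      by (rule nonlocal_vertex_algebra_closed[OF gen])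
    show "quasi_module_at_infinity (pscale (pscale s)) (generated S) (Y_Eo s) id_op s (\<lambda>\<psi>. \<psi>)"
      by (rule quasi_module_closed[OF gen])
    show "faithful_on (generated S) (\<lambda>\<psi>. \<psi>)" by (simp add: faithful_on_def)
    show "module_at_infinity (pscale (pscale s)) (generated S) (Y_Eo s) id_op s (\<lambda>\<psi>. \<psi>)"
      if "compatible s S" by (rule module_generated[OF S that])
  qed
  thus ?thesis using maximal_closed by blast
qed

end
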